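(* There exists $\varepsilon>0$ such that the following holds for every $\mathfrak u=(p,q)\in\mathcal B_\varepsilon$. For each $n\in\mathbb Z_0:=\mathbb Z\setminus\{0\}$ the domain $\mathcal D_n$ contains exactly two zeros (counted with multiplicity) $r_n^-\le r_n^+$ of the entire function $\rho$ and exactly one eigenvalue $\mu_n$ of the operator $H_{dir}$, and this eigenvalue is simple. The domain $\mathcal D_0$ contains exactly two zeros $r_0^\pm$ of $\rho$ (counted with multiplicity). The operator $H_{dir}$ has no other eigenvalues in $\mathbb C$, and $\rho$ has no other zeros in $\mathbb C$. For all $n\in\mathbb Z_0$ the numbers $r_n^\pm$ and $\mu_n$ are real, $\mu_n\in[r_n^-,r_n^+]$, and $$r_n^\pm(\mathfrak u)=r_n^\pm(\mathfrak u^-)=-r_{-n}^\mp(\mathfrak u_* )=-r_{-n}^\mp(\mathfrak u_*^-),\qquad \mu_{-n}(\mathfrak u)=-\mu_n(\mathfrak u_*^-),$$ where $\mathfrak u_*=(p,-q)$, $\mathfrak u^-(x)=\mathfrak u(1-x)$, $\mathfrak u_*^-(x)=\mathfrak u_*(1-x)$.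
   Context: Let $\mathbb T=\mathbb R/\mathbb Z$, $\mathcal H=\{f\in L^2(\mathbb T)\text{ real-valued}:\int_0^1 f\,dx=0\}$, $\mathcal H_1=\{f: f,f'\in\mathcal H\}$, $\mathfrak H=\mathcal H_1\oplus\mathcal H$. For $\mathfrak u=(p,q)\in\mathfrak H$ and $\lambda\in\mathbb C$ consider the equation $y'''+(py)'+py'+qy=\lambda y$ on $\mathbb R$. Let $\varphi_1,\varphi_2,\varphi_3$ be its fundamental solutions with $\varphi_j^{(k-1)}(0,\lambda)=\delta_{jk}$, $j,k=1,2,3$, and let $M(\lambda)=(\varphi_j^{(k-1)}(1,\lambda))_{j,k=1}^3$ be the monodromy matrix (entire in $\lambda$). Its eigenvalues (Floquet multipliers) $\tau_1,\tau_2,\tau_3$ satisfy $\tau_1\tau_2\tau_3=1$, and $\rho=(\tau_1-\tau_2)^2(\tau_1-\tau_3)^2(\tau_2-\tau_3)^2$ is an entire function of $\lambda$. $H_{dir}$ is the operator $y\mapsto y'''+(py)'+py'+qy$ on $[0,2]$ with the 3-point conditions $y(0)=y(1)=y(2)=0$ (its spectrum is discrete). Throughout, $\lambda^{1/3}$ denotes the branch with $\arg\lambda^{1/3}\in(-\pi/3,\pi/3]$. For $n\ge0$, $\mathcal D_n=\{\lambda\in\mathbb C:|\lambda^{1/3}-\tfrac{2\pi n}{\sqrt3}|<\tfrac{2}{\sqrt3}\}$ and $\mathcal D_{-n}=\{\lambda:-\lambda\in\mathcal D_n\}$. $\mathcal B_\varepsilon=\{\mathfrak u=(p,q)\in\mathfrak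 H:\int_0^1(|p'|^2+|q|^2)dx<\varepsilon\}$. *)

theory Defs
  imports "HOL-Complex_Analysis.Complex_Analysis" "HOL-Library.Multiset"
begin

text \<open>Functions on the circle T = R/Z are represented as 1-periodic functions on R.\<close>

definition periodic1 :: "(real \<Rightarrow> real) \<Rightarrow> bool" where
  "periodic1 f \<longleftrightarrow> (\<forall>x. f (x + 1) = f x)"

definition in_calH :: "(real \<Rightarrow> real) \<Rightarrow> bool" where
  "in_calH f \<longleftrightarrow> periodic1 f \<and> f measurable_on {0..1} \<and> f integrable_on {0..1}
     \<and> (\<lambda>x. (f x)\<^sup>2) integrable_on {0..1} \<and> integral {0..1} f = 0"

text \<open>dp is a (weak) derivative of p: p is absolutely continuous with p' = dp a.e.\<close>
definition weak_deriv :: "(real \<Rightarrow> real) \<Rightarrow> (real \<Rightarrow> real) \<Rightarrow> bool" where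
  "weak_deriv p dp \<longleftrightarrow> (\<forall>a b. a \<le> b \<longrightarrow> (dp has_integral (p b - p a)) {a..b})"

definition in_calH1 :: "(real \<Rightarrow> real) \<Rightarrow> bool" where
  "in_calH1 p \<longleftrightarrow> in_calH p \<and> (\<exists>dp. weak_deriv p dp \<and> in_calH dp)"

definition in_frakH :: "(real \<Rightarrow> real) \<Rightarrow> (real \<Rightarrow> real) \<Rightarrow> bool" where
  "in_frakH p q \<longleftrightarrow> in_calH1 p \<and> in_calH q"

definition in_Beps :: "real \<Rightarrow> (real \<Rightarrow> real) \<Rightarrow> (real \<Rightarrow> real) \<Rightarrow> bool" where
  "in_Beps eps p q \<longleftrightarrow> in_frakH p q \<and>
     (\<exists>dp. weak_deriv p dp \<and> in_calH dp \<and> integral {0..1} (\<lambda>x. (dp x)\<^sup>2 + (q x)\<^sup>2) < eps)"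

section \<open>The equation y''' + (py)' + py' + qy = lambda y + g\<close>

text \<open>Written as a first order system for (y, y', y'' + p y) on [0,2]
  (the quasi-derivative y'' + p y avoids p'):
  y' = y1, y1' = y2 - p y, y2' = (lambda - q) y - p y1 + g, in integrated form.\<close>
definition ode_sol :: "(real \<Rightarrow> real) \<Rightarrow> (real \<Rightarrow> real) \<Rightarrow> complex \<Rightarrow> (real \<Rightarrow> complex)
     \<Rightarrow> (real \<Rightarrow> complex) \<Rightarrow> (real \<Rightarrow> complex) \<Rightarrow> (real \<Rightarrow> complex) \<Rightarrow> bool" where
  "ode_sol p q lam g y0 y1 y2 \<longleftrightarrow> (\<forall>x\<in>{0..2}.
      (y1 has_integral (y0 x - y0 0)) {0..x} \<and>
      ((\<lambda>t. y2 t - of_real (p t) * y0 t) has_integral (y1 x - y1 0)) {0..x} \<and>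
      ((\<lambda>t. (lam - of_real (q t)) * y0 t - of_real (p t) * y1 t + g t)
          has_integral (y2 x - y2 0)) {0..x})"

datatype idx3 = I1 | I2 | I3

lemma UNIV_idx3: "(UNIV :: idx3 set) = {I1, I2, I3}"
  using idx3.exhaust by auto

instance idx3 :: finite
  by standard (simp add: UNIV_idx3)

text \<open>The derivative vector (y, y', y'') of a solution at x (note y'' = y2 - p y).\<close>
definition dvec :: "(real \<Rightarrow> real) \<Rightarrow> (real \<Rightarrow> complex) \<Rightarrow> (real \<Rightarrow> complex)
     \<Rightarrow> (real \<Rightarrow> complex) \<Rightarrow> real \<Rightarrow> idx3 \<Rightarrow> complex" where
  "dvec p y0 y1 y2 x k = (case k of I1 \<Rightarrow> y0 x | I2 \<Rightarrow> y1 x | I3 \<Rightarrow> y2 x - of_real (p x) * y0 x)"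

definition monodromy :: "(real \<Rightarrow> real) \<Rightarrow> (real \<Rightarrow> real) \<Rightarrow> complex \<Rightarrow> complex ^ idx3 ^ idx3" where
  "monodromy p q lam = (\<chi> j k. THE v. \<exists>y0 y1 y2. ode_sol p q lam (\<lambda>_. 0) y0 y1 y2 \<and>
       (\<forall>i. dvec p y0 y1 y2 0 i = (if i = j then 1 else 0)) \<and> v = dvec p y0 y1 y2 1 k)"

text \<open>rho = (tau1-tau2)^2 (tau1-tau3)^2 (tau2-tau3)^2 for the Floquet multipliers
  tau1, tau2, tau3 (eigenvalues of M(lambda) with multiplicity, i.e. the roots of
  the characteristic polynomial).\<close>
definition rho :: "(real \<Rightarrow> real) \<Rightarrow> (real \<Rightarrow> real) \<Rightarrow> complex \<Rightarrow> complex" where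
  "rho p q lam = (SOME r. \<exists>t1 t2 t3.
      (\<forall>z. det (mat z - monodromy p q lam) = (z - t1) * (z - t2) * (z - t3)) \<and>
      r = (t1 - t2)\<^sup>2 * (t1 - t3)\<^sup>2 * (t2 - t3)\<^sup>2)"

text \<open>y (together with its quasi-derivatives y1, y2) is in the domain of H_dir and
  (H_dir - lambda) y = g.\<close>
definition dir_sol :: "(real \<Rightarrow> real) \<Rightarrow> (real \<Rightarrow> real) \<Rightarrow> complex \<Rightarrow> (real \<Rightarrow> complex)
     \<Rightarrow> (real \<Rightarrow> complex) \<Rightarrow> bool" where
  "dir_sol p q lam g y \<longleftrightarrow> (\<exists>y1 y2. ode_sol p q lam g y y1 y2) \<and> y 0 = 0 \<and> y 1 = 0 \<and> y 2 = 0"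

definition dir_eigenfun :: "(real \<Rightarrow> real) \<Rightarrow> (real \<Rightarrow> real) \<Rightarrow> complex \<Rightarrow> (real \<Rightarrow> complex) \<Rightarrow> bool" where
  "dir_eigenfun p q lam y \<longleftrightarrow> dir_sol p q lam (\<lambda>_. 0) y \<and> (\<exists>x\<in>{0..2}. y x \<noteq> 0)"

definition dir_eigenvalue :: "(real \<Rightarrow> real) \<Rightarrow> (real \<Rightarrow> real) \<Rightarrow> complex \<Rightarrow> bool" where
  "dir_eigenvalue p q lam \<longleftrightarrow> (\<exists>y. dir_eigenfun p q lam y)"

text \<open>Simple eigenvalue: algebraic multiplicity one, i.e. the eigenspace is one-dimensional
  (functions on [0,2]) and there is no associated (root) vector:
  no y in the domain with (H_dir - lambda) y = eigenfunction.\<close>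
definition dir_simple :: "(real \<Rightarrow> real) \<Rightarrow> (real \<Rightarrow> real) \<Rightarrow> complex \<Rightarrow> bool" where
  "dir_simple p q lam \<longleftrightarrow> dir_eigenvalue p q lam \<and>
     (\<forall>f g. dir_eigenfun p q lam f \<and> dir_eigenfun p q lam g \<longrightarrow>
        (\<exists>c. \<forall>x\<in>{0..2}. g x = c * f x)) \<and>
     (\<forall>f. dir_eigenfun p q lam f \<longrightarrow> \<not> (\<exists>y. dir_sol p q lam f y))"

text \<open>lambda^(1/3) with arg in (-pi/3, pi/3] (Ln has imaginary part in (-pi, pi]).\<close>
definition cbrt :: "complex \<Rightarrow> complex" where
  "cbrt z = (if z = 0 then 0 else exp (Ln z / 3))"

definition Dn :: "int \<Rightarrow> complex set" where
  "Dn n = (if n \<ge> 0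
      then {lam. cmod (cbrt lam - of_real (2 * pi * real_of_int n / sqrt 3)) < 2 / sqrt 3}
      else {lam. cmod (cbrt (- lam) - of_real (2 * pi * real_of_int (- n) / sqrt 3)) < 2 / sqrt 3})"

definition zeros_in :: "(complex \<Rightarrow> complex) \<Rightarrow> complex set \<Rightarrow> complex set" where
  "zeros_in f S = {z \<in> S. f z = 0}"

definition zero_mset :: "(complex \<Rightarrow> complex) \<Rightarrow> complex set \<Rightarrow> complex multiset" where
  "zero_mset f S = (\<Sum>z\<in>zeros_in f S. replicate_mset (nat (zorder f z)) z)"

end

theory Submission
  imports Defs
begin

text \<open>
  For \<open>p = q = 0\<close> and \<open>\<lambda> = z\<^sup>3\<close> the multipliers are the exponentials of the three cube roots
  of \<open>\<lambda>\<close>; their Vandermonde product \<open>V\<close> satisfies \<open>\<rho> = V\<^sup>2\<close> and is, up to the factor \<open>\<lambda>\<close>, the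
  characteristic determinant \<open>\<Delta>\<close> of the three-point problem. With \<open>a\<^sub>1 \<ge> a\<^sub>2 \<ge> a\<^sub>3\<close> the real parts
  of the cube roots, \<open>V\<close> has size \<open>exp (a\<^sub>1 - a\<^sub>3)\<close> off the discs. Variation of constants bounds the
  perturbation of the trace of \<open>M\<close> by a small multiple of \<open>exp a\<^sub>1\<close>, and that of \<open>M\<^sup>-\<^sup>1\<close>, which is
  the monodromy matrix of the adjoint equation, by one of \<open>exp (- a\<^sub>3)\<close>. Basing the three-point
  problem at \<open>x = 1\<close> writes \<open>\<Delta>\<close> as a product of entries of \<open>M\<close> and \<open>M\<^sup>-\<^sup>1\<close>, so both \<open>\<rho>\<close> and \<open>\<Delta>\<close>
  satisfy Rouche's condition with constants independent of \<open>n\<close>, which gives the counts.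

  At a simple real zero \<open>\<mu>\<close> of \<open>\<Delta>\<close> with \<open>n > 0\<close> the eigenfunction is a Floquet solution with a real
  multiplier that is not the large one. Hence all multipliers are real and \<open>\<rho>(\<mu>) \<ge> 0\<close>, whereas
  \<open>\<rho> < 0\<close> at the real end points of \<open>D\<^sub>n\<close>: the two zeros of \<open>\<rho>\<close> are real and enclose \<open>\<mu>\<close>. Reflection
  \<open>x \<mapsto> 2 - x\<close> reduces \<open>n < 0\<close> to \<open>n > 0\<close>.
\<close>

section \<open>Products of absolutely continuous functions\<close>

text \<open>What shapes the proof is uniformity in \<open>n\<close>. Written through the entries of
  \<open>M\<close> alone, \<open>rho\<close> and the three-point determinant are sums of terms far
  larger than themselves, so cancellation must never be estimated. Hence every 2x2 minor is read as
  a solution of the adjoint equation and bounded there, and derivatives are weighted by powers of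
  \<open>scale z\<close>, which makes all constants independent of \<open>z\<close>. The three real
  parts have sum zero, so each trace scale is at most the square of the other; this absorbs the
  cubes in the discriminant into its leading term \<open>T^2 * E^2\<close>. As \<open>q\<close> is
  merely integrable, the equation is kept as an integrated first order system, and all calculus runs
  through a product rule for indefinite integrals. The disc \<open>D_0\<close> is exceptional: the
  free functions satisfy \<open>rho0 = - 27 * lam^2 * dir_det0^2\<close> with
  \<open>dir_det0 0 = 1\<close>, so \<open>rho\<close> has two zeros there and the three-point
  problem none. That the multiplier of the eigenfunction is not the large one is seen by pairing its
  initial data with a left eigenvector of the free matrix that belongs to a small
  multiplier.\<close>

definition abs_cont :: "real \<Rightarrow> (real \<Rightarrow> complex) \<Rightarrow> (real \<Rightarrow> complex) \<Rightarrow> bool" where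
  "abs_cont b f f' \<longleftrightarrow> f' absolutely_integrable_on {0..b} \<and>
     (\<forall>x\<in>{0..b}. (f' has_integral (f x - f 0)) {0..x})"

text \<open>Multiplying a gauge integrable function by a continuous factor can destroy
  integrability, whereas absolute integrability survives. Hence the extra clause in
  \<open>abs_cont\<close>.\<close>

lemma absolutely_integrable_times_continuous:
  fixes f g :: "real \<Rightarrow> complex"
  assumes "f absolutely_integrable_on {a..b}" "continuous_on {a..b} g"
  shows "(\<lambda>x. f x * g x) absolutely_integrable_on {a..b}"
proof -
  have "(\<lambda>x. g x * f x) absolutely_integrable_on {a..b}"
  proof (rule absolutely_integrable_bounded_measurable_product[of "(*)"])
    show "bilinear ((*) :: complex \<Rightarrow> complex \<Rightarrow> complex)"
      by (rule bilinear_times)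
    show "g \<in> borel_measurable (lebesgue_on {a..b})"
      using assms(2) by (intro continuous_imp_measurable_on_sets_lebesgue) auto
    show "bounded (g ` {a..b})"
      using assms(2) compact_continuous_image compact_imp_bounded by blast
  qed (use assms in auto)
  then show ?thesis by (simp add: mult.commute)
qed

lemma absolutely_integrable_of_real:
  "f absolutely_integrable_on S \<Longrightarrow> (\<lambda>x. complex_of_real (f x)) absolutely_integrable_on S"
  using absolutely_integrable_linear[OF _ bounded_linear_of_real] by (fastforce simp: o_def)

lemma indefinite_integral_difference:
  fixes f :: "real \<Rightarrow> 'a :: banach"
  assumes "\<And>x. x \<in> {0..b} \<Longrightarrow> (f' has_integral (f x - f 0)) {0..x}" "0 \<le> u" "u \<le> v" "v \<le> b"
  shows "(f' has_integral (f v - f u)) {u..v}"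
proof -
  have 1: "(f' has_integral (f u - f 0)) {0..u}" "(f' has_integral (f v - f 0)) {0..v}"
    using assms by auto
  have "f' integrable_on {0..v}"
    using 1 by blast
  then have "f' integrable_on {u..v}"
    by (rule integrable_subinterval_real) (use assms in auto)
  then obtain i where i: "(f' has_integral i) {u..v}"
    by blast
  have "(f' has_integral (f u - f 0) + i) {0..v}"
    using has_integral_combine[OF _ _ 1(1) i] assms by auto
  then have "(f u - f 0) + i = f v - f 0"
    using 1(2) has_integral_unique by blast
  then have "i = f v - f u"
    by (simp add: algebra_simps)
  then show ?thesis
    using i by simp
qed

lemma indefinite_integral_continuous_on:
  fixes f :: "real \<Rightarrow> 'a :: banach"
  assumes "\<And>x. x \<in> {0..b} \<Longrightarrow> (f' has_integral (f x - f 0)) {0..x}"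
  shows "continuous_on {0..b} f"
proof (cases "0 \<le> b")
  case True
  then have "f' integrable_on {0..b}"
    using assms[of b] by auto
  then have "continuous_on {0..b} (\<lambda>x. integral {0..x} f' + f 0)"
    by (intro continuous_intros indefinite_integral_continuous_1)
  then show ?thesis
    by (rule continuous_on_eq) (simp add: integral_unique[OF assms])
qed auto

lemma abs_cont_has_integral:
  "abs_cont b f f' \<Longrightarrow> 0 \<le> u \<Longrightarrow> u \<le> v \<Longrightarrow> v \<le> b \<Longrightarrow> (f' has_integral (f v - f u)) {u..v}"
  unfolding abs_cont_def using indefinite_integral_difference by blast

lemma abs_cont_continuous_on: "abs_cont b f f' \<Longrightarrow> continuous_on {0..b} f"
  unfolding abs_cont_def using indefinite_integral_continuous_on by blast

lemma abs_cont_add: "abs_cont b f f' \<Longrightarrow> abs_cont b g g' \<Longrightarrow> abs_cont b (\<lambda>x. f x + g x) (\<lambda>x. f' x + g' x)"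
  unfolding abs_cont_def
  by (auto intro!: set_integral_add(1) dest!: bspec intro: has_integral_eq_rhs[OF has_integral_add])

lemma abs_cont_diff: "abs_cont b f f' \<Longrightarrow> abs_cont b g g' \<Longrightarrow> abs_cont b (\<lambda>x. f x - g x) (\<lambda>x. f' x - g' x)"
  unfolding abs_cont_def
  by (auto intro!: set_integral_diff(1) dest!: bspec intro: has_integral_eq_rhs[OF has_integral_diff])

lemma abs_cont_cong:
  assumes "abs_cont b f f'" "\<And>x. x \<in> {0..b} \<Longrightarrow> f x = g x" "\<And>x. x \<in> {0..b} \<Longrightarrow> f' x = g' x"
  shows "abs_cont b g g'"
  unfolding abs_cont_def
proof (intro conjI ballI)
  show "g' absolutely_integrable_on {0..b}"
    using assms(1,3) unfolding abs_cont_def by (auto intro: absolutely_integrable_spike[where S = "{}"])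
  fix x assume x: "x \<in> {0..b}"
  then have "(f' has_integral (f x - f 0)) {0..x}"
    using assms(1) unfolding abs_cont_def by auto
  then have "(g' has_integral (f x - f 0)) {0..x}"
    by (rule has_integral_eq[rotated]) (use assms(3) x in auto)
  then show "(g' has_integral (g x - g 0)) {0..x}"
    using assms(2) x by auto
qed

text \<open>Let \<open>D\<close> be \<open>f * g\<close> minus the indefinite integral of the
  candidate derivative. On a short interval its increment is at most the oscillation of
  \<open>f\<close> and \<open>g\<close> times the integral of \<open>|f'| + |g'|\<close>; summing
  over a fine uniform partition shows that \<open>D\<close> is constant, without any almost
  everywhere differentiation.\<close>

lemma abs_cont_mult:
  assumes f: "abs_cont b f f'" and g: "abs_cont b g g'"
  shows "abs_cont b (\<lambda>x. f x * g x) (\<lambda>x. f' x * g x + f x * g' x)"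
proof -
  define h where "h = (\<lambda>x. f' x * g x + f x * g' x)"
  have cf: "continuous_on {0..b} f" and cg: "continuous_on {0..b} g"
    using f g abs_cont_continuous_on by auto
  have f'i: "f' absolutely_integrable_on {0..b}" and g'i: "g' absolutely_integrable_on {0..b}"
    using f g abs_cont_def by auto
  have "(\<lambda>x. f' x * g x + g' x * f x) absolutely_integrable_on {0..b}"
    by (intro set_integral_add(1) absolutely_integrable_times_continuous f'i g'i cf cg)
  then have hai: "h absolutely_integrable_on {0..b}"
    by (simp add: h_def mult.commute)
  define D where "D = (\<lambda>t. f t * g t - integral {0..t} h)"
  define k where "k = (\<lambda>t. norm (f' t) + norm (g' t))"
  define K where "K = (\<lambda>t. integral {0..t} k)"
  have ki: "k integrable_on {0..b}"
    unfolding k_def using f'i g'i by (intro integrable_add) (auto simp: absolutely_integrable_on_def)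
  have hi: "h integrable_on {0..b}"
    using hai set_lebesgue_integral_eq_integral(1) by blast
  have loc: "norm (D v - D u) \<le> e * (K v - K u)"
    if uv: "0 \<le> u" "u \<le> v" "v \<le> b"
      and e: "\<And>t. t \<in> {u..v} \<Longrightarrow> norm (g v - g t) \<le> e" "\<And>t. t \<in> {u..v} \<Longrightarrow> norm (f u - f t) \<le> e" for u v e
  proof -
    have sub: "\<And>x. x \<in> {0..b} \<Longrightarrow> k integrable_on {0..x}" "\<And>x. x \<in> {0..b} \<Longrightarrow> h integrable_on {0..x}"
      using integrable_subinterval_real[OF ki] integrable_subinterval_real[OF hi] by auto
    have hK: "(k has_integral (K v - K u)) {u..v}"
    proof (rule indefinite_integral_difference[OF _ uv])
      show "(k has_integral K x - K 0) {0..x}" if "x \<in> {0..b}" for x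
        using integrable_integral[OF sub(1)[OF that]] by (simp add: K_def)
    qed
    have hH: "(h has_integral (integral {0..v} h - integral {0..u} h)) {u..v}"
    proof (rule indefinite_integral_difference[OF _ uv])
      show "(h has_integral integral {0..x} h - integral {0..0} h) {0..x}" if "x \<in> {0..b}" for x
        using integrable_integral[OF sub(2)[OF that]] by simp
    qed
    \<comment> \<open>\<open>g\<close> is frozen at \<open>v\<close> and \<open>f\<close> at
      \<open>u\<close>, so that the two integrals add up to \<open>f v * g v - f u * g u\<close>
      exactly.\<close>
    have 1: "((\<lambda>t. f' t * g v) has_integral ((f v - f u) * g v)) {u..v}"
      using abs_cont_has_integral[OF f] uv by (intro has_integral_mult_left) auto
    have 2: "((\<lambda>t. f u * g' t) has_integral (f u * (g v - g u))) {u..v}"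
      using abs_cont_has_integral[OF g] uv by (intro has_integral_mult_right) auto
    have A: "((\<lambda>t. f' t * g v + f u * g' t - h t) has_integral (D v - D u)) {u..v}"
      by (rule has_integral_eq_rhs[OF has_integral_diff[OF has_integral_add[OF 1 2] hH]])
         (simp add: D_def algebra_simps)
    have B: "((\<lambda>t. e * k t) has_integral (e * (K v - K u))) {u..v}"
      using hK by (rule has_integral_mult_right)
    have C: "norm (f' t * g v + f u * g' t - h t) \<le> e * k t" if "t \<in> {u..v}" for t
    proof -
      have "norm (f' t * g v + f u * g' t - h t) = norm (f' t * (g v - g t) + (f u - f t) * g' t)"
        by (simp add: h_def algebra_simps)
      also have "\<dots> \<le> norm (f' t) * norm (g v - g t) + norm (f u - f t) * norm (g' t)"
        by (metis norm_mult norm_triangle_ineq)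
      also have "\<dots> \<le> norm (f' t) * e + e * norm (g' t)"
        using e[OF that] by (intro add_mono mult_mono) (auto intro: order_trans[OF norm_ge_zero])
      finally show ?thesis
        by (simp add: k_def algebra_simps)
    qed
    show ?thesis
      using integral_norm_bound_integral[OF has_integral_integrable[OF A] has_integral_integrable[OF B] C]
      by (simp add: integral_unique[OF A] integral_unique[OF hK])
  qed
  have D0: "D x = D 0" if x: "x \<in> {0..b}" for x
  proof -
    have Kx: "0 \<le> K x"
      unfolding K_def by (intro integral_nonneg integrable_subinterval_real[OF ki])
        (use x in \<open>auto simp: k_def\<close>)
    have "norm (D x - D 0) \<le> e * K x" if e: "e > 0" for e
    proof -
      have "uniformly_continuous_on {0..b} f" "uniformly_continuous_on {0..b} g"
        using cf cg compact_uniformly_continuous by auto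
      then obtain d1 d2 where d: "d1 > 0" "d2 > 0"
        "\<And>s t. s \<in> {0..b} \<Longrightarrow> t \<in> {0..b} \<Longrightarrow> dist s t < d1 \<Longrightarrow> dist (f s) (f t) < e"
        "\<And>s t. s \<in> {0..b} \<Longrightarrow> t \<in> {0..b} \<Longrightarrow> dist s t < d2 \<Longrightarrow> dist (g s) (g t) < e"
        unfolding uniformly_continuous_on_def using e by metis
      define m where "m = min d1 d2"
      have m: "m > 0" "m \<le> d1" "m \<le> d2"
        using d by (auto simp: m_def)
      obtain n where n: "x / m < real n"
        using reals_Archimedean2 by blast
      have "0 \<le> x / m"
        using x m by simp
      with n have n0: "n > 0"
        by linarith
      have xn: "x / real n < m"
        using n n0 m by (simp add: field_simps)
      define u where "u = (\<lambda>i::nat. real i * x / real n)"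
      have step: "norm (D (u (Suc i)) - D (u i)) \<le> e * (K (u (Suc i)) - K (u i))" if i: "i < n" for i
      proof (rule loc)
        show "0 \<le> u i" "u i \<le> u (Suc i)"
          using x by (auto simp: u_def divide_right_mono mult_right_mono)
        have "real (Suc i) * x \<le> real n * x"
          using i x by (intro mult_right_mono) auto
        then show ub: "u (Suc i) \<le> b"
          using x n0 by (auto simp: u_def field_simps intro: order_trans)
        have diff: "u (Suc i) - u i = x / real n"
          by (simp add: u_def add_divide_distrib algebra_simps)
        fix t assume t: "t \<in> {u i..u (Suc i)}"
        have tb: "t \<in> {0..b}" "u i \<in> {0..b}" "u (Suc i) \<in> {0..b}"
          using t ub \<open>0 \<le> u i\<close> by auto
        show "norm (g (u (Suc i)) - g t) \<le> e"
          using d(4)[of "u (Suc i)" t] tb t diff xn m by (auto simp: dist_norm)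
        show "norm (f (u i) - f t) \<le> e"
          using d(3)[of "u i" t] tb t diff xn m by (auto simp: dist_norm)
      qed
      have "D x - D 0 = (\<Sum>i<n. D (u (Suc i)) - D (u i))"
        using n0 by (simp only: sum_lessThan_telescope[of "\<lambda>i. D (u i)"]) (simp add: u_def)
      also have "norm \<dots> \<le> (\<Sum>i<n. e * (K (u (Suc i)) - K (u i)))"
        by (intro sum_norm_le) (use step in auto)
      also have "\<dots> = e * (K x - K 0)"
        using n0 by (simp only: sum_lessThan_telescope[of "\<lambda>i. K (u i)"] flip: sum_distrib_left) (simp add: u_def)
      finally show ?thesis by (simp add: K_def)
    qed
    then have lim: "norm (D x - D 0) \<le> e * K x" if "e > 0" for e
      using that by blast
    have "norm (D x - D 0) \<le> 0"
    proof (rule field_le_epsilon)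
      fix e :: real assume "e > 0"
      then have "norm (D x - D 0) \<le> e / (K x + 1) * K x"
        using Kx by (intro lim) auto
      also have "\<dots> \<le> e"
        using Kx \<open>e > 0\<close> by (simp add: field_simps)
      finally show "norm (D x - D 0) \<le> 0 + e" by simp
    qed
    then show ?thesis by simp
  qed
  show ?thesis
    unfolding abs_cont_def
  proof (intro conjI ballI)
    show "(\<lambda>x. f' x * g x + f x * g' x) absolutely_integrable_on {0..b}"
      using hai by (simp add: h_def)
    fix x assume x: "x \<in> {0..b}"
    have "h integrable_on {0..x}"
      using integrable_subinterval_real[OF hi] x by auto
    moreover have "integral {0..x} h = f x * g x - f 0 * g 0"
      using D0[OF x] by (simp add: D_def algebra_simps)
    ultimately have "(h has_integral f x * g x - f 0 * g 0) {0..x}"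
      by (simp add: has_integral_iff)
    then show "((\<lambda>x. f' x * g x + f x * g' x) has_integral f x * g x - f 0 * g 0) {0..x}"
      by (simp only: h_def)
  qed
qed

lemma abs_cont_derivative:
  assumes "\<And>x. x \<in> {0..b} \<Longrightarrow> (f has_vector_derivative f' x) (at x)" "continuous_on {0..b} f'"
  shows "abs_cont b f f'"
  unfolding abs_cont_def
proof (intro conjI ballI)
  show "f' absolutely_integrable_on {0..b}"
    using assms(2) by (rule absolutely_integrable_continuous_real)
  show "(f' has_integral f x - f 0) {0..x}" if "x \<in> {0..b}" for x
    using that assms(1)
    by (intro fundamental_theorem_of_calculus) (auto intro: has_vector_derivative_at_within)
qed

text \<open>Continuity of \<open>f'\<close> upgrades an almost everywhere conclusion to every point,
  end points included. It serves to show that a solution vanishing identically has zero initial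
  data.\<close>

lemma abs_cont_derivative_zero_unique:
  assumes "abs_cont b f f'" "continuous_on {0..b} f'" "\<And>x. x \<in> {0..b} \<Longrightarrow> f x = 0" "b > 0" "x \<in> {0..b}"
  shows "f' x = 0"
proof -
  have "((\<lambda>u. integral {0..u} f') has_vector_derivative f' x) (at x within {0..b})"
    by (rule integral_has_vector_derivative) (use assms in auto)
  moreover have "((\<lambda>u. integral {0..u} f') has_vector_derivative 0) (at x within {0..b})"
  proof (rule has_vector_derivative_transform[OF \<open>x \<in> {0..b}\<close> _ has_vector_derivative_const[of 0]])
    fix y assume y: "y \<in> {0..b}"
    then have "(f' has_integral 0) {0..y}"
      using assms(1,3) y assms(4) unfolding abs_cont_def by (metis atLeastAtMost_iff diff_zero less_eq_real_def)
    then show "integral {0..y} f' = 0"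
      by (rule integral_unique)
  qed
  ultimately show ?thesis
    using assms(4,5) by (intro vector_derivative_unique_within[of x "{0..b}"]) (auto simp: trivial_limit_within islimpt_Icc)
qed

section \<open>Solutions of the integrated system\<close>

text \<open>The system of \<open>ode_sol\<close> on an interval of variable length: a solution
  shifted by one period is controlled on \<open>{0..1}\<close> only.\<close>

definition osol :: "real \<Rightarrow> (real \<Rightarrow> real) \<Rightarrow> (real \<Rightarrow> real) \<Rightarrow> complex \<Rightarrow> (real \<Rightarrow> complex)
     \<Rightarrow> (real \<Rightarrow> complex) \<Rightarrow> (real \<Rightarrow> complex) \<Rightarrow> (real \<Rightarrow> complex) \<Rightarrow> bool" where
  "osol b p q lam g y0 y1 y2 \<longleftrightarrow> (\<forall>x\<in>{0..b}.
      (y1 has_integral (y0 x - y0 0)) {0..x} \<and>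
      ((\<lambda>t. y2 t - of_real (p t) * y0 t) has_integral (y1 x - y1 0)) {0..x} \<and>
      ((\<lambda>t. (lam - of_real (q t)) * y0 t - of_real (p t) * y1 t + g t)
          has_integral (y2 x - y2 0)) {0..x})"

lemma ode_sol_eq_osol: "ode_sol = osol 2"
  unfolding ode_sol_def osol_def by (intro ext) auto

text \<open>All that the analysis uses of the potentials: a sup bound for \<open>p\<close> and an L1
  bound for \<open>q\<close>, with the same \<open>d\<close>. The class is stable under changing the
  sign of \<open>q\<close> and under reflection, so every estimate also serves the adjoint and the
  reflected equation.\<close>

definition pot :: "real \<Rightarrow> (real \<Rightarrow> real) \<Rightarrow> (real \<Rightarrow> real) \<Rightarrow> bool" where
  "pot d p q \<longleftrightarrow> continuous_on UNIV p \<and> (\<forall>x. p (x + 1) = p x) \<and> (\<forall>x. \<bar>p x\<bar> \<le> d) \<and>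
     (\<forall>x. q (x + 1) = q x) \<and> q absolutely_integrable_on {0..1} \<and> integral {0..1} (\<lambda>x. \<bar>q x\<bar>) \<le> d"

lemma potD:
  assumes "pot d p q"
  shows "continuous_on S p" "p (x + 1) = p x" "\<bar>p x\<bar> \<le> d" "q (x + 1) = q x" "0 \<le> d"
    "q absolutely_integrable_on {0..1}" "integral {0..1} (\<lambda>x. \<bar>q x\<bar>) \<le> d"
  using assms unfolding pot_def by (auto intro: continuous_on_subset order_trans[OF abs_ge_zero])

lemma pot_uminus: "pot d p q \<Longrightarrow> pot d p (\<lambda>x. - q x)"
  unfolding pot_def by (auto simp: set_integrable_def)

lemma pot_0: "0 \<le> d \<Longrightarrow> pot d (\<lambda>_. 0) (\<lambda>_. 0)"
  unfolding pot_def by auto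

lemma pot_mono: "pot d p q \<Longrightarrow> d \<le> d' \<Longrightarrow> pot d' p q"
  unfolding pot_def by (meson order_trans)

lemma pot_reflect:
  assumes "pot d p q"
  shows "pot d (\<lambda>x. p (1 - x)) (\<lambda>x. q (1 - x))"
proof -
  have per: "p (1 - (x + 1)) = p (1 - x)" "q (1 - (x + 1)) = q (1 - x)" for x
    using potD(2)[OF assms, of "- x"] potD(4)[OF assms, of "- x"] by (auto simp: algebra_simps)
  have refl: "((\<lambda>x. f (1 - x)) has_integral i) {0..1}" if "(f has_integral i) {0..1}" for f :: "real \<Rightarrow> real" and i
  proof -
    have "((\<lambda>x. f (- x)) has_integral i) {-1..-0}"
      using that by (subst has_integral_reflect_real) auto
    from has_integral_shift_real_ivl[OF this, of "-1"] show ?thesis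
      by simp
  qed
  have "q absolutely_integrable_on {0..1}"
    using potD(6)[OF assms] .
  then have "q integrable_on {0..1}" "(\<lambda>x. \<bar>q x\<bar>) integrable_on {0..1}"
    by (auto simp: absolutely_integrable_on_def)
  from this[THEN integrable_integral, THEN refl]
  have "(\<lambda>x. q (1 - x)) integrable_on {0..1}" "(\<lambda>x. \<bar>q (1 - x)\<bar>) integrable_on {0..1}"
     "integral {0..1} (\<lambda>x. \<bar>q (1 - x)\<bar>) \<le> d"
    using potD(7)[OF assms] by (auto simp: has_integral_iff)
  moreover have "continuous_on UNIV (\<lambda>x. p (1 - x))"
    by (intro continuous_on_compose2[OF potD(1)[OF assms, of UNIV]] continuous_intros) auto
  ultimately show ?thesis
    unfolding pot_def using per potD(3)[OF assms] by (auto simp: absolutely_integrable_on_def)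
qed

lemma pot_integral_2:
  assumes "pot d p q"
  shows "q absolutely_integrable_on {0..2}" "integral {0..2} (\<lambda>x. \<bar>q x\<bar>) \<le> 2 * d"
proof -
  have q: "q integrable_on {0..1}" "(\<lambda>x. \<bar>q x\<bar>) integrable_on {0..1}"
    using potD(6)[OF assms] by (auto simp: absolutely_integrable_on_def)
  have ext: "(f has_integral 2 * i) {0..2}"
    if f: "(f has_integral i) {0..1}" "\<And>x. f (x + 1) = f x" for f :: "real \<Rightarrow> real" and i
  proof -
    have "f (x - 1) = f x" for x
      using f(2)[of "x - 1"] by simp
    then have "(f has_integral i) {1..2}"
      using has_integral_shift_real_ivl[OF f(1), of "-1"] by simp
    from has_integral_combine[OF _ _ f(1) this] show ?thesis by simp
  qed
  have "(q has_integral 2 * integral {0..1} q) {0..2}"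
    "((\<lambda>x. \<bar>q x\<bar>) has_integral 2 * integral {0..1} (\<lambda>x. \<bar>q x\<bar>)) {0..2}"
    using q potD(4)[OF assms] by (auto intro!: ext)
  then show "q absolutely_integrable_on {0..2}" "integral {0..2} (\<lambda>x. \<bar>q x\<bar>) \<le> 2 * d"
    using potD(7)[OF assms] by (auto simp: absolutely_integrable_on_def has_integral_iff)
qed

lemma pot_absolutely_integrable:
  fixes u v g :: "real \<Rightarrow> complex"
  assumes "pot d p q" "b \<le> 2" "continuous_on {0..b} u" "continuous_on {0..b} v" "continuous_on {0..b} g"
  shows "(\<lambda>t. (lam - of_real (q t)) * u t - of_real (p t) * v t + g t) absolutely_integrable_on {0..b}"
proof -
  have "(\<lambda>x. complex_of_real (q x)) absolutely_integrable_on {0..b}"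
    using pot_integral_2(1)[OF assms(1)] assms(2)
    by (intro absolutely_integrable_of_real) (auto intro: absolutely_integrable_on_subinterval)
  then have "(\<lambda>t. complex_of_real (q t) * u t) absolutely_integrable_on {0..b}"
    using assms(3) by (rule absolutely_integrable_times_continuous)
  moreover have "(\<lambda>t. lam * u t - of_real (p t) * v t + g t) absolutely_integrable_on {0..b}"
    using assms by (intro absolutely_integrable_continuous_real continuous_intros potD(1)[OF assms(1)]) auto
  ultimately have "(\<lambda>t. (lam * u t - of_real (p t) * v t + g t) - of_real (q t) * u t) absolutely_integrable_on {0..b}"
    by (rule set_integral_diff(1)[rotated])
  then show ?thesis
    by (simp add: algebra_simps)
qed

lemma osol_abs_cont:
  assumes "pot d p q" "b \<le> 2" "continuous_on {0..b} g" "osol b p q lam g y0 y1 y2"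
  shows "abs_cont b y0 y1" "abs_cont b y1 (\<lambda>t. y2 t - of_real (p t) * y0 t)"
    "abs_cont b y2 (\<lambda>t. (lam - of_real (q t)) * y0 t - of_real (p t) * y1 t + g t)"
    "continuous_on {0..b} y0" "continuous_on {0..b} y1" "continuous_on {0..b} y2"
proof -
  have i: "\<And>x. x \<in> {0..b} \<Longrightarrow> (y1 has_integral (y0 x - y0 0)) {0..x}"
    "\<And>x. x \<in> {0..b} \<Longrightarrow> ((\<lambda>t. y2 t - of_real (p t) * y0 t) has_integral (y1 x - y1 0)) {0..x}"
    "\<And>x. x \<in> {0..b} \<Longrightarrow> ((\<lambda>t. (lam - of_real (q t)) * y0 t - of_real (p t) * y1 t + g t)
          has_integral (y2 x - y2 0)) {0..x}"
    using assms(4) unfolding osol_def by blast+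
  show c: "continuous_on {0..b} y0" "continuous_on {0..b} y1" "continuous_on {0..b} y2"
    by (rule indefinite_integral_continuous_on, erule i)+
  show "abs_cont b y0 y1" "abs_cont b y1 (\<lambda>t. y2 t - of_real (p t) * y0 t)"
    unfolding abs_cont_def using i c potD(1)[OF assms(1)]
    by (auto intro!: absolutely_integrable_continuous_real continuous_intros continuous_on_apply_bcontfun)
  show "abs_cont b y2 (\<lambda>t. (lam - of_real (q t)) * y0 t - of_real (p t) * y1 t + g t)"
    unfolding abs_cont_def using i(3) pot_absolutely_integrable[OF assms(1,2) c(1,2) assms(3)] by auto
qed

lemma osol_abs_contI:
  assumes "abs_cont b y0 y1" "abs_cont b y1 (\<lambda>t. y2 t - of_real (p t) * y0 t)"
    "abs_cont b y2 (\<lambda>t. (lam - of_real (q t)) * y0 t - of_real (p t) * y1 t + g t)"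
  shows "osol b p q lam g y0 y1 y2"
  using assms unfolding osol_def abs_cont_def by blast

text \<open>A large weight exponent \<open>K\<close> makes the bounded part \<open>L\<close> of a
  coefficient negligible, but an L1 function such as \<open>q\<close> gains nothing from it. Its
  share \<open>2 * d\<close> is why existence is proved for small potentials.\<close>

lemma exp_weight_integral_bound:
  fixes h :: "real \<Rightarrow> complex"
  assumes p: "pot d p q" and x: "x \<in> {0..2}" and "h integrable_on {0..x}" "0 < K" "0 \<le> L" "0 \<le> D"
    and bd: "\<And>t. t \<in> {0..x} \<Longrightarrow> norm (h t) \<le> exp (K * t) * ((L + \<bar>q t\<bar>) * D)"
  shows "norm (complex_of_real (exp (- (K * x))) * integral {0..x} h) \<le> (L / K + 2 * d) * D"
proof -
  have qi: "(\<lambda>t. \<bar>q t\<bar>) integrable_on {0..2}"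
    using pot_integral_2(1)[OF p] by (simp add: absolutely_integrable_on_def)
  then have qx: "(\<lambda>t. \<bar>q t\<bar>) integrable_on {0..x}"
    by (rule integrable_subinterval_real) (use x in auto)
  have "integral {0..x} (\<lambda>t. \<bar>q t\<bar>) \<le> integral {0..2} (\<lambda>t. \<bar>q t\<bar>)"
    by (rule integral_subset_le) (use qx qi x in auto)
  then have q2: "integral {0..x} (\<lambda>t. \<bar>q t\<bar>) \<le> 2 * d"
    using pot_integral_2(2)[OF p] by simp
  have "((\<lambda>t. exp (K * t)) has_integral (exp (K * x) / K - exp (K * 0) / K)) {0..x}"
    using x \<open>0 < K\<close> by (intro fundamental_theorem_of_calculus)
      (auto intro!: derivative_eq_intros simp flip: has_real_derivative_iff_has_vector_derivative)
  then have "((\<lambda>t. L * D * exp (K * t) + exp (K * x) * D * \<bar>q t\<bar>) has_integral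
      L * D * (exp (K * x) / K - exp (K * 0) / K) + exp (K * x) * D * integral {0..x} (\<lambda>t. \<bar>q t\<bar>)) {0..x}" (is "(?k has_integral ?I) _")
    by (intro has_integral_add has_integral_mult_right) (use qx in auto)
  moreover have "norm (h t) \<le> ?k t" if "t \<in> {0..x}" for t
  proof -
    have "exp (K * t) * (\<bar>q t\<bar> * D) \<le> exp (K * x) * (\<bar>q t\<bar> * D)"
      using that assms by (intro mult_right_mono) auto
    then show ?thesis
      using bd[OF that] by (simp add: algebra_simps)
  qed
  ultimately have "norm (integral {0..x} h) \<le> ?I"
    using integral_norm_bound_integral[OF assms(3), of ?k] by (auto simp: has_integral_iff)
  also have "\<dots> \<le> L * D * (exp (K * x) / K) + exp (K * x) * D * (2 * d)"
    using assms q2 by (intro add_mono mult_left_mono) auto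
  also have "\<dots> = exp (K * x) * ((L / K + 2 * d) * D)"
    by (simp add: algebra_simps)
  finally have "exp (- (K * x)) * norm (integral {0..x} h) \<le> exp (- (K * x)) * (exp (K * x) * ((L / K + 2 * d) * D))"
    by (intro mult_left_mono) auto
  also have "\<dots> = (L / K + 2 * d) * D"
    by (simp add: exp_minus)
  finally show ?thesis
    by (simp add: norm_mult)
qed

lemma dist_triple_le:
  "dist (a, b, c) (a', b', c') \<le> dist a a' + dist b b' + dist c c'"
proof -
  have "dist (a, b, c) (a', b', c') \<le> dist a a' + dist (b, c) (b', c')"
    by (subst dist_Pair_Pair) (intro sqrt_sum_squares_le_sum zero_le_dist)
  also have "dist (b, c) (b', c') \<le> dist b b' + dist c c'"
    by (subst dist_Pair_Pair) (intro sqrt_sum_squares_le_sum zero_le_dist)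
  finally show ?thesis by simp
qed

text \<open>Picard iteration for the unknowns multiplied by \<open>exp (- K * x)\<close>: with
  \<open>K\<close> adapted to \<open>lam\<close> it contracts on all of \<open>{0..2}\<close> at
  once, so no continuation from short intervals occurs.\<close>

lemma osol_exists:
  assumes p: "pot d p q" and d: "d \<le> 1/24"
  shows "\<exists>y0 y1 y2. osol 2 p q lam (\<lambda>_. 0) y0 y1 y2 \<and> y0 0 = a \<and> y1 0 = b \<and> y2 0 = c"
proof -
  define L where "L = cmod lam + d + 1"
  \<comment> \<open>\<open>K = 16 * L\<close> and \<open>d <= 1/24\<close> give
    \<open>L / K + 2 * d <= 1/16 + 1/12 <= 1/6\<close> for each component; the three components
    together contract by \<open>1/2\<close>.\<close>
  define K where "K = 16 * L"
  have d0: "0 \<le> d" using potD(5)[OF p] .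
  have L: "L > 0" "cmod lam + d \<le> L" "d + 1 \<le> L" "1 \<le> L" using d0 by (auto simp: L_def add_nonneg_pos)
  have K: "K > 0" "L / K = 1/16" using L by (auto simp: K_def)
  \<comment> \<open>The complete space consists of bounded continuous functions on the whole line;
    clamping the argument to \<open>{0..2}\<close> extends the iterates to it.\<close>
  define cl :: "real \<Rightarrow> real" where "cl x = max 0 (min 2 x)" for x
  have cl: "cl x \<in> {0..2}" "x \<in> {0..2} \<Longrightarrow> cl x = x" for x
    by (auto simp: cl_def)
  have ccl: "continuous_on UNIV cl"
    unfolding cl_def by (intro continuous_intros)
  define H where "H r h x = of_real (exp (- (K * cl x))) * (r + integral {0..cl x} h)" for r :: complex and h x
  have H: "H r h \<in> bcontfun" if "h absolutely_integrable_on {0..2}" for r h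
  proof -
    have "h integrable_on {0..2}"
      using that set_lebesgue_integral_eq_integral(1) by blast
    then have ci: "continuous_on {0..2} (\<lambda>x. integral {0..x} h)"
      by (rule indefinite_integral_continuous_1)
    then have cI: "continuous_on UNIV (\<lambda>x. integral {0..cl x} h)"
      by (rule continuous_on_compose2[OF _ ccl]) (use cl in auto)
    have "bounded ((\<lambda>x. integral {0..x} h) ` {0..2})"
      using compact_continuous_image[OF ci] compact_imp_bounded by blast
    then obtain B where "\<forall>y\<in>(\<lambda>x. integral {0..x} h) ` {0..2}. norm y \<le> B"
      unfolding bounded_iff by blast
    then have B: "\<And>x. x \<in> {0..2} \<Longrightarrow> norm (integral {0..x} h) \<le> B"
      by blast
    have "norm (H r h x) \<le> norm r + B" for x
    proof -
      have "norm (H r h x) = exp (- (K * cl x)) * norm (r + integral {0..cl x} h)"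
        by (simp add: H_def norm_mult)
      also have "\<dots> \<le> 1 * (norm r + B)"
        using K cl(1)[of x] B[OF cl(1)[of x]] by (intro mult_mono norm_triangle_mono) auto
      finally show ?thesis by simp
    qed
    moreover have "continuous_on UNIV (H r h)"
      unfolding H_def by (intro continuous_intros ccl cI)
    ultimately show ?thesis by (intro bcontfun_normI) auto
  qed
  define h1 where "h1 = (\<lambda>(U :: real \<Rightarrow>\<^sub>C complex) (V :: real \<Rightarrow>\<^sub>C complex) (W :: real \<Rightarrow>\<^sub>C complex) t. of_real (exp (K * t)) * V t)"
  define h2 where "h2 = (\<lambda>(U :: real \<Rightarrow>\<^sub>C complex) (V :: real \<Rightarrow>\<^sub>C complex) (W :: real \<Rightarrow>\<^sub>C complex) t. of_real (exp (K * t)) * (W t - of_real (p t) * U t))"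
  define h3 where "h3 = (\<lambda>(U :: real \<Rightarrow>\<^sub>C complex) (V :: real \<Rightarrow>\<^sub>C complex) (W :: real \<Rightarrow>\<^sub>C complex) t. (lam - of_real (q t)) * (of_real (exp (K * t)) * U t) - of_real (p t) * (of_real (exp (K * t)) * V t) + 0)"
  have ai1: "h1 U V W absolutely_integrable_on {0..2}" for U V W
    unfolding h1_def by (intro absolutely_integrable_continuous_real continuous_intros continuous_on_apply_bcontfun)
  have ai2: "h2 U V W absolutely_integrable_on {0..2}" for U V W
    unfolding h2_def by (intro absolutely_integrable_continuous_real continuous_intros continuous_on_apply_bcontfun potD(1)[OF p])
  have ai3: "h3 U V W absolutely_integrable_on {0..2}" for U V W
    unfolding h3_def by (intro pot_absolutely_integrable[OF p] continuous_intros continuous_on_apply_bcontfun) auto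
  define F where "F = (\<lambda>(U, V, W). (Bcontfun (H a (h1 U V W)), Bcontfun (H b (h2 U V W)), Bcontfun (H c (h3 U V W))))"
  have Fx: "Bcontfun (H r h) x = H r h x" if "h absolutely_integrable_on {0..2}" for r h x
    using H[OF that] by (simp add: Bcontfun_inverse)
  have Hd: "dist (Bcontfun (H r h)) (Bcontfun (H r h')) \<le> 1/6 * D"
    if h: "h absolutely_integrable_on {0..2}" "h' absolutely_integrable_on {0..2}" and D: "0 \<le> D"
    and bd: "\<And>t. t \<in> {0..2} \<Longrightarrow> norm (h t - h' t) \<le> exp (K * t) * ((L + \<bar>q t\<bar>) * D)" for r h h' D
  proof (rule dist_bound)
    fix x
    have hi: "h integrable_on {0..cl x}" "h' integrable_on {0..cl x}"
      using h[THEN set_lebesgue_integral_eq_integral(1)] cl(1)[of x] by (auto intro: integrable_subinterval_real)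
    have "H r h x - H r h' x = of_real (exp (- (K * cl x))) * integral {0..cl x} (\<lambda>t. h t - h' t)"
      unfolding H_def integral_diff[OF hi] by (simp add: algebra_simps)
    also have "norm \<dots> \<le> (L / K + 2 * d) * D"
      using K L D bd cl(1)[of x] by (intro exp_weight_integral_bound[OF p] integrable_diff hi) auto
    also have "\<dots> \<le> 1/6 * D"
      using K d D by (intro mult_right_mono) auto
    finally show "dist (Bcontfun (H r h) x) (Bcontfun (H r h') x) \<le> 1/6 * D"
      by (simp add: Fx h dist_norm)
  qed
  have lip: "dist (F X) (F Y) \<le> 1/2 * dist X Y" for X Y
  proof -
    obtain U V W U' V' W' where X: "X = (U, V, W)" and Y: "Y = (U', V', W')"
      by (metis prod.exhaust)
    define D where "D = dist X Y"
    have "dist U U' \<le> D" "dist V V' \<le> D" "dist W W' \<le> D"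
      using dist_fst_le[of X Y] dist_snd_le[of X Y] dist_fst_le[of "snd X" "snd Y"] dist_snd_le[of "snd X" "snd Y"]
      by (auto simp: D_def X Y)
    then have D: "norm (U t - U' t) \<le> D" "norm (V t - V' t) \<le> D" "norm (W t - W' t) \<le> D" for t
      using dist_bounded[of U t U'] dist_bounded[of V t V'] dist_bounded[of W t W'] by (auto simp: dist_norm)
    have D0: "0 \<le> D" by (simp add: D_def)
    have pd: "\<bar>p t\<bar> \<le> d" for t using potD(3)[OF p] .
    have 1: "dist (Bcontfun (H a (h1 U V W))) (Bcontfun (H a (h1 U' V' W'))) \<le> 1/6 * D"
    proof (rule Hd[OF ai1 ai1 D0])
      fix t
      have "norm (h1 U V W t - h1 U' V' W' t) = exp (K * t) * norm (V t - V' t)"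
        by (simp add: h1_def norm_mult flip: right_diff_distrib exp_of_real)
      also have "\<dots> \<le> exp (K * t) * (1 * D)"
        using D by (intro mult_left_mono) auto
      also have "\<dots> \<le> exp (K * t) * ((L + \<bar>q t\<bar>) * D)"
        using D0 L by (intro mult_left_mono mult_right_mono) auto
      finally show "norm (h1 U V W t - h1 U' V' W' t) \<le> exp (K * t) * ((L + \<bar>q t\<bar>) * D)" .
    qed
    have 2: "dist (Bcontfun (H b (h2 U V W))) (Bcontfun (H b (h2 U' V' W'))) \<le> 1/6 * D"
    proof (rule Hd[OF ai2 ai2 D0])
      fix t
      have "h2 U V W t - h2 U' V' W' t = of_real (exp (K * t)) * ((W t - W' t) - of_real (p t) * (U t - U' t))"
        by (simp add: h2_def algebra_simps)
      then have "norm (h2 U V W t - h2 U' V' W' t) = exp (K * t) * norm ((W t - W' t) - of_real (p t) * (U t - U' t))"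
        by (simp add: norm_mult)
      also have "norm ((W t - W' t) - of_real (p t) * (U t - U' t)) \<le> D + d * D"
        using D pd d0 by (intro order_trans[OF norm_triangle_ineq4 add_mono]) (auto simp: norm_mult intro!: mult_mono)
      also have "D + d * D \<le> (L + \<bar>q t\<bar>) * D"
        using mult_right_mono[OF L(3) D0] mult_nonneg_nonneg[OF D0 abs_ge_zero[of "q t"]] by (simp add: algebra_simps)
      finally show "norm (h2 U V W t - h2 U' V' W' t) \<le> exp (K * t) * ((L + \<bar>q t\<bar>) * D)"
        by simp
    qed
    have 3: "dist (Bcontfun (H c (h3 U V W))) (Bcontfun (H c (h3 U' V' W'))) \<le> 1/6 * D"
    proof (rule Hd[OF ai3 ai3 D0])
      fix t
      have "h3 U V W t - h3 U' V' W' t = of_real (exp (K * t)) * ((lam - of_real (q t)) * (U t - U' t) - of_real (p t) * (V t - V' t))"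
        by (simp add: h3_def algebra_simps)
      then have "norm (h3 U V W t - h3 U' V' W' t) = exp (K * t) * norm ((lam - of_real (q t)) * (U t - U' t) - of_real (p t) * (V t - V' t))"
        by (simp add: norm_mult)
      also have "norm ((lam - of_real (q t)) * (U t - U' t) - of_real (p t) * (V t - V' t)) \<le> (cmod lam + \<bar>q t\<bar>) * D + d * D"
        using D pd d0 norm_triangle_ineq4[of lam "of_real (q t)"]
        by (intro order_trans[OF norm_triangle_ineq4] add_mono) (auto simp: norm_mult intro!: mult_mono)
      also have "(cmod lam + \<bar>q t\<bar>) * D + d * D \<le> (L + \<bar>q t\<bar>) * D"
        using mult_right_mono[OF L(2) D0] D0 by (simp add: algebra_simps)
      finally show "norm (h3 U V W t - h3 U' V' W' t) \<le> exp (K * t) * ((L + \<bar>q t\<bar>) * D)"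
        by simp
    qed
    have "dist (F X) (F Y) \<le> 1/6 * D + 1/6 * D + 1/6 * D"
      unfolding F_def X Y prod.case using 1 2 3 by (intro order_trans[OF dist_triple_le] add_mono)
    then show ?thesis by (simp add: D_def)
  qed
  obtain X where "F X = X"
    using banach_fix_type[of "1/2" F] lip by auto
  then obtain U V W where fix_eqs: "Bcontfun (H a (h1 U V W)) = U" "Bcontfun (H b (h2 U V W)) = V" "Bcontfun (H c (h3 U V W)) = W"
    by (cases X) (auto simp: F_def)
  have eqs: "U x = H a (h1 U V W) x" "V x = H b (h2 U V W) x" "W x = H c (h3 U V W) x" for x
    by (metis Fx ai1 fix_eqs(1), metis Fx ai2 fix_eqs(2), metis Fx ai3 fix_eqs(3))
  define y0 y1 y2 where "y0 = (\<lambda>x. of_real (exp (K * x)) * U x)" and "y1 = (\<lambda>x. of_real (exp (K * x)) * V x)" and "y2 = (\<lambda>x. of_real (exp (K * x)) * W x)"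
  have EH: "of_real (exp (K * x)) * H r h x = r + integral {0..x} h" if "x \<in> {0..2}" for r h x
    using cl(2)[OF that] by (simp add: H_def exp_minus)
  have ys: "y0 x = a + integral {0..x} (h1 U V W)" "y1 x = b + integral {0..x} (h2 U V W)"
     "y2 x = c + integral {0..x} (h3 U V W)" if "x \<in> {0..2}" for x
    unfolding y0_def y1_def y2_def 
    using EH[OF that, of a "h1 U V W"] EH[OF that, of b "h2 U V W"] EH[OF that, of c "h3 U V W"] eqs[of x] by simp_all
  have init: "y0 0 = a" "y1 0 = b" "y2 0 = c"
    using ys[of 0] by auto
  have hh: "h1 U V W = y1" "h2 U V W = (\<lambda>t. y2 t - of_real (p t) * y0 t)"
    "h3 U V W = (\<lambda>t. (lam - of_real (q t)) * y0 t - of_real (p t) * y1 t + 0)"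
    by (auto simp: h1_def h2_def h3_def y0_def y1_def y2_def algebra_simps)
  have int: "(h has_integral integral {0..x} h) {0..x}" if "h absolutely_integrable_on {0..2}" "x \<in> {0..2}" for h :: "real \<Rightarrow> complex" and x
    using integrable_subinterval_real[OF set_lebesgue_integral_eq_integral(1)[OF that(1)], of 0 x] that(2) by auto
  have "osol 2 p q lam (\<lambda>_. 0) y0 y1 y2"
    unfolding osol_def
    using int[OF ai1, of _ U V W] int[OF ai2, of _ U V W] int[OF ai3, of _ U V W] ys init
    by (auto simp: hh)
  with init show ?thesis by blast
qed

section \<open>Wronskians and variation of constants\<close>

text \<open>Lagrange's identity: against a solution of the adjoint equation, with \<open>- q\<close>
  and \<open>- lam\<close>, all terms in \<open>p\<close> and \<open>q\<close> cancel, and only the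
  mismatch of the spectral parameters and the forcing \<open>g\<close> remain.\<close>

lemma osol_bilinear:
  assumes p: "pot d p q" and b: "b \<le> 2" and g: "continuous_on {0..b} g"
    and y: "osol b p q lam' g y0 y1 y2" and w: "osol b p (\<lambda>x. - q x) (- lam) (\<lambda>_. 0) w0 w1 w2"
  shows "abs_cont b (\<lambda>t. y2 t * w0 t - y1 t * w1 t + y0 t * w2 t) (\<lambda>t. ((lam' - lam) * y0 t + g t) * w0 t)"
proof -
  note y' = osol_abs_cont[OF p b g y] and w' = osol_abs_cont[OF pot_uminus[OF p] b continuous_on_const w]
  show ?thesis
    by (rule abs_cont_cong[OF abs_cont_add[OF abs_cont_diff[OF abs_cont_mult[OF y'(3) w'(1)] abs_cont_mult[OF y'(2) w'(2)]] abs_cont_mult[OF y'(1) w'(3)]]])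
      (simp_all add: algebra_simps)
qed

text \<open>In third order the 2x2 minors of two solutions form a vector of length three again; the
  minors of rows (1,2), (1,3), (2,3), in this order, satisfy the adjoint system.\<close>

lemma osol_cross:
  assumes p: "pot d p q" and b: "b \<le> 2"
    and u: "osol b p q lam (\<lambda>_. 0) u0 u1 u2" and v: "osol b p q lam (\<lambda>_. 0) v0 v1 v2"
  shows "osol b p (\<lambda>x. - q x) (- lam) (\<lambda>_. 0) (\<lambda>t. u0 t * v1 t - u1 t * v0 t)
    (\<lambda>t. u0 t * v2 t - u2 t * v0 t) (\<lambda>t. u1 t * v2 t - u2 t * v1 t)"
proof -
  note u' = osol_abs_cont[OF p b continuous_on_const u] and v' = osol_abs_cont[OF p b continuous_on_const v]
  show ?thesis
  proof (rule osol_abs_contI)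
    show "abs_cont b (\<lambda>t. u0 t * v1 t - u1 t * v0 t) (\<lambda>t. u0 t * v2 t - u2 t * v0 t)"
      by (rule abs_cont_cong[OF abs_cont_diff[OF abs_cont_mult[OF u'(1) v'(2)] abs_cont_mult[OF u'(2) v'(1)]]])
        (simp_all add: algebra_simps)
    show "abs_cont b (\<lambda>t. u0 t * v2 t - u2 t * v0 t)
        (\<lambda>t. u1 t * v2 t - u2 t * v1 t - of_real (p t) * (u0 t * v1 t - u1 t * v0 t))"
      by (rule abs_cont_cong[OF abs_cont_diff[OF abs_cont_mult[OF u'(1) v'(3)] abs_cont_mult[OF u'(3) v'(1)]]])
        (simp_all add: algebra_simps)
    show "abs_cont b (\<lambda>t. u1 t * v2 t - u2 t * v1 t)
       (\<lambda>t. (- lam - of_real (- q t)) * (u0 t * v1 t - u1 t * v0 t)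
          - of_real (p t) * (u0 t * v2 t - u2 t * v0 t) + 0)"
      by (rule abs_cont_cong[OF abs_cont_diff[OF abs_cont_mult[OF u'(2) v'(3)] abs_cont_mult[OF u'(3) v'(2)]]])
        (simp_all add: algebra_simps)
  qed
qed

definition sel3 :: "'a \<Rightarrow> 'a \<Rightarrow> 'a \<Rightarrow> idx3 \<Rightarrow> 'a" where
  "sel3 a b c i = (case i of I1 \<Rightarrow> a | I2 \<Rightarrow> b | I3 \<Rightarrow> c)"

lemma sel3_simps [simp]: "sel3 a b c I1 = a" "sel3 a b c I2 = b" "sel3 a b c I3 = c"
  by (simp_all add: sel3_def)

definition osolv :: "real \<Rightarrow> (real \<Rightarrow> real) \<Rightarrow> (real \<Rightarrow> real) \<Rightarrow> complex \<Rightarrow> (real \<Rightarrow> complex)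
     \<Rightarrow> (idx3 \<Rightarrow> real \<Rightarrow> complex) \<Rightarrow> bool" where
  "osolv b p q lam g y \<longleftrightarrow> osol b p q lam g (y I1) (y I2) (y I3)"

text \<open>The first index is the initial datum, the second the component \<open>y\<close>,
  \<open>y'\<close>, \<open>y'' + p y\<close>. Initial data are quasi-derivatives, unlike in
  \<open>monodromy\<close>; only the values on \<open>{0..2}\<close> are determined.\<close>

definition phi :: "(real \<Rightarrow> real) \<Rightarrow> (real \<Rightarrow> real) \<Rightarrow> complex \<Rightarrow> idx3 \<Rightarrow> idx3 \<Rightarrow> real \<Rightarrow> complex" where
  "phi p q lam j = (SOME y. osolv 2 p q lam (\<lambda>_. 0) y \<and> (\<forall>i. y i 0 = of_bool (i = j)))"

text \<open>\<open>1/48\<close> is what the absorption step of \<open>phi_estimate\<close> needs,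
  namely \<open>24 * d <= 1/2\<close>.\<close>

abbreviation "smallpot \<equiv> pot (1/48)"

lemma phi:
  assumes "smallpot p q"
  shows "osolv 2 p q lam (\<lambda>_. 0) (phi p q lam j)" "phi p q lam j i 0 = of_bool (i = j)"
proof -
  obtain y0 y1 y2 where y: "osol 2 p q lam (\<lambda>_. 0) y0 y1 y2" 
      "y0 0 = of_bool (I1 = j)" "y1 0 = of_bool (I2 = j)" "y2 0 = of_bool (I3 = j)"
    using osol_exists[OF assms, of lam "of_bool (I1 = j)" "of_bool (I2 = j)" "of_bool (I3 = j)"] by auto
  have "\<exists>y. osolv 2 p q lam (\<lambda>_. 0) y \<and> (\<forall>i. y i 0 = of_bool (i = j))"
  proof (intro exI[of _ "sel3 y0 y1 y2"] conjI allI)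
    show "osolv 2 p q lam (\<lambda>_. 0) (sel3 y0 y1 y2)"
      using y by (simp add: osolv_def)
    show "sel3 y0 y1 y2 i 0 = of_bool (i = j)" for i
      using y by (cases i) auto
  qed
  from someI_ex[OF this] show "osolv 2 p q lam (\<lambda>_. 0) (phi p q lam j)" "phi p q lam j i 0 = of_bool (i = j)"
    unfolding phi_def by auto
qed

lemma osol_subset: "osol b p q lam g y0 y1 y2 \<Longrightarrow> c \<le> b \<Longrightarrow> osol c p q lam g y0 y1 y2"
  unfolding osol_def by auto

lemma osolv_subset: "osolv b p q lam g y \<Longrightarrow> c \<le> b \<Longrightarrow> osolv c p q lam g y"
  unfolding osolv_def by (rule osol_subset)

lemma osolv_continuous_on:
  assumes "osolv b p q lam g y"
  shows "continuous_on {0..b} (y i)"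
proof (cases i)
  case I1
  then show ?thesis
    using assms unfolding osolv_def osol_def by (intro indefinite_integral_continuous_on[of b "y I2"]) auto
next
  case I2
  then show ?thesis
    using assms unfolding osolv_def osol_def
    by (intro indefinite_integral_continuous_on[of b "(\<lambda>t. y I3 t - of_real (p t) * y I1 t)"]) auto
next
  case I3
  then show ?thesis
    using assms unfolding osolv_def osol_def
    by (intro indefinite_integral_continuous_on[of b "(\<lambda>t. (lam - of_real (q t)) * y I1 t - of_real (p t) * y I2 t + g t)"]) auto
qed

lemma phi_continuous_on: "smallpot p q \<Longrightarrow> continuous_on {0..2} (phi p q lam j i)"
  using phi(1) osolv_continuous_on by blast

text \<open>\<open>W\<close> is the determinant of \<open>u\<close>, \<open>v\<close>,
  \<open>y\<close> expanded along \<open>y\<close>; the minors of \<open>u\<close> and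
  \<open>v\<close> supply the adjoint solution for \<open>osol_bilinear\<close>.\<close>

lemma osolv_wronskian:
  assumes p: "pot d p q" and b: "b \<le> 2" and g: "continuous_on {0..b} g"
    and y: "osolv b p q lam' g y" and u: "osolv b p q lam (\<lambda>_. 0) u" and v: "osolv b p q lam (\<lambda>_. 0) v"
    and x: "x \<in> {0..b}"
  defines "W \<equiv> \<lambda>t. y I3 t * (u I1 t * v I2 t - u I2 t * v I1 t) - y I2 t * (u I1 t * v I3 t - u I3 t * v I1 t)
      + y I1 t * (u I2 t * v I3 t - u I3 t * v I2 t)"
  shows "W x = W 0 + integral {0..x} (\<lambda>t. ((lam' - lam) * y I1 t + g t) * (u I1 t * v I2 t - u I2 t * v I1 t))"
proof -
  have "abs_cont b W (\<lambda>t. ((lam' - lam) * y I1 t + g t) * (u I1 t * v I2 t - u I2 t * v I1 t))"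
    unfolding W_def using u v y unfolding osolv_def
    by (intro osol_bilinear[OF p b g] osol_cross[OF p b])
  then have "((\<lambda>t. ((lam' - lam) * y I1 t + g t) * (u I1 t * v I2 t - u I2 t * v I1 t)) has_integral (W x - W 0)) {0..x}"
    using x unfolding abs_cont_def by blast
  from integral_unique[OF this] show ?thesis
    by simp
qed

lemma phi_det:
  assumes p: "smallpot p q" and x: "x \<in> {0..2}"
  shows "phi p q lam I3 I3 x * (phi p q lam I1 I1 x * phi p q lam I2 I2 x - phi p q lam I1 I2 x * phi p q lam I2 I1 x)
    - phi p q lam I3 I2 x * (phi p q lam I1 I1 x * phi p q lam I2 I3 x - phi p q lam I1 I3 x * phi p q lam I2 I1 x)
    + phi p q lam I3 I1 x * (phi p q lam I1 I2 x * phi p q lam I2 I3 x - phi p q lam I1 I3 x * phi p q lam I2 I2 x) = 1"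
  using osolv_wronskian[OF p order_refl continuous_on_const phi(1)[OF p] phi(1)[OF p] phi(1)[OF p] x, of lam I3 lam I1 I2]
  by (simp add: phi(2)[OF p])

text \<open>A forcing term enters the third equation only, so variation of constants needs just the
  third column of the inverse fundamental matrix. By \<open>phi_det\<close> that column consists of
  these cofactors.\<close>

definition cofac :: "(real \<Rightarrow> real) \<Rightarrow> (real \<Rightarrow> real) \<Rightarrow> complex \<Rightarrow> idx3 \<Rightarrow> real \<Rightarrow> complex" where
  "cofac p q lam j t = (case j of
     I1 \<Rightarrow> phi p q lam I2 I1 t * phi p q lam I3 I2 t - phi p q lam I2 I2 t * phi p q lam I3 I1 t
   | I2 \<Rightarrow> - (phi p q lam I1 I1 t * phi p q lam I3 I2 t - phi p q lam I1 I2 t * phi p q lam I3 I1 t)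
   | I3 \<Rightarrow> phi p q lam I1 I1 t * phi p q lam I2 I2 t - phi p q lam I1 I2 t * phi p q lam I2 I1 t)"

lemma sum_idx3: "(\<Sum>j\<in>UNIV. f j) = f I1 + f I2 + (f I3 :: 'a :: comm_monoid_add)"
  by (simp add: UNIV_idx3 add.assoc)

text \<open>\<open>y\<close> may have a different parameter \<open>lam'\<close>: the term
  \<open>(lam' - lam) * y\<close> is treated as forcing. Comparing two parameters in this way gives
  both analyticity in \<open>lam\<close> and the multiplicity argument for eigenvalues.\<close>

lemma variation_of_constants:
  assumes p: "smallpot p q" and b: "b \<le> 2" and g: "continuous_on {0..b} g"
    and y: "osolv b p q lam' g y" and x: "x \<in> {0..b}"
  shows "y i x = (\<Sum>j\<in>UNIV. phi p q lam j i x *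
     (y j 0 + integral {0..x} (\<lambda>t. ((lam' - lam) * y I1 t + g t) * cofac p q lam j t)))"
proof -
  have ph: "osolv b p q lam (\<lambda>_. 0) (phi p q lam j)" for j
    using osolv_subset[OF phi(1)[OF p] b] .
  have r3: "y I3 0 + integral {0..x} (\<lambda>t. ((lam' - lam) * y I1 t + g t) * cofac p q lam I3 t) =
     y I3 x * (phi p q lam I1 I1 x * phi p q lam I2 I2 x - phi p q lam I1 I2 x * phi p q lam I2 I1 x)
     - y I2 x * (phi p q lam I1 I1 x * phi p q lam I2 I3 x - phi p q lam I1 I3 x * phi p q lam I2 I1 x)
      + y I1 x * (phi p q lam I1 I2 x * phi p q lam I2 I3 x - phi p q lam I1 I3 x * phi p q lam I2 I2 x)"
    using osolv_wronskian[OF p b g y ph[of I1] ph[of I2] x] by (simp add: cofac_def phi(2)[OF p])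
  have neg: "integral {0..x} (\<lambda>t. ((lam' - lam) * y I1 t + g t) * cofac p q lam I2 t) =
      - integral {0..x} (\<lambda>t. ((lam' - lam) * y I1 t + g t) *
        (phi p q lam I1 I1 t * phi p q lam I3 I2 t - phi p q lam I1 I2 t * phi p q lam I3 I1 t))"
    by (simp only: cofac_def idx3.case mult_minus_right integral_neg)
  have r2: "y I2 0 + integral {0..x} (\<lambda>t. ((lam' - lam) * y I1 t + g t) * cofac p q lam I2 t) =
     - (y I3 x * (phi p q lam I1 I1 x * phi p q lam I3 I2 x - phi p q lam I1 I2 x * phi p q lam I3 I1 x)
     - y I2 x * (phi p q lam I1 I1 x * phi p q lam I3 I3 x - phi p q lam I1 I3 x * phi p q lam I3 I1 x)
      + y I1 x * (phi p q lam I1 I2 x * phi p q lam I3 I3 x - phi p q lam I1 I3 x * phi p q lam I3 I2 x))"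
    using osolv_wronskian[OF p b g y ph[of I1] ph[of I3] x] neg by (simp add: phi(2)[OF p])
  have r1: "y I1 0 + integral {0..x} (\<lambda>t. ((lam' - lam) * y I1 t + g t) * cofac p q lam I1 t) =
     y I3 x * (phi p q lam I2 I1 x * phi p q lam I3 I2 x - phi p q lam I2 I2 x * phi p q lam I3 I1 x)
     - y I2 x * (phi p q lam I2 I1 x * phi p q lam I3 I3 x - phi p q lam I2 I3 x * phi p q lam I3 I1 x)
      + y I1 x * (phi p q lam I2 I2 x * phi p q lam I3 I3 x - phi p q lam I2 I3 x * phi p q lam I3 I2 x)"
    using osolv_wronskian[OF p b g y ph[of I2] ph[of I3] x] by (simp add: cofac_def phi(2)[OF p])
  have x2: "x \<in> {0..2}" using x b by auto
  \<comment> \<open>Cramer's rule: \<open>1\<close> is replaced by the determinant of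
    \<open>phi_det\<close>, after which the identity is polynomial in the entries at
    \<open>x\<close>.\<close>
  have "y i x = y i x * 1" by simp
  also have "\<dots> = (\<Sum>j\<in>UNIV. phi p q lam j i x *
     (y j 0 + integral {0..x} (\<lambda>t. ((lam' - lam) * y I1 t + g t) * cofac p q lam j t)))"
    unfolding phi_det[OF p x2, of lam, symmetric] sum_idx3 r1 r2 r3
    by (cases i) (simp_all add: algebra_simps)
  finally show ?thesis .
qed

lemma osolv_eq:
  assumes "smallpot p q" "b \<le> 2" "osolv b p q lam (\<lambda>_. 0) y" "x \<in> {0..b}"
  shows "y i x = (\<Sum>j\<in>UNIV. phi p q lam j i x * y j 0)"
  using variation_of_constants[OF assms(1,2) continuous_on_const assms(3,4), of i lam] by simp

lemma phi_eqI:
  assumes "smallpot p q" "b \<le> 2" "osolv b p q lam (\<lambda>_. 0) y" "\<And>i. y i 0 = of_bool (i = j)" "x \<in> {0..b}"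
  shows "phi p q lam j i x = y i x"
  unfolding osolv_eq[OF assms(1,2,3,5)] by (simp add: assms(4) of_bool_def if_distrib cong: if_cong)

lemma osolv_lincomb:
  assumes "osolv b p q lam g y" "osolv b p q lam h z"
  shows "osolv b p q lam (\<lambda>t. c * g t + e * h t) (\<lambda>i t. c * y i t + e * z i t)"
  unfolding osolv_def osol_def
proof (intro ballI conjI)
  fix x assume x: "x \<in> {0..b}"
  note y = assms(1)[unfolded osolv_def osol_def, rule_format, OF x]
  note z = assms(2)[unfolded osolv_def osol_def, rule_format, OF x]
  note lin = has_integral_add[OF has_integral_mult_right[where c = c] has_integral_mult_right[where c = e]]
  show "((\<lambda>t. c * y I2 t + e * z I2 t) has_integral (c * y I1 x + e * z I1 x) - (c * y I1 0 + e * z I1 0)) {0..x}"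
    by (rule has_integral_eq_rhs[OF lin[OF y[THEN conjunct1] z[THEN conjunct1]]]) (simp add: algebra_simps)
  have "((\<lambda>t. c * (y I3 t - of_real (p t) * y I1 t) + e * (z I3 t - of_real (p t) * z I1 t)) has_integral
    (c * y I2 x + e * z I2 x) - (c * y I2 0 + e * z I2 0)) {0..x}"
    by (rule has_integral_eq_rhs[OF lin[OF y[THEN conjunct2, THEN conjunct1] z[THEN conjunct2, THEN conjunct1]]])
      (simp add: algebra_simps)
  then show "((\<lambda>t. (c * y I3 t + e * z I3 t) - of_real (p t) * (c * y I1 t + e * z I1 t)) has_integral
    (c * y I2 x + e * z I2 x) - (c * y I2 0 + e * z I2 0)) {0..x}"
    by (simp add: algebra_simps)
  have "((\<lambda>t. c * ((lam - of_real (q t)) * y I1 t - of_real (p t) * y I2 t + g t)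
      + e * ((lam - of_real (q t)) * z I1 t - of_real (p t) * z I2 t + h t)) has_integral
    (c * y I3 x + e * z I3 x) - (c * y I3 0 + e * z I3 0)) {0..x}"
    by (rule has_integral_eq_rhs[OF lin[OF y[THEN conjunct2, THEN conjunct2] z[THEN conjunct2, THEN conjunct2]]])
      (simp add: algebra_simps)
  then show "((\<lambda>t. (lam - of_real (q t)) * (c * y I1 t + e * z I1 t) - of_real (p t) * (c * y I2 t + e * z I2 t)
      + (c * g t + e * h t)) has_integral
    (c * y I3 x + e * z I3 x) - (c * y I3 0 + e * z I3 0)) {0..x}"
    by (simp add: algebra_simps)
qed

lemma osolv_translate:
  assumes "smallpot p q" "osolv 2 p q lam g y"
  shows "osolv 1 p q lam (\<lambda>t. g (t + 1)) (\<lambda>i t. y i (t + 1))"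
proof -
  have "((\<lambda>t. f (t + 1)) has_integral (F (x + 1) - F (0 + 1))) {0..x}"
    if "x \<in> {0..1}" "\<And>x. x \<in> {0..2} \<Longrightarrow> (f has_integral (F x - F 0)) {0..x}" for f F :: "real \<Rightarrow> complex" and x
  proof -
    have "(f has_integral (F (x + 1) - F 1)) {1..x + 1}"
      by (rule indefinite_integral_difference[where b = 2]) (use that in auto)
    from has_integral_shift_real_ivl[OF this, of 1] show ?thesis by simp
  qed
  note tr = this
  have per: "p (x + 1) = p x" "q (x + 1) = q x" for x
    using potD(2,4)[OF assms(1)] by auto
  note y = assms(2)[unfolded osolv_def osol_def, rule_format]
  show ?thesis
    unfolding osolv_def osol_def
    using tr[OF _ y[THEN conjunct1]] tr[OF _ y[THEN conjunct2, THEN conjunct1]] tr[OF _ y[THEN conjunct2, THEN conjunct2]]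
    by (auto simp: per)
qed

lemma phi_translate:
  assumes "smallpot p q" "x \<in> {0..1}"
  shows "phi p q lam j i (x + 1) = (\<Sum>k\<in>UNIV. phi p q lam k i x * phi p q lam j k 1)"
  using osolv_eq[OF assms(1) _ osolv_translate[OF assms(1) phi(1)[OF assms(1)]] assms(2), of lam j i] by simp

lemma osolv_cnj:
  assumes "osolv b p q lam g y"
  shows "osolv b p q (cnj lam) (\<lambda>t. cnj (g t)) (\<lambda>i t. cnj (y i t))"
  unfolding osolv_def osol_def
proof (intro ballI conjI)
  fix x assume x: "x \<in> {0..b}"
  have c: "((\<lambda>t. cnj (f t)) has_integral cnj i) S" if "(f has_integral i) S" for f :: "real \<Rightarrow> complex" and i S
    using has_integral_linear[OF that bounded_linear_cnj] by (simp add: o_def)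
  note y = assms[unfolded osolv_def osol_def, rule_format, OF x]
  show "((\<lambda>t. cnj (y I2 t)) has_integral cnj (y I1 x) - cnj (y I1 0)) {0..x}"
    using c[OF y[THEN conjunct1]] by simp
  show "((\<lambda>t. cnj (y I3 t) - of_real (p t) * cnj (y I1 t)) has_integral cnj (y I2 x) - cnj (y I2 0)) {0..x}"
    using c[OF y[THEN conjunct2, THEN conjunct1]] by simp
  show "((\<lambda>t. (cnj lam - of_real (q t)) * cnj (y I1 t) - of_real (p t) * cnj (y I2 t) + cnj (g t))
      has_integral cnj (y I3 x) - cnj (y I3 0)) {0..x}"
    using c[OF y[THEN conjunct2, THEN conjunct2]] by simp
qed

lemma phi_cnj:
  assumes "smallpot p q" "x \<in> {0..2}"
  shows "phi p q (cnj lam) j i x = cnj (phi p q lam j i x)"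
proof (rule phi_eqI[OF assms(1) order_refl _ _ assms(2)])
  show "osolv 2 p q (cnj lam) (\<lambda>_. 0) (\<lambda>i t. cnj (phi p q lam j i t))"
    using osolv_cnj[OF phi(1)[OF assms(1)]] by simp
qed (simp add: phi(2)[OF assms(1)])

text \<open>Both sides solve the adjoint equation with the same unit initial data. The gain is
  quantitative: a minor estimated as a product would cost \<open>exp (2 * growth z)\<close>, as an
  adjoint solution at \<open>x = 1\<close> it costs \<open>exp (growth (- z))\<close>.\<close>

lemma phi_minors:
  assumes p: "smallpot p q" and x: "x \<in> {0..2}"
  shows "phi p (\<lambda>x. - q x) (- lam) I1 i x = sel3
        (phi p q lam I1 I1 x * phi p q lam I2 I2 x - phi p q lam I1 I2 x * phi p q lam I2 I1 x)
        (phi p q lam I1 I1 x * phi p q lam I2 I3 x - phi p q lam I1 I3 x * phi p q lam I2 I1 x)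
        (phi p q lam I1 I2 x * phi p q lam I2 I3 x - phi p q lam I1 I3 x * phi p q lam I2 I2 x) i"
    "phi p (\<lambda>x. - q x) (- lam) I2 i x = sel3
        (phi p q lam I1 I1 x * phi p q lam I3 I2 x - phi p q lam I1 I2 x * phi p q lam I3 I1 x)
        (phi p q lam I1 I1 x * phi p q lam I3 I3 x - phi p q lam I1 I3 x * phi p q lam I3 I1 x)
        (phi p q lam I1 I2 x * phi p q lam I3 I3 x - phi p q lam I1 I3 x * phi p q lam I3 I2 x) i"
    "phi p (\<lambda>x. - q x) (- lam) I3 i x = sel3
        (phi p q lam I2 I1 x * phi p q lam I3 I2 x - phi p q lam I2 I2 x * phi p q lam I3 I1 x)
        (phi p q lam I2 I1 x * phi p q lam I3 I3 x - phi p q lam I2 I3 x * phi p q lam I3 I1 x)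
        (phi p q lam I2 I2 x * phi p q lam I3 I3 x - phi p q lam I2 I3 x * phi p q lam I3 I2 x) i"
proof -
  let ?c = "\<lambda>j k i t. sel3 (phi p q lam j I1 t * phi p q lam k I2 t - phi p q lam j I2 t * phi p q lam k I1 t)
        (phi p q lam j I1 t * phi p q lam k I3 t - phi p q lam j I3 t * phi p q lam k I1 t)
        (phi p q lam j I2 t * phi p q lam k I3 t - phi p q lam j I3 t * phi p q lam k I2 t) i"
  have "osolv 2 p (\<lambda>x. - q x) (- lam) (\<lambda>_. 0) (?c j k)" for j k
    using osol_cross[OF p order_refl phi(1)[OF p, unfolded osolv_def] phi(1)[OF p, unfolded osolv_def], of lam j k]
    by (simp add: osolv_def)
  note eqI = phi_eqI[OF pot_uminus[OF p] order_refl this _ x]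
  show "phi p (\<lambda>x. - q x) (- lam) I1 i x = ?c I1 I2 i x"
    by (rule eqI) (case_tac i; simp add: phi(2)[OF p])
  show "phi p (\<lambda>x. - q x) (- lam) I2 i x = ?c I1 I3 i x"
    by (rule eqI) (case_tac i; simp add: phi(2)[OF p])
  show "phi p (\<lambda>x. - q x) (- lam) I3 i x = ?c I2 I3 i x"
    by (rule eqI) (case_tac i; simp add: phi(2)[OF p])
qed

text \<open>Under \<open>x\<close> to \<open>2 - x\<close> odd derivatives change sign, hence so do
  \<open>q\<close>, \<open>lam\<close> and the forcing; periodicity turns \<open>p (2 - x)\<close>
  into \<open>p (1 - x)\<close>.\<close>

lemma osolv_reflect:
  assumes p: "smallpot p q" and y: "osolv 2 p q lam g y"
  shows "osolv 2 (\<lambda>x. p (1 - x)) (\<lambda>x. - q (1 - x)) (- lam) (\<lambda>t. - g (2 - t))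
    (\<lambda>i t. (if i = I2 then - y i (2 - t) else y i (2 - t)))"
proof -
  have per: "p (2 - x) = p (1 - x)" "q (2 - x) = q (1 - x)" for x
    using potD(2,4)[OF p, of "1 - x"] by (auto simp: algebra_simps)
  have "((\<lambda>t. - f (2 - t)) has_integral (F (2 - x) - F 2)) {0..x}"
    if "x \<in> {0..2}" "\<And>x. x \<in> {0..2} \<Longrightarrow> (f has_integral (F x - F 0)) {0..x}" for f F :: "real \<Rightarrow> complex" and x
  proof -
    have "(f has_integral (F 2 - F (2 - x))) {2 - x..2}"
      by (rule indefinite_integral_difference[where b = 2]) (use that in auto)
    then have "((\<lambda>t. f (- t)) has_integral (F 2 - F (2 - x))) {-2..-(2-x)}"
      by (subst has_integral_reflect_real)
    from has_integral_neg[OF has_integral_shift_real_ivl[OF this, of "-2"]] show ?thesis by simp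
  qed
  note tr = this
  note y' = y[unfolded osolv_def osol_def, rule_format]
  show ?thesis
    unfolding osolv_def osol_def
  proof (intro ballI conjI)
    fix x :: real assume x: "x \<in> {0..2}"
    show "((\<lambda>t. if I2 = I2 then - y I2 (2 - t) else y I2 (2 - t)) has_integral
          (if I1 = I2 then - y I1 (2 - x) else y I1 (2 - x)) - (if I1 = I2 then - y I1 (2 - 0) else y I1 (2 - 0))) {0..x}"
      using tr[OF x y'[THEN conjunct1]] by simp
    show "((\<lambda>t. (if I3 = I2 then - y I3 (2 - t) else y I3 (2 - t)) -
         complex_of_real (p (1 - t)) * (if I1 = I2 then - y I1 (2 - t) else y I1 (2 - t))) has_integral
          (if I2 = I2 then - y I2 (2 - x) else y I2 (2 - x)) - (if I2 = I2 then - y I2 (2 - 0) else y I2 (2 - 0))) {0..x}"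
      using has_integral_neg[OF tr[OF x y'[THEN conjunct2, THEN conjunct1]]] by (simp add: per algebra_simps)
    show "((\<lambda>t. (- lam - complex_of_real (- q (1 - t))) * (if I1 = I2 then - y I1 (2 - t) else y I1 (2 - t)) -
         complex_of_real (p (1 - t)) * (if I2 = I2 then - y I2 (2 - t) else y I2 (2 - t)) + - g (2 - t)) has_integral
          (if I3 = I2 then - y I3 (2 - x) else y I3 (2 - x)) - (if I3 = I2 then - y I3 (2 - 0) else y I3 (2 - 0))) {0..x}"
      using tr[OF x y'[THEN conjunct2, THEN conjunct2]] by (simp add: per algebra_simps)
  qed
qed

section \<open>Comparison with the free equation\<close>

definition omega :: complex where "omega = Complex (-1/2) (sqrt 3 / 2)"

lemma omega_square: "omega\<^sup>2 = Complex (-1/2) (- sqrt 3 / 2)"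
  by (simp add: omega_def power2_eq_square complex_eq_iff)

lemma omega_cube: "omega ^ 3 = 1"
proof -
  have "omega ^ 3 = omega * omega\<^sup>2" by (simp add: power3_eq_cube power2_eq_square)
  then show ?thesis by (simp add: omega_square) (simp add: omega_def complex_eq_iff)
qed

lemma omega_sum: "1 + omega + omega\<^sup>2 = 0"
  by (simp add: omega_square) (simp add: omega_def complex_eq_iff)

lemma omega_sum2: "1 + omega\<^sup>2 + omega = 0"
  using omega_sum by (simp add: add_ac)

lemma omega_mult: "omega * omega = omega\<^sup>2" "omega * omega\<^sup>2 = 1" "omega\<^sup>2 * omega = 1" "omega\<^sup>2 * omega\<^sup>2 = omega"
proof -
  show "omega * omega = omega\<^sup>2" by (simp add: power2_eq_square)
  show "omega * omega\<^sup>2 = 1" "omega\<^sup>2 * omega = 1"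
    using omega_cube by (simp_all add: power3_eq_cube power2_eq_square mult.assoc)
  show "omega\<^sup>2 * omega\<^sup>2 = omega"
    using omega_cube by (simp add: power3_eq_cube power2_eq_square mult.assoc)
qed

lemma norm_omega: "cmod omega = 1" "cmod (omega\<^sup>2) = 1"
  by (simp_all add: omega_def cmod_def norm_power power2_eq_square)

lemma cnj_omega: "cnj omega = omega\<^sup>2" "cnj (omega\<^sup>2) = omega"
  unfolding omega_square unfolding omega_def by (simp_all add: complex_eq_iff)

lemma Re_omega: "Re (omega * z) = - Re z / 2 - sqrt 3 / 2 * Im z" "Re (omega\<^sup>2 * z) = - Re z / 2 + sqrt 3 / 2 * Im z"
  "Im (omega * z) = sqrt 3 / 2 * Re z - Im z / 2" "Im (omega\<^sup>2 * z) = - sqrt 3 / 2 * Re z - Im z / 2"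
  unfolding omega_square unfolding omega_def by simp_all

text \<open>The largest real part among the cube roots of \<open>z ^ 3\<close>;
  \<open>growth (- z)\<close> is minus the smallest one.\<close>

definition growth :: "complex \<Rightarrow> real" where
  "growth z = max (Re z) (max (Re (omega * z)) (Re (omega\<^sup>2 * z)))"

lemma growth_ge: "Re z \<le> growth z" "Re (omega * z) \<le> growth z" "Re (omega\<^sup>2 * z) \<le> growth z"
  by (auto simp: growth_def)

lemma growth_nonneg: "0 \<le> growth z"
  unfolding growth_def Re_omega by (auto simp: max_def field_simps)

text \<open>The floor \<open>1\<close> keeps the weighted estimates valid near \<open>z = 0\<close>,
  where the kernels do not decay in \<open>z\<close>.\<close>

definition scale :: "complex \<Rightarrow> real" where "scale z = max 1 (cmod z)"

lemma scale_ge: "1 \<le> scale z" "cmod z \<le> scale z" "0 < scale z"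
  by (auto simp: scale_def)

text \<open>\<open>ker0\<close>, \<open>ker1\<close>, \<open>ker2\<close> are the solutions of
  \<open>y''' = z ^ 3 * y\<close> whose only nonzero datum at \<open>0\<close> is \<open>y\<close>,
  \<open>y'\<close>, \<open>y''\<close> respectively, equal to \<open>1\<close>. The exponential
  formulas for the last two have a removable singularity at \<open>z = 0\<close>.\<close>

definition ker0 :: "complex \<Rightarrow> complex \<Rightarrow> complex" where
  "ker0 z t = (exp (z * t) + exp (omega * z * t) + exp (omega\<^sup>2 * z * t)) / 3"
definition ker1 :: "complex \<Rightarrow> complex \<Rightarrow> complex" where
  "ker1 z t = (if z = 0 then t else (exp (z * t) + omega\<^sup>2 * exp (omega * z * t) + omega * exp (omega\<^sup>2 * z * t)) / (3 * z))"
definition ker2 :: "complex \<Rightarrow> complex \<Rightarrow> complex" where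
  "ker2 z t = (if z = 0 then t\<^sup>2 / 2 else (exp (z * t) + omega * exp (omega * z * t) + omega\<^sup>2 * exp (omega\<^sup>2 * z * t)) / (3 * z\<^sup>2))"

lemma cube_times_ker: "z ^ 3 * ker2 z t = z * (exp (z * t) + omega * exp (omega * z * t) + omega\<^sup>2 * exp (omega\<^sup>2 * z * t)) / 3"
  "z ^ 3 * ker1 z t = z\<^sup>2 * (exp (z * t) + omega\<^sup>2 * exp (omega * z * t) + omega * exp (omega\<^sup>2 * z * t)) / 3"
  by (auto simp: ker2_def ker1_def power3_eq_cube power2_eq_square)

lemma exp_comb_derivative:
  "((\<lambda>t. (a * exp (z * t) + b * exp (omega * z * t) + c * exp (omega\<^sup>2 * z * t)) / d) has_field_derivative
     z * (a * exp (z * t) + (b * omega) * exp (omega * z * t) + (c * omega\<^sup>2) * exp (omega\<^sup>2 * z * t)) / d) (at t)"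
  by (auto intro!: derivative_eq_intros simp: divide_inverse algebra_simps)

lemma C_derivative:
  "(ker0 z has_field_derivative z ^ 3 * ker2 z t) (at t)"
  "(ker1 z has_field_derivative ker0 z t) (at t)"
  "(ker2 z has_field_derivative ker1 z t) (at t)"
proof -
  show "(ker0 z has_field_derivative z ^ 3 * ker2 z t) (at t)"
    unfolding cube_times_ker unfolding ker0_def[abs_def]
    using exp_comb_derivative[of 1 z 1 1 3 t] by simp
  show "(ker1 z has_field_derivative ker0 z t) (at t)"
  proof (cases "z = 0")
    case True
    then show ?thesis by (simp add: ker1_def[abs_def] ker0_def)
  next
    case False
    then show ?thesis
      using exp_comb_derivative[of 1 z "omega\<^sup>2" omega "3 * z" t] by (simp add: ker1_def[abs_def] ker0_def omega_mult)
  qed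
  show "(ker2 z has_field_derivative ker1 z t) (at t)"
  proof (cases "z = 0")
    case True
    have "((\<lambda>t. t\<^sup>2 / 2) has_field_derivative t) (at t)" for t :: complex
      by (auto intro!: derivative_eq_intros)
    with True show ?thesis by (simp add: ker1_def ker2_def[abs_def])
  next
    case False
    then have "z * (1 * exp (z * t) + (omega * omega) * exp (omega * z * t) + (omega\<^sup>2 * omega\<^sup>2) * exp (omega\<^sup>2 * z * t)) / (3 * z\<^sup>2) = ker1 z t"
      unfolding omega_mult by (simp add: ker1_def power2_eq_square[of z])
    then show ?thesis
      using exp_comb_derivative[of 1 z "omega" "omega\<^sup>2" "3 * z\<^sup>2" t] False
      by (simp add: ker2_def[abs_def])
  qed
qed

lemma norm_exp_growth:
  assumes "0 \<le> t"
  shows "cmod (exp (z * of_real t)) \<le> exp (growth z * t)" "cmod (exp (omega * z * of_real t)) \<le> exp (growth z * t)"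
    "cmod (exp (omega\<^sup>2 * z * of_real t)) \<le> exp (growth z * t)"
proof -
  have "cmod (exp (a * of_real t)) \<le> exp (growth z * t)" if "Re a \<le> growth z" for a
    using that assms by (simp add: mult_right_mono)
  then show "cmod (exp (z * of_real t)) \<le> exp (growth z * t)" "cmod (exp (omega * z * of_real t)) \<le> exp (growth z * t)"
    "cmod (exp (omega\<^sup>2 * z * of_real t)) \<le> exp (growth z * t)"
    using growth_ge by blast+
qed

lemma norm_exp_comb:
  assumes "0 \<le> t" "cmod a \<le> 1" "cmod b \<le> 1"
  shows "cmod (exp (z * of_real t) + a * exp (omega * z * of_real t) + b * exp (omega\<^sup>2 * z * of_real t)) \<le> 3 * exp (growth z * t)"
proof -
  have "cmod (a * exp (omega * z * of_real t)) \<le> 1 * exp (growth z * t)" "cmod (b * exp (omega\<^sup>2 * z * of_real t)) \<le> 1 * exp (growth z * t)"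
    unfolding norm_mult[of a] norm_mult[of b] using assms norm_exp_growth[OF assms(1), of z] by (intro mult_mono; auto)+
  then show ?thesis
    using norm_exp_growth(1)[OF assms(1), of z] by (intro order_trans[OF norm_triangle_ineq]
      order_trans[OF add_mono[OF norm_triangle_ineq order_refl]]) linarith
qed

lemma ker0_bound: "0 \<le> t \<Longrightarrow> cmod (ker0 z (of_real t)) \<le> exp (growth z * t)"
  using norm_exp_comb[of t 1 1 z] by (simp add: ker0_def norm_divide)

text \<open>For small \<open>z\<close> the division by \<open>z\<close> spoils the direct estimate,
  so the bound on \<open>ker0\<close> is integrated once and twice; \<open>4\<close> is the square
  of the interval length.\<close>

lemma ker1_C2_bound_small:
  assumes "0 \<le> t" "t \<le> 2"
  shows "cmod (ker1 z (of_real t)) \<le> 4 * exp (growth z * t)" "cmod (ker2 z (of_real t)) \<le> 4 * exp (growth z * t)"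
proof -
  have step: "cmod (F (of_real x)) \<le> x * B"
    if x: "0 \<le> x" and F: "\<And>t. (F has_field_derivative G t) (at t)" "F 0 = 0"
      and G: "\<And>s. 0 \<le> s \<Longrightarrow> s \<le> x \<Longrightarrow> cmod (G (of_real s)) \<le> B" for x B and F G :: "complex \<Rightarrow> complex"
  proof -
    have hi: "((\<lambda>s. G (of_real s)) has_integral (F (of_real x) - F (of_real 0))) {0..x}"
      using x by (intro fundamental_theorem_of_calculus has_vector_derivative_real_field
          has_field_derivative_at_within[OF F(1)]) auto
    have ki: "((\<lambda>s. B) has_integral x * B) {0..x}"
      using has_integral_const_real[of B 0 x] x by simp
    show ?thesis
      using integral_norm_bound_integral[OF has_integral_integrable[OF hi] has_integral_integrable[OF ki]] G F(2)
      unfolding integral_unique[OF hi] integral_unique[OF ki] by simp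
  qed
  have mono: "exp (growth z * s) \<le> exp (growth z * x)" if "s \<le> x" for s x
    using that growth_nonneg[of z] by (simp add: mult_left_mono)
  have 1: "cmod (ker1 z (of_real x)) \<le> x * exp (growth z * x)" if "0 \<le> x" for x
  proof (rule step[OF that C_derivative(2)])
    show "ker1 z 0 = 0"
      by (simp add: ker1_def omega_sum omega_sum2)
    show "cmod (ker0 z (of_real s)) \<le> exp (growth z * x)" if "0 \<le> s" "s \<le> x" for s
      using ker0_bound[OF that(1)] mono[OF that(2)] by (rule order_trans)
  qed
  have 2: "cmod (ker2 z (of_real x)) \<le> x * (x * exp (growth z * x))" if "0 \<le> x" for x
  proof (rule step[OF that C_derivative(3)])
    show "ker2 z 0 = 0"
      by (simp add: ker2_def omega_sum omega_sum2)
    show "cmod (ker1 z (of_real s)) \<le> x * exp (growth z * x)" if "0 \<le> s" "s \<le> x" for s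
      using 1[OF that(1)] mult_mono[OF that(2) mono[OF that(2)]] that by auto
  qed
  show "cmod (ker1 z (of_real t)) \<le> 4 * exp (growth z * t)"
    using 1[OF assms(1)] assms(2) by (auto elim!: order_trans intro!: mult_right_mono)
  note 2[OF assms(1)]
  also have "t * (t * exp (growth z * t)) \<le> 2 * (2 * exp (growth z * t))"
    using assms by (intro mult_mono) auto
  finally show "cmod (ker2 z (of_real t)) \<le> 4 * exp (growth z * t)"
    by simp
qed

text \<open>The power of \<open>scale z\<close> carried by each component: a derivative costs one
  factor of size \<open>z\<close>.\<close>

definition weight :: "idx3 \<Rightarrow> nat" where "weight = sel3 0 1 2"

text \<open>The index order is opposite to that of \<open>phi\<close>: component \<open>i\<close>,
  then initial datum \<open>k\<close>. Time is complex so that field derivatives apply.\<close>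

definition phi0 :: "complex \<Rightarrow> idx3 \<Rightarrow> idx3 \<Rightarrow> complex \<Rightarrow> complex" where
  "phi0 z i k t = sel3 (sel3 (ker0 z t) (ker1 z t) (ker2 z t) k) (sel3 (z ^ 3 * ker2 z t) (ker0 z t) (ker1 z t) k)
     (sel3 (z ^ 3 * ker1 z t) (z ^ 3 * ker2 z t) (ker0 z t) k) i"

text \<open>The derivative acts on the datum index rather than on the component index, because a
  matrix exponential commutes with its generator. This is the form needed when the kernel is
  evaluated at \<open>x - t\<close>.\<close>

lemma phi0_derivative:
  "(phi0 z i I3 has_field_derivative phi0 z i I2 t) (at t)"
  "(phi0 z i I2 has_field_derivative phi0 z i I1 t) (at t)"
  "(phi0 z i I1 has_field_derivative z ^ 3 * phi0 z i I3 t) (at t)"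
  by (cases i; auto simp: phi0_def[abs_def] intro!: C_derivative DERIV_cmult)+

lemma phi0_0: "phi0 z i k 0 = of_bool (i = k)"
proof -
  have "ker0 z 0 = 1" "ker1 z 0 = 0" "ker2 z 0 = 0"
    by (auto simp: ker0_def ker1_def ker2_def omega_sum omega_sum2)
  then show ?thesis by (cases i; cases k) (auto simp: phi0_def)
qed

text \<open>Conjugation by the diagonal matrix of the powers \<open>scale z ^ weight\<close> makes
  all nine entries comparable to \<open>exp (growth z * t)\<close>; the factor \<open>4\<close>
  comes from the kernels with \<open>|z| <= 1\<close>.\<close>

lemma phi0_bound:
  assumes "0 \<le> t" "t \<le> 2"
  shows "cmod (phi0 z i k (of_real t)) * scale z ^ weight k \<le> 4 * scale z ^ weight i * exp (growth z * t)"
proof -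
  let ?e = "exp (growth z * t)"
  have e: "0 < ?e" by simp
  have b0: "cmod (ker0 z (of_real t)) \<le> ?e" using ker0_bound[OF assms(1)] .
  have b1: "cmod (ker1 z (of_real t)) * scale z \<le> 4 * ?e"
  proof (cases "cmod z \<le> 1")
    case True
    then show ?thesis using ker1_C2_bound_small[OF assms, of z] by (simp add: scale_def)
  next
    case False
    then have "z \<noteq> 0" by auto
    then have "cmod (ker1 z (of_real t)) * cmod z \<le> ?e"
      using norm_exp_comb[OF assms(1), of "omega\<^sup>2" omega z] by (simp add: ker1_def norm_omega norm_divide norm_mult)
    moreover have "scale z = cmod z" using False by (simp add: scale_def)
    moreover have "?e \<le> 4 * ?e" by simp
    ultimately show ?thesis by (metis order_trans)
  qed
  have b2: "cmod (ker2 z (of_real t)) * scale z ^ 2 \<le> 4 * ?e"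
  proof (cases "cmod z \<le> 1")
    case True
    then show ?thesis using ker1_C2_bound_small[OF assms, of z] by (simp add: scale_def)
  next
    case False
    then have "z \<noteq> 0" by auto
    then have "cmod (ker2 z (of_real t)) * cmod z ^ 2 \<le> ?e"
      using norm_exp_comb[OF assms(1), of omega "omega\<^sup>2" z] by (simp add: ker2_def norm_omega norm_divide norm_mult norm_power)
    moreover have "scale z = cmod z" using False by (simp add: scale_def)
    moreover have "?e \<le> 4 * ?e" by simp
    ultimately show ?thesis by (metis order_trans)
  qed
  have b3: "cmod (z ^ 3 * ker2 z (of_real t)) \<le> scale z * ?e"
  proof -
    have "cmod (z ^ 3 * ker2 z (of_real t)) \<le> cmod z * ?e"
      using mult_left_mono[OF norm_exp_comb[OF assms(1), of omega "omega\<^sup>2" z], of "cmod z"]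
      by (simp add: cube_times_ker norm_omega norm_divide norm_mult)
    also have "\<dots> \<le> scale z * ?e" by (intro mult_right_mono scale_ge) auto
    finally show ?thesis .
  qed
  have b4: "cmod (z ^ 3 * ker1 z (of_real t)) \<le> scale z ^ 2 * ?e"
  proof -
    have "cmod (z ^ 3 * ker1 z (of_real t)) \<le> cmod z ^ 2 * ?e"
      using mult_left_mono[OF norm_exp_comb[OF assms(1), of "omega\<^sup>2" omega z], of "cmod z ^ 2"]
      by (simp add: cube_times_ker norm_omega norm_divide norm_mult norm_power)
    also have "\<dots> \<le> scale z ^ 2 * ?e" by (intro mult_right_mono power_mono scale_ge) auto
    finally show ?thesis .
  qed
  have s: "scale z > 0" using scale_ge by auto
  have "cmod (ker0 z (of_real t)) * scale z \<le> 4 * scale z * ?e" "cmod (ker0 z (of_real t)) * scale z ^ 2 \<le> 4 * scale z ^ 2 * ?e"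
    "cmod (ker1 z (of_real t)) * scale z ^ 2 \<le> 4 * scale z * ?e"
    "cmod (z ^ 3 * ker2 z (of_real t)) \<le> 4 * scale z * ?e" "cmod (z ^ 3 * ker2 z (of_real t)) * scale z \<le> 4 * scale z ^ 2 * ?e"
    "cmod (z ^ 3 * ker1 z (of_real t)) \<le> 4 * scale z ^ 2 * ?e" "cmod (ker0 z (of_real t)) \<le> 4 * ?e"
  proof -
    show "cmod (ker0 z (of_real t)) \<le> 4 * ?e" using b0 e by linarith
    then show "cmod (ker0 z (of_real t)) * scale z \<le> 4 * scale z * ?e" "cmod (ker0 z (of_real t)) * scale z ^ 2 \<le> 4 * scale z ^ 2 * ?e"
      using s by (auto simp: mult.commute mult.left_commute)
    show "cmod (ker1 z (of_real t)) * scale z ^ 2 \<le> 4 * scale z * ?e"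
      using mult_right_mono[OF b1, of "scale z"] s by (simp add: power2_eq_square mult_ac)
    show "cmod (z ^ 3 * ker1 z (of_real t)) \<le> 4 * scale z ^ 2 * ?e"
      using b4 mult_pos_pos[of "scale z ^ 2" ?e] s by (auto intro: order_trans)
    show c2: "cmod (z ^ 3 * ker2 z (of_real t)) \<le> 4 * scale z * ?e"
      using b3 mult_pos_pos[of "scale z" ?e] s by (auto intro: order_trans)
    show "cmod (z ^ 3 * ker2 z (of_real t)) * scale z \<le> 4 * scale z ^ 2 * ?e"
      using mult_right_mono[OF c2, of "scale z"] s by (simp add: power2_eq_square mult_ac)
  qed
  with b1 b2 show ?thesis
    by (cases i; cases k) (simp_all add: phi0_def weight_def)
qed

section \<open>Duhamel comparison with the free equation, uniform in \<open>z\<close>\<close>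

lemma osolv_free_representation:
  assumes p: "smallpot p q" and y: "osolv 2 p q (z ^ 3) (\<lambda>_. 0) y" and x: "x \<in> {0..2}"
  shows "((\<lambda>t. - ((of_real (q t) * y I1 t + of_real (p t) * y I2 t) * phi0 z i I3 (of_real (x - t))
        + of_real (p t) * y I1 t * phi0 z i I2 (of_real (x - t)))) has_integral
      y i x - (\<Sum>k\<in>UNIV. y k 0 * phi0 z i k (of_real x))) {0..x}"
proof -
  have yx: "osol x p q (z ^ 3) (\<lambda>_. 0) (y I1) (y I2) (y I3)"
    using y x by (auto simp: osolv_def intro: osol_subset)
  have x2: "x \<le> 2" using x by auto
  note a = osol_abs_cont[OF p x2 continuous_on_const yx]
  have kac: "abs_cont x (\<lambda>t. F (of_real (x - t))) (\<lambda>t. - G (of_real (x - t)))"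
    if F: "\<And>t. (F has_field_derivative G t) (at t)" and G: "\<And>t. (G has_field_derivative H t) (at t)" for F G H :: "complex \<Rightarrow> complex"
  proof (rule abs_cont_derivative)
    show "((\<lambda>t. F (of_real (x - t))) has_vector_derivative - G (of_real (x - t))) (at t)" for t
    proof -
      have "((\<lambda>t. F (of_real x - t)) has_field_derivative G (of_real x - of_real t) * (- 1)) (at (of_real t))"
        by (rule DERIV_chain2[OF F]) (auto intro!: derivative_eq_intros)
      from has_vector_derivative_real_field[OF this] show ?thesis by simp
    qed
    have "continuous_on UNIV G"
      using G by (auto intro!: continuous_at_imp_continuous_on DERIV_isCont)
    then have "continuous_on {0..x} (\<lambda>t. G (of_real (x - t)))"
      by (rule continuous_on_compose2) (auto intro!: continuous_intros)
    then show "continuous_on {0..x} (\<lambda>t. - G (of_real (x - t)))"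
      by (rule continuous_on_minus)
  qed
  have k3: "abs_cont x (\<lambda>t. phi0 z i I3 (of_real (x - t))) (\<lambda>t. - phi0 z i I2 (of_real (x - t)))"
    by (rule kac[OF phi0_derivative(1,2)])
  have k2: "abs_cont x (\<lambda>t. phi0 z i I2 (of_real (x - t))) (\<lambda>t. - phi0 z i I1 (of_real (x - t)))"
    by (rule kac[OF phi0_derivative(2,3)])
  have k1: "abs_cont x (\<lambda>t. phi0 z i I1 (of_real (x - t))) (\<lambda>t. - (z ^ 3 * phi0 z i I3 (of_real (x - t))))"
    by (rule kac[OF phi0_derivative(3) DERIV_cmult[OF phi0_derivative(1)]])
  \<comment> \<open>This sum is \<open>y i x\<close> at \<open>t = x\<close> and the free evolution
    of the initial data at \<open>t = 0\<close>; the free terms of its derivative cancel and only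
    the potentials remain.\<close>
  have "abs_cont x (\<lambda>t. y I3 t * phi0 z i I3 (of_real (x - t)) + y I2 t * phi0 z i I2 (of_real (x - t)) + y I1 t * phi0 z i I1 (of_real (x - t)))
    (\<lambda>t. - ((of_real (q t) * y I1 t + of_real (p t) * y I2 t) * phi0 z i I3 (of_real (x - t))
        + of_real (p t) * y I1 t * phi0 z i I2 (of_real (x - t))))"
    by (rule abs_cont_cong[OF abs_cont_add[OF abs_cont_add[OF abs_cont_mult[OF a(3) k3] abs_cont_mult[OF a(2) k2]] abs_cont_mult[OF a(1) k1]]])
      (simp_all add: algebra_simps)
  from abs_cont_has_integral[OF this, of 0 x] show ?thesis
    using x by (cases i) (simp_all add: sum_idx3 phi0_0 algebra_simps)
qed

text \<open>Let \<open>a\<close> be the maximum of the weighted solution over \<open>{0..2}\<close>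
  and over the components. Duhamel's formula bounds the deviation from the free solution by
  \<open>24 * d * a <= a / 2\<close> in weighted form, so \<open>a\<close> is at most twice the free
  bound, whence \<open>8 = 2 * 4\<close> and \<open>192 = 24 * 8\<close>.\<close>

lemma phi_estimate:
  assumes p: "pot d p q" and d: "d \<le> 1/48" and x: "x \<in> {0..2}"
  shows "cmod (phi p q (z ^ 3) j i x) * scale z ^ weight j \<le> 8 * scale z ^ weight i * exp (growth z * x)"
    and "cmod (phi p q (z ^ 3) j i x - phi0 z i j (of_real x)) * scale z ^ weight j \<le> 192 * d * scale z ^ weight i * exp (growth z * x)"
proof -
  have sp: "smallpot p q" using pot_mono[OF p] d by auto
  have d0: "0 \<le> d" using potD(5)[OF p] .
  let ?y = "phi p q (z ^ 3) j"
  note y = phi(1)[OF sp, of "z ^ 3" j]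
  let ?s = "scale z" and ?m = "growth z"
  have s: "?s > 0" "?s \<ge> 1" using scale_ge by auto
  define G where "G = (\<lambda>x. Max (range (\<lambda>i. cmod (?y i x) / (?s ^ weight i * exp (?m * x)))))"
  have G: "G x = max (cmod (?y I1 x) / (?s ^ weight I1 * exp (?m * x)))
     (max (cmod (?y I2 x) / (?s ^ weight I2 * exp (?m * x))) (cmod (?y I3 x) / (?s ^ weight I3 * exp (?m * x))))" for x
    by (simp add: G_def UNIV_idx3)
  have "continuous_on {0..2} G"
    unfolding G using s phi_continuous_on[OF sp] by (intro continuous_intros) auto
  then obtain x0 where x0: "x0 \<in> {0..2}" "\<And>x. x \<in> {0..2} \<Longrightarrow> G x \<le> G x0"
    using continuous_attains_sup[of "{0..2::real}" G] by auto
  define a where "a = G x0"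
  have aG: "cmod (?y i x) \<le> a * ?s ^ weight i * exp (?m * x)" if "x \<in> {0..2}" for i x
  proof -
    have "cmod (?y i x) / (?s ^ weight i * exp (?m * x)) \<le> G x"
      unfolding G_def by (intro Max_ge) auto
    also have "\<dots> \<le> a" using x0 that by (simp add: a_def)
    finally show ?thesis using s by (simp add: field_simps)
  qed
  obtain i0 where i0: "a = cmod (?y i0 x0) / (?s ^ weight i0 * exp (?m * x0))"
  proof -
    have "G x0 \<in> range (\<lambda>i. cmod (?y i x0) / (?s ^ weight i * exp (?m * x0)))"
      unfolding G_def by (intro Max_in) auto
    then show ?thesis using that a_def by auto
  qed
  have a0: "0 \<le> a" unfolding i0 using s by simp
  have main: "cmod (?y i x - phi0 z i j (of_real x)) \<le> 24 * d * a * ?s ^ weight i * exp (?m * x)" if x: "x \<in> {0..2}" for i x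
  proof -
    let ?h = "\<lambda>t. - ((of_real (q t) * ?y I1 t + of_real (p t) * ?y I2 t) * phi0 z i I3 (of_real (x - t))
        + of_real (p t) * ?y I1 t * phi0 z i I2 (of_real (x - t)))"
    let ?E = "4 * a * ?s ^ weight i * exp (?m * x)"
    have hi: "(?h has_integral ?y i x - phi0 z i j (of_real x)) {0..x}"
      using osolv_free_representation[OF sp y x, of i] by (cases j) (simp_all add: sum_idx3 phi(2)[OF sp])
    have qi: "(\<lambda>t. \<bar>q t\<bar>) integrable_on {0..2}"
      using pot_integral_2(1)[OF p] by (simp add: absolutely_integrable_on_def)
    then have qx: "(\<lambda>t. \<bar>q t\<bar>) integrable_on {0..x}"
      by (rule integrable_subinterval_real) (use x in auto)
    have "integral {0..x} (\<lambda>t. \<bar>q t\<bar>) \<le> integral {0..2} (\<lambda>t. \<bar>q t\<bar>)"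
      by (rule integral_subset_le) (use qx qi x in auto)
    then have q2: "integral {0..x} (\<lambda>t. \<bar>q t\<bar>) \<le> 2 * d"
      using pot_integral_2(2)[OF p] by simp
    have ki: "((\<lambda>t. ?E * (\<bar>q t\<bar> + 2 * d)) has_integral ?E * (integral {0..x} (\<lambda>t. \<bar>q t\<bar>) + x * (2 * d))) {0..x}"
      using has_integral_const_real[of "2 * d" 0 x] x
      by (intro has_integral_mult_right has_integral_add) (use qx in auto)
    have bd: "cmod (?h t) \<le> ?E * (\<bar>q t\<bar> + 2 * d)" if t: "t \<in> {0..x}" for t
    proof -
      have t2: "t \<in> {0..2}" "0 \<le> x - t" "x - t \<le> 2" using t x by auto
      let ?F3 = "cmod (phi0 z i I3 (of_real (x - t)))" and ?F2 = "cmod (phi0 z i I2 (of_real (x - t)))"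
      have F: "?F3 * ?s ^ 2 \<le> 4 * ?s ^ weight i * exp (?m * (x - t))" "?F2 * ?s \<le> 4 * ?s ^ weight i * exp (?m * (x - t))"
        using phi0_bound[OF t2(2,3), of z i I3] phi0_bound[OF t2(2,3), of z i I2] by (simp_all add: weight_def)
      have "?F3 * ?s \<le> ?F3 * ?s ^ 2" "?F3 * 1 \<le> ?F3 * ?s ^ 2" "?F2 * 1 \<le> ?F2 * ?s"
        using s by (intro mult_left_mono self_le_power one_le_power; simp)+
      then have F3: "?F3 * ?s \<le> 4 * ?s ^ weight i * exp (?m * (x - t))" "?F3 \<le> 4 * ?s ^ weight i * exp (?m * (x - t))"
        "?F2 \<le> 4 * ?s ^ weight i * exp (?m * (x - t))"
        using F by linarith+
      have Y: "cmod (?y I1 t) \<le> a * exp (?m * t)" "cmod (?y I2 t) \<le> a * ?s * exp (?m * t)"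
        using aG[OF t2(1), of I1] aG[OF t2(1), of I2] by (simp_all add: weight_def)
      have growth2: "exp (?m * t) * exp (?m * (x - t)) = exp (?m * x)"
        by (simp flip: exp_add add: algebra_simps)
      have EE: "a * exp (?m * t) * (4 * ?s ^ weight i * exp (?m * (x - t))) = ?E"
        unfolding growth2[symmetric] by (simp only: mult_ac)
      have P1: "cmod (?y I1 t) * ?F3 \<le> ?E"
        using mult_mono[OF Y(1) F3(2)] a0 unfolding EE by simp
      have P2: "cmod (?y I1 t) * ?F2 \<le> ?E"
        using mult_mono[OF Y(1) F3(3)] a0 unfolding EE by simp
      \<comment> \<open>\<open>y'\<close> costs one factor \<open>scale z\<close>; it is paid for by
        the kernel with datum \<open>I3\<close>, which carries \<open>scale z\<close> to the power
        \<open>-2\<close>. This keeps the \<open>p\<close>-term from growing with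
        \<open>z\<close>.\<close>
      have "cmod (?y I2 t) * ?F3 \<le> a * ?s * exp (?m * t) * ?F3"
        using Y(2) by (intro mult_right_mono) auto
      also have "\<dots> = a * exp (?m * t) * (?F3 * ?s)" by simp
      also have "\<dots> \<le> a * exp (?m * t) * (4 * ?s ^ weight i * exp (?m * (x - t)))"
        using F3(1) a0 by (intro mult_left_mono) auto
      also have "\<dots> = ?E" by (rule EE)
      finally have P3: "cmod (?y I2 t) * ?F3 \<le> ?E" .
      have E0: "0 \<le> ?E" using a0 s by simp
      have "cmod (?h t) \<le> \<bar>q t\<bar> * (cmod (?y I1 t) * ?F3) + \<bar>p t\<bar> * (cmod (?y I2 t) * ?F3) + \<bar>p t\<bar> * (cmod (?y I1 t) * ?F2)"
      proof -
        have "?h t = - (of_real (q t) * ?y I1 t * phi0 z i I3 (of_real (x - t)) + of_real (p t) * ?y I2 t * phi0 z i I3 (of_real (x - t))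
           + of_real (p t) * ?y I1 t * phi0 z i I2 (of_real (x - t)))"
          by (simp add: algebra_simps)
        also have "cmod \<dots> \<le> cmod (of_real (q t) * ?y I1 t * phi0 z i I3 (of_real (x - t))) + cmod (of_real (p t) * ?y I2 t * phi0 z i I3 (of_real (x - t)))
           + cmod (of_real (p t) * ?y I1 t * phi0 z i I2 (of_real (x - t)))"
          unfolding norm_minus_cancel by (intro order_trans[OF norm_triangle_ineq] add_mono order_refl norm_triangle_ineq)
        finally show ?thesis by (simp add: norm_mult mult.assoc)
      qed
      also have "\<dots> \<le> \<bar>q t\<bar> * ?E + d * ?E + d * ?E"
        using E0 potD(3)[OF p, of t] d0 by (intro add_mono mult_left_mono[OF P1] mult_mono[OF _ P3] mult_mono[OF _ P2]) auto
      finally show ?thesis by (simp add: algebra_simps)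
    qed
    have "cmod (?y i x - phi0 z i j (of_real x)) \<le> ?E * (integral {0..x} (\<lambda>t. \<bar>q t\<bar>) + x * (2 * d))"
      using integral_norm_bound_integral[OF has_integral_integrable[OF hi] has_integral_integrable[OF ki] bd]
      unfolding integral_unique[OF hi] integral_unique[OF ki] .
    \<comment> \<open>\<open>2 * d\<close> is the mass of \<open>q\<close> over two periods,
      \<open>4 * d\<close> comes from the two \<open>p\<close>-terms on length \<open>2\<close>;
      with the \<open>4\<close> inside \<open>?E\<close> this is the constant
      \<open>24\<close>.\<close>
    also have "\<dots> \<le> ?E * (2 * d + 2 * (2 * d))"
      using q2 x d0 a0 s by (intro mult_left_mono add_mono mult_right_mono) auto
    finally show ?thesis by (simp add: algebra_simps)
  qed
  have FB: "cmod (phi0 z i j (of_real x)) \<le> 4 * ?s ^ weight i * exp (?m * x) / ?s ^ weight j" if "x \<in> {0..2}" for i x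
    using phi0_bound[of x z i j] that s by (simp add: pos_le_divide_eq)
  have "cmod (?y i0 x0) \<le> cmod (?y i0 x0 - phi0 z i0 j (of_real x0)) + cmod (phi0 z i0 j (of_real x0))"
    by (metis diff_add_cancel norm_triangle_ineq)
  also have "\<dots> \<le> 24 * d * a * ?s ^ weight i0 * exp (?m * x0) + 4 * ?s ^ weight i0 * exp (?m * x0) / ?s ^ weight j"
    using main[OF x0(1)] FB[OF x0(1)] by (intro add_mono) auto
  also have "\<dots> = (24 * d * a + 4 / ?s ^ weight j) * (?s ^ weight i0 * exp (?m * x0))"
    by (simp add: algebra_simps)
  finally have "a \<le> 24 * d * a + 4 / ?s ^ weight j"
    using i0 s by (simp add: pos_divide_le_eq)
  also have "24 * d * a \<le> 1/2 * a"
    using d a0 by (intro mult_right_mono) auto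
  finally have a8: "a \<le> 8 / ?s ^ weight j" by simp
  then have a8': "a * ?s ^ weight j \<le> 8" using s by (simp add: pos_le_divide_eq)
  have "cmod (?y i x) * ?s ^ weight j \<le> a * ?s ^ weight i * exp (?m * x) * ?s ^ weight j"
    using aG[OF x] s by (intro mult_right_mono) auto
  also have "\<dots> = (a * ?s ^ weight j) * (?s ^ weight i * exp (?m * x))" by simp
  also have "\<dots> \<le> 8 * (?s ^ weight i * exp (?m * x))"
    using a8' s by (intro mult_right_mono) auto
  finally show "cmod (?y i x) * ?s ^ weight j \<le> 8 * ?s ^ weight i * exp (?m * x)" by simp
  have "cmod (?y i x - phi0 z i j (of_real x)) * ?s ^ weight j \<le> 24 * d * a * ?s ^ weight i * exp (?m * x) * ?s ^ weight j"
    using main[OF x] s by (intro mult_right_mono) auto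
  also have "\<dots> = (a * ?s ^ weight j) * (24 * d * ?s ^ weight i * exp (?m * x))" by simp
  also have "\<dots> \<le> 8 * (24 * d * ?s ^ weight i * exp (?m * x))"
    using a8' s d0 by (intro mult_right_mono) auto
  finally show "cmod (?y i x - phi0 z i j (of_real x)) * ?s ^ weight j \<le> 192 * d * ?s ^ weight i * exp (?m * x)" by simp
qed

text \<open>For zero potentials the deviation bound of \<open>phi_estimate\<close> is
  \<open>0\<close>, which identifies the solution without a separate uniqueness argument.\<close>

lemma phi_free:
  assumes "x \<in> {0..2}"
  shows "phi (\<lambda>_. 0) (\<lambda>_. 0) (z ^ 3) j i x = phi0 z i j (of_real x)"
  using phi_estimate(2)[OF pot_0[OF order_refl] _ assms, of z j i] zero_less_power[OF scale_ge(3)[of z], of "weight j"]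
  by (auto simp: mult_le_0_iff)

section \<open>Monodromy, discriminant and the three-point problem\<close>

no_notation fps_nth (infixl \<open>$\<close> 75)

lemma det_idx3:
  fixes A :: "'a::comm_ring_1 ^ idx3 ^ idx3"
  shows "det A = A $ I1 $ I1 * A $ I2 $ I2 * A $ I3 $ I3 + A $ I1 $ I2 * A $ I2 $ I3 * A $ I3 $ I1
     + A $ I1 $ I3 * A $ I2 $ I1 * A $ I3 $ I2 - A $ I1 $ I1 * A $ I2 $ I3 * A $ I3 $ I2
     - A $ I1 $ I2 * A $ I2 $ I1 * A $ I3 $ I3 - A $ I1 $ I3 * A $ I2 $ I2 * A $ I3 $ I1"
proof -
  have f: "finite {I2, I3}" "I1 \<notin> {I2, I3}" "finite {I3}" "I2 \<notin> {I3}" by simp_all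
  show ?thesis
    unfolding det_def UNIV_idx3 sum_over_permutations_insert[OF f(1,2)] sum_over_permutations_insert[OF f(3,4)] permutes_sing
    by (simp add: sign_swap_id permutation_swap_id sign_compose sign_id swap_id_eq)
qed

definition mtrace :: "(real \<Rightarrow> real) \<Rightarrow> (real \<Rightarrow> real) \<Rightarrow> complex \<Rightarrow> complex" where
  "mtrace p q lam = (\<Sum>i\<in>UNIV. phi p q lam i i 1)"

text \<open>The discriminant of the monic cubic whose roots have elementary symmetric functions
  \<open>T\<close>, \<open>E\<close> and \<open>1\<close>.\<close>

definition cubic_disc :: "'a::comm_ring_1 \<Rightarrow> 'a \<Rightarrow> 'a" where
  "cubic_disc T E = T\<^sup>2 * E\<^sup>2 - 4 * T ^ 3 - 4 * E ^ 3 + 18 * T * E - 27"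

lemma cubic_disc_commute: "cubic_disc T E = cubic_disc E T"
  by (simp add: cubic_disc_def algebra_simps)

lemma cubic_disc_roots:
  "t1 * t2 * t3 = 1 \<Longrightarrow> cubic_disc (t1 + t2 + t3) (t1 * t2 + t1 * t3 + t2 * t3) =
     (t1 - t2)\<^sup>2 * (t1 - t3)\<^sup>2 * (t2 - t3)\<^sup>2"
  for t1 :: "'a::idom"
  unfolding cubic_disc_def by algebra

lemma cubic_factorization:
  fixes T E :: complex
  obtains t1 t2 t3 where "\<And>z. z ^ 3 - T * z\<^sup>2 + E * z - 1 = (z - t1) * (z - t2) * (z - t3)"
proof -
  define a :: "nat \<Rightarrow> complex" where "a = (\<lambda>i. [-1, E, -T, 1] ! i)"
  obtain t1 where "(\<Sum>i\<le>3. a i * t1 ^ i) = 0"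
    by (rule fundamental_theorem_of_algebra[of a 3]) (auto simp: a_def intro!: bexI[of _ 3])
  then have t1: "t1 ^ 3 - T * t1\<^sup>2 + E * t1 - 1 = 0"
    by (simp add: a_def numeral_3_eq_3 power2_eq_square algebra_simps)
  define b where "b = t1 - T"
  define c where "c = E + t1 * b"
  define s where "s = csqrt (b\<^sup>2 - 4 * c)"
  have s: "s\<^sup>2 = b\<^sup>2 - 4 * c" by (simp add: s_def)
  have "z ^ 3 - T * z\<^sup>2 + E * z - 1 = (z - t1) * (z - (- b + s) / 2) * (z - (- b - s) / 2)" for z
  proof -
    have "(z - (- b + s) / 2) * (z - (- b - s) / 2) = z\<^sup>2 + b * z + (b\<^sup>2 - s\<^sup>2) / 4"
      by (simp add: field_simps power2_eq_square)
    also have "\<dots> = z\<^sup>2 + b * z + c" by (simp add: s)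
    finally have "(z - t1) * (z - (- b + s) / 2) * (z - (- b - s) / 2) = (z - t1) * (z\<^sup>2 + b * z + c)"
      by (simp only: mult.assoc)
    then show ?thesis
      using t1 unfolding c_def b_def by algebra
  qed
  then show ?thesis using that by blast
qed

text \<open>\<open>monodromy\<close> prescribes the true second derivative, so its first solution
  starts with quasi-derivative \<open>p 0\<close>. As \<open>p 1 = p 0\<close>, the correction is a
  change of basis and leaves the characteristic polynomial alone.\<close>

lemma monodromy_entry:
  fixes lam :: complex
  assumes p: "smallpot p q"
  defines "Y \<equiv> \<lambda>j i. phi p q lam j i 1 + (if j = I1 then of_real (p 0) * phi p q lam I3 i 1 else 0)"
  shows "monodromy p q lam $ j $ k = sel3 (Y j I1) (Y j I2) (Y j I3 - of_real (p 0) * Y j I1) k"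
proof -
  have p1: "p 1 = p 0" using potD(2)[OF p, of 0] by simp
  let ?P = "\<lambda>v. \<exists>y0 y1 y2. ode_sol p q lam (\<lambda>_. 0) y0 y1 y2 \<and>
       (\<forall>i. dvec p y0 y1 y2 0 i = (if i = j then 1 else 0)) \<and> v = dvec p y0 y1 y2 1 k"
  have 1: "?P (sel3 (Y j I1) (Y j I2) (Y j I3 - of_real (p 0) * Y j I1) k)"
  proof -
    define y where "y = (\<lambda>i t. 1 * phi p q lam j i t + (if j = I1 then of_real (p 0) else 0) * phi p q lam I3 i t)"
    have "osolv 2 p q lam (\<lambda>_. 0) y"
      unfolding y_def using osolv_lincomb[OF phi(1)[OF p, of lam j] phi(1)[OF p, of lam I3], where c = 1 and e = "if j = I1 then of_real (p 0) else 0"] by simp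
    moreover have "dvec p (y I1) (y I2) (y I3) 0 i = (if i = j then 1 else 0)" for i
      by (cases i; cases j) (simp_all add: dvec_def y_def phi(2)[OF p])
    moreover have "sel3 (Y j I1) (Y j I2) (Y j I3 - of_real (p 0) * Y j I1) k = dvec p (y I1) (y I2) (y I3) 1 k"
      by (cases k) (simp_all add: dvec_def y_def Y_def p1)
    ultimately show ?thesis
      unfolding ode_sol_eq_osol osolv_def by blast
  qed
  have 2: "v = sel3 (Y j I1) (Y j I2) (Y j I3 - of_real (p 0) * Y j I1) k" if v: "?P v" for v
  proof -
    obtain y0 y1 y2 where y: "osolv 2 p q lam (\<lambda>_. 0) (sel3 y0 y1 y2)"
      "\<And>i. dvec p y0 y1 y2 0 i = (if i = j then 1 else 0)" "v = dvec p y0 y1 y2 1 k"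
      using v unfolding ode_sol_eq_osol osolv_def sel3_simps by blast
    have init: "y0 0 = of_bool (j = I1)" "y1 0 = of_bool (j = I2)"
       "y2 0 = of_bool (j = I3) + of_real (p 0) * of_bool (j = I1)"
      using y(2)[of I1] y(2)[of I2] y(2)[of I3] by (auto simp: dvec_def algebra_simps split: if_splits)
    have "sel3 y0 y1 y2 i 1 = Y j i" for i
      using osolv_eq[OF p order_refl y(1), of 1 i] init
      by (cases j) (simp_all add: sum_idx3 Y_def)
    from this[of I1] this[of I2] this[of I3] show ?thesis
      unfolding y(3) by (cases k) (simp_all add: dvec_def p1)
  qed
  show ?thesis
    unfolding monodromy_def using the_equality[of ?P, OF 1 2] by simp
qed

text \<open>The coefficient of \<open>z\<close> is the sum of the principal 2x2 minors, which by
  \<open>phi_minors\<close> is the trace of the adjoint problem; the determinant is \<open>1\<close>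
  by \<open>phi_det\<close>.\<close>

lemma monodromy_charpoly:
  assumes p: "smallpot p q"
  shows "det (mat z - monodromy p q lam) = z ^ 3 - mtrace p q lam * z\<^sup>2 + mtrace p (\<lambda>x. - q x) (- lam) * z - 1"
proof -
  have one: "(1::real) \<in> {0..2}" by simp
  have T: "mtrace p (\<lambda>x. - q x) (- lam) =
    (phi p q lam I1 I1 1 * phi p q lam I2 I2 1 - phi p q lam I1 I2 1 * phi p q lam I2 I1 1)
    + (phi p q lam I1 I1 1 * phi p q lam I3 I3 1 - phi p q lam I1 I3 1 * phi p q lam I3 I1 1)
    + (phi p q lam I2 I2 1 * phi p q lam I3 I3 1 - phi p q lam I2 I3 1 * phi p q lam I3 I2 1)"
    unfolding mtrace_def sum_idx3 phi_minors[OF p one] by simp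
  show ?thesis
    unfolding det_idx3 T phi_det[OF p one, of lam, symmetric]
    unfolding mtrace_def sum_idx3
    by (simp add: mat_def monodromy_entry[OF p] power2_eq_square power3_eq_cube) algebra
qed

lemma rho_eq_disc3:
  assumes p: "smallpot p q"
  shows "rho p q lam = cubic_disc (mtrace p q lam) (mtrace p (\<lambda>x. - q x) (- lam))"
proof -
  let ?T = "mtrace p q lam" and ?E = "mtrace p (\<lambda>x. - q x) (- lam)"
  let ?P = "\<lambda>r. \<exists>t1 t2 t3. (\<forall>z. det (mat z - monodromy p q lam) = (z - t1) * (z - t2) * (z - t3)) \<and>
      r = (t1 - t2)\<^sup>2 * (t1 - t3)\<^sup>2 * (t2 - t3)\<^sup>2"
  obtain t1 t2 t3 where "\<And>z. z ^ 3 - ?T * z\<^sup>2 + ?E * z - 1 = (z - t1) * (z - t2) * (z - t3)"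
    using cubic_factorization by blast
  then have "\<exists>r. ?P r"
    unfolding monodromy_charpoly[OF p] by blast
  then have "?P (SOME r. ?P r)"
    by (rule someI_ex)
  then obtain t1 t2 t3 where
    t: "\<And>z. z ^ 3 - ?T * z\<^sup>2 + ?E * z - 1 = (z - t1) * (z - t2) * (z - t3)" and
    r: "rho p q lam = (t1 - t2)\<^sup>2 * (t1 - t3)\<^sup>2 * (t2 - t3)\<^sup>2"
    unfolding monodromy_charpoly[OF p] rho_def by blast
  \<comment> \<open>Evaluating the polynomial identity at \<open>0\<close>, \<open>1\<close> and
    \<open>-1\<close> recovers the three elementary symmetric functions, so the value does not
    depend on the roots picked by \<open>SOME\<close>.\<close>
  have e0: "t1 * t2 * t3 = 1" using t[of 0] by simp
  have s: "?E - ?T = t1 * t2 + t1 * t3 + t2 * t3 - (t1 + t2 + t3)"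
    using t[of 1] e0 by (simp add: algebra_simps)
  have "?T + ?E = (t1 + t2 + t3) + (t1 * t2 + t1 * t3 + t2 * t3)"
    using t[of "-1"] e0 by (simp add: algebra_simps)
  then have "2 * ?T = 2 * (t1 + t2 + t3)" "2 * ?E = 2 * (t1 * t2 + t1 * t3 + t2 * t3)"
    using s by algebra+
  then have "?T = t1 + t2 + t3" "?E = t1 * t2 + t1 * t3 + t2 * t3"
    unfolding mult_cancel_left by auto
  then show ?thesis using r cubic_disc_roots[OF e0] by simp
qed

text \<open>Passing to the adjoint exchanges the two traces, that is, it inverts the multipliers,
  and the discriminant is symmetric in them because the product of the roots is
  \<open>1\<close>.\<close>

lemma rho_adjoint:
  assumes "smallpot p q"
  shows "rho p (\<lambda>x. - q x) (- lam) = rho p q lam"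
  unfolding rho_eq_disc3[OF assms] rho_eq_disc3[OF pot_uminus[OF assms]] by (simp add: cubic_disc_commute)

lemma mtrace_cnj: "smallpot p q \<Longrightarrow> mtrace p q (cnj lam) = cnj (mtrace p q lam)"
  unfolding mtrace_def sum_idx3 by (simp add: phi_cnj)

lemma rho_cnj: "smallpot p q \<Longrightarrow> rho p q (cnj lam) = cnj (rho p q lam)"
  using mtrace_cnj[of p q lam] mtrace_cnj[of p "\<lambda>x. - q x" "- lam"]
  by (simp add: rho_eq_disc3 pot_uminus cubic_disc_def)

text \<open>Up to the sign change \<open>S = diag (1, -1, 1)\<close>, reflection runs solutions
  backwards over one period, so the reflected matrix \<open>R\<close> is conjugate to the inverse of
  \<open>N\<close>. That inverse, \<open>K\<close>, is made of minors, and its trace is that of the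
  adjoint problem.\<close>

lemma mtrace_reflect:
  assumes p: "smallpot p q"
  shows "mtrace (\<lambda>x. p (1 - x)) (\<lambda>x. - q (1 - x)) (- lam) = mtrace p (\<lambda>x. - q x) (- lam)"
proof -
  let ?pr = "\<lambda>x. p (1 - x)" and ?qr = "\<lambda>x. - q (1 - x)"
  have pr: "smallpot ?pr ?qr" using pot_uminus[OF pot_reflect[OF p]] .
  define N :: "complex^idx3^idx3" where "N = (\<chi> i k. phi p q lam k i 1)"
  define R :: "complex^idx3^idx3" where "R = (\<chi> i k. phi ?pr ?qr (- lam) k i 1)"
  define S :: "complex^idx3^idx3" where "S = (\<chi> i k. of_bool (i = k) * (if i = I2 then - 1 else 1))"
  let ?t = "\<lambda>k i. phi p (\<lambda>x. - q x) (- lam) k i 1"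
  define K :: "complex^idx3^idx3" where "K = (\<chi> i k. sel3
    (sel3 (?t I3 I3) (- ?t I3 I2) (?t I3 I1) k) (sel3 (- ?t I2 I3) (?t I2 I2) (- ?t I2 I1) k) (sel3 (?t I1 I3) (- ?t I1 I2) (?t I1 I1) k) i)"
  have one: "(1::real) \<in> {0..2}" by simp
  have NK: "N ** K = mat 1"
  proof -
    have "(N ** K) $ i $ k = mat 1 $ i $ k" for i k
      unfolding matrix_matrix_mult_def mat_def N_def K_def sum_idx3 phi_minors[OF p one]
      using phi_det[OF p one, of lam]
      by (cases i; cases k) (simp_all add: sum_idx3 algebra_simps)
    then show ?thesis by (simp add: vec_eq_iff)
  qed
  have SS: "S ** S = mat 1"
  proof -
    have "(S ** S) $ i $ k = mat 1 $ i $ k" for i k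
      unfolding matrix_matrix_mult_def mat_def S_def by (cases i; cases k) (simp_all add: sum_idx3)
    then show ?thesis by (simp add: vec_eq_iff)
  qed
  \<comment> \<open>The reflection of the solution with datum \<open>j\<close> starts from
    \<open>S\<close> times the value at \<open>2\<close> and reaches \<open>S\<close> times the
    value at \<open>1\<close> after one period.\<close>
  have "S ** N = R ** S ** N ** N"
  proof -
    have "(S ** N) $ i $ j = (R ** S ** N ** N) $ i $ j" for i j
    proof -
      note refl = osolv_eq[OF pr order_refl osolv_reflect[OF p phi(1)[OF p, of lam j], simplified] one, of i]
      have two: "phi p q lam j k 2 = (N ** N) $ k $ j" for k
        using phi_translate[OF p, of 1 lam j k] by (simp add: matrix_matrix_mult_def N_def)
      have SA: "(S ** A) $ k $ j = (if k = I2 then - A $ k $ j else A $ k $ j)" for A k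
        by (cases k) (simp_all add: matrix_matrix_mult_def S_def sum_idx3)
      have "(S ** N) $ i $ j = (if i = I2 then - phi p q lam j i 1 else phi p q lam j i 1)"
        unfolding SA by (simp add: N_def)
      also have "\<dots> = (\<Sum>k\<in>UNIV. R $ i $ k * (if k = I2 then - phi p q lam j k 2 else phi p q lam j k 2))"
        using refl by (cases i) (simp_all add: R_def sum_idx3)
      also have "\<dots> = (R ** (S ** (N ** N))) $ i $ j"
        unfolding two by (simp add: matrix_matrix_mult_def[of R] SA sum_idx3)
      finally show ?thesis by (simp add: matrix_mul_assoc)
    qed
    then show ?thesis by (simp add: vec_eq_iff)
  qed
  then have "S ** N ** K = R ** S ** N ** N ** K" by simp
  then have "S = R ** S ** N"
    by (simp add: NK flip: matrix_mul_assoc)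
  then have "S ** K = R ** S ** N ** K" by metis
  then have "S ** K ** S = R ** S ** S"
    by (simp add: NK flip: matrix_mul_assoc)
  then have R: "R = S ** K ** S"
    by (simp add: SS flip: matrix_mul_assoc)
  have "R $ i $ i = K $ i $ i" for i
    unfolding R by (cases i) (simp_all add: matrix_matrix_mult_def S_def sum_idx3)
  then have "(\<Sum>i\<in>UNIV. R $ i $ i) = (\<Sum>i\<in>UNIV. K $ i $ i)" by simp
  then show ?thesis
    by (simp add: mtrace_def R_def K_def sum_idx3)
qed

lemma rho_reflect:
  assumes p: "smallpot p q"
  shows "rho (\<lambda>x. p (1 - x)) (\<lambda>x. - q (1 - x)) (- lam) = rho p q lam"
    "rho (\<lambda>x. p (1 - x)) (\<lambda>x. q (1 - x)) lam = rho p q lam"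
proof -
  have 1: "mtrace (\<lambda>x. p (1 - x)) (\<lambda>x. - q (1 - x)) (- lam) = mtrace p (\<lambda>x. - q x) (- lam)"
    by (rule mtrace_reflect[OF p])
  have 2: "mtrace (\<lambda>x. p (1 - x)) (\<lambda>x. q (1 - x)) lam = mtrace p q lam"
    using mtrace_reflect[OF pot_uminus[OF p], of "- lam"] by simp
  show "rho (\<lambda>x. p (1 - x)) (\<lambda>x. - q (1 - x)) (- lam) = rho p q lam"
    "rho (\<lambda>x. p (1 - x)) (\<lambda>x. q (1 - x)) lam = rho p q lam"
    using 1 2 by (simp_all add: rho_eq_disc3[OF p] rho_eq_disc3[OF pot_reflect[OF p]]
        rho_eq_disc3[OF pot_uminus[OF pot_reflect[OF p]]] cubic_disc_commute)
qed

section \<open>The three-point problem as a determinant condition\<close>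

definition dir_det :: "(real \<Rightarrow> real) \<Rightarrow> (real \<Rightarrow> real) \<Rightarrow> complex \<Rightarrow> complex" where
  "dir_det p q lam = phi p q lam I2 I1 1 * phi p (\<lambda>x. - q x) (- lam) I3 I1 1
     + phi p q lam I3 I1 1 * phi p (\<lambda>x. - q x) (- lam) I3 I2 1"

text \<open>The right-hand side is the determinant of the values at \<open>1\<close> and
  \<open>2\<close> of the second and third fundamental solution, after \<open>phi_translate\<close>
  is inserted; the contribution of the first solution cancels. Grouping it into minors is what
  yields the product form of \<open>dir_det\<close>.\<close>

lemma dir_det_eq:
  assumes "smallpot p q"
  shows "dir_det p q lam = 
    phi p q lam I2 I1 1 * (phi p q lam I2 I1 1 * phi p q lam I3 I2 1 - phi p q lam I2 I2 1 * phi p q lam I3 I1 1)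
    + phi p q lam I3 I1 1 * (phi p q lam I2 I1 1 * phi p q lam I3 I3 1 - phi p q lam I2 I3 1 * phi p q lam I3 I1 1)"
  unfolding dir_det_def by (simp add: phi_minors[OF assms])

lemma dir_sol_osolv:
  "dir_sol p q lam g y \<longleftrightarrow> (\<exists>Y. osolv 2 p q lam g Y \<and> Y I1 = y) \<and> y 0 = 0 \<and> y 1 = 0 \<and> y 2 = 0"
proof -
  have "(\<exists>y1 y2. ode_sol p q lam g y y1 y2) \<longleftrightarrow> (\<exists>Y. osolv 2 p q lam g Y \<and> Y I1 = y)"
    unfolding ode_sol_eq_osol osolv_def
    by (metis sel3_simps)
  then show ?thesis unfolding dir_sol_def by blast
qed

lemma osolv_at_2:
  assumes "smallpot p q" "osolv 2 p q lam (\<lambda>_. 0) y"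
  shows "y i 2 = (\<Sum>k\<in>UNIV. phi p q lam k i 1 * y k 1)"
  using osolv_eq[OF assms(1) _ osolv_translate[OF assms], of 1 i] by simp

lemma dir_eigenfunE:
  assumes p: "smallpot p q" and f: "dir_eigenfun p q lam f"
  obtains Y a b where "osolv 2 p q lam (\<lambda>_. 0) Y" "Y I1 = f" "a = Y I2 0" "b = Y I3 0" "a \<noteq> 0 \<or> b \<noteq> 0"
    "\<And>x. x \<in> {0..2} \<Longrightarrow> f x = a * phi p q lam I2 I1 x + b * phi p q lam I3 I1 x"
    "phi p q lam I2 I1 1 * a + phi p q lam I3 I1 1 * b = 0"
    "phi p q lam I2 I1 1 * (phi p q lam I2 I2 1 * a + phi p q lam I3 I2 1 * b)
      + phi p q lam I3 I1 1 * (phi p q lam I2 I3 1 * a + phi p q lam I3 I3 1 * b) = 0"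
proof -
  obtain Y where Y: "osolv 2 p q lam (\<lambda>_. 0) Y" "Y I1 = f" and f0: "f 0 = 0" "f 1 = 0" "f 2 = 0"
    and nz: "\<exists>x\<in>{0..2}. f x \<noteq> 0"
    using f unfolding dir_eigenfun_def dir_sol_osolv by auto
  have rep: "Y i x = phi p q lam I2 i x * Y I2 0 + phi p q lam I3 i x * Y I3 0" if "x \<in> {0..2}" for i x
    using osolv_eq[OF p order_refl Y(1) that, of i] f0 Y(2) by (simp add: sum_idx3)
  have "Y I2 0 \<noteq> 0 \<or> Y I3 0 \<noteq> 0"
    using nz rep[of _ I1] Y(2) by auto
  moreover have "f x = Y I2 0 * phi p q lam I2 I1 x + Y I3 0 * phi p q lam I3 I1 x" if "x \<in> {0..2}" for x
    using rep[OF that, of I1] Y(2) by (simp add: mult.commute)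
  moreover have "phi p q lam I2 I1 1 * Y I2 0 + phi p q lam I3 I1 1 * Y I3 0 = 0"
    using rep[of 1 I1] f0 Y(2) by simp
  moreover have "phi p q lam I2 I1 1 * (phi p q lam I2 I2 1 * Y I2 0 + phi p q lam I3 I2 1 * Y I3 0)
      + phi p q lam I3 I1 1 * (phi p q lam I2 I3 1 * Y I2 0 + phi p q lam I3 I3 1 * Y I3 0) = 0"
    using osolv_at_2[OF p Y(1), of I1] rep[of 1 I2] rep[of 1 I3] f0 Y(2) by (simp add: sum_idx3)
  ultimately show ?thesis using that[of Y "Y I2 0" "Y I3 0"] Y by blast
qed

lemma dir_eigenfunI:
  assumes p: "smallpot p q" and ab: "a \<noteq> 0 \<or> b \<noteq> 0"
    and 1: "phi p q lam I2 I1 1 * a + phi p q lam I3 I1 1 * b = 0"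
    and 2: "phi p q lam I2 I1 1 * (phi p q lam I2 I2 1 * a + phi p q lam I3 I2 1 * b)
      + phi p q lam I3 I1 1 * (phi p q lam I2 I3 1 * a + phi p q lam I3 I3 1 * b) = 0"
  shows "dir_eigenfun p q lam (\<lambda>x. a * phi p q lam I2 I1 x + b * phi p q lam I3 I1 x)"
proof -
  define Y where "Y = (\<lambda>i x. a * phi p q lam I2 i x + b * phi p q lam I3 i x)"
  have Y: "osolv 2 p q lam (\<lambda>_. 0) Y"
    unfolding Y_def using osolv_lincomb[OF phi(1)[OF p, of lam I2] phi(1)[OF p, of lam I3], where c = a and e = b] by simp
  have init: "Y I1 0 = 0" "Y I2 0 = a" "Y I3 0 = b"
    by (simp_all add: Y_def phi(2)[OF p])
  have Y1: "Y I1 1 = 0" using 1 by (simp add: Y_def mult.commute)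
  have Y2: "Y I1 2 = 0"
    using 2 osolv_at_2[OF p Y, of I1] Y1 by (simp add: sum_idx3 Y_def mult.commute)
  \<comment> \<open>A solution vanishing on the whole interval has vanishing first and second
    derivatives at \<open>0\<close>, which are \<open>a\<close> and \<open>b\<close> here.\<close>
  have "\<exists>x\<in>{0..2}. Y I1 x \<noteq> 0"
  proof (rule ccontr)
    assume "\<not> ?thesis"
    then have z: "Y I1 x = 0" if "x \<in> {0..2}" for x using that by blast
    note abs_cont = osol_abs_cont[OF p order_refl continuous_on_const Y[unfolded osolv_def]]
    have z2: "Y I2 x = 0" if "x \<in> {0..2}" for x
      by (rule abs_cont_derivative_zero_unique[OF abs_cont(1) abs_cont(5)]) (use z that in auto)
    have "Y I3 0 - of_real (p 0) * Y I1 0 = 0"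
      by (rule abs_cont_derivative_zero_unique[OF abs_cont(2)])
        (use z2 in \<open>auto intro!: continuous_intros abs_cont potD(1)[OF p]\<close>)
    then show False using ab init z2[of 0] by auto
  qed
  then show ?thesis
    using Y Y1 Y2 init unfolding dir_eigenfun_def dir_sol_osolv Y_def by blast
qed

lemma dir_eigenvalue_iff:
  assumes p: "smallpot p q"
  shows "dir_eigenvalue p q lam \<longleftrightarrow> dir_det p q lam = 0"
proof
  assume "dir_eigenvalue p q lam"
  then obtain f where f: "dir_eigenfun p q lam f" unfolding dir_eigenvalue_def by blast
  obtain Y a b where Y: "a \<noteq> 0 \<or> b \<noteq> 0"
    "phi p q lam I2 I1 1 * a + phi p q lam I3 I1 1 * b = 0"
    "phi p q lam I2 I1 1 * (phi p q lam I2 I2 1 * a + phi p q lam I3 I2 1 * b)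
      + phi p q lam I3 I1 1 * (phi p q lam I2 I3 1 * a + phi p q lam I3 I3 1 * b) = 0"
    using dir_eigenfunE[OF p f] by metis
  then have "dir_det p q lam * a = 0" "dir_det p q lam * b = 0"
    unfolding dir_det_eq[OF p] by algebra+
  then show "dir_det p q lam = 0" using Y(1) by auto
next
  assume D: "dir_det p q lam = 0"
  have "\<exists>a b. (a \<noteq> 0 \<or> b \<noteq> 0) \<and> phi p q lam I2 I1 1 * a + phi p q lam I3 I1 1 * b = 0 \<and>
    phi p q lam I2 I1 1 * (phi p q lam I2 I2 1 * a + phi p q lam I3 I2 1 * b)
      + phi p q lam I3 I1 1 * (phi p q lam I2 I3 1 * a + phi p q lam I3 I3 1 * b) = 0"
  \<comment> \<open>If both entries vanish, every pair \<open>(a, b)\<close> satisfies the two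
    conditions. Otherwise the first condition fixes the pair up to a factor, and the second one
    becomes \<open>dir_det = 0\<close>.\<close>
  proof (cases "phi p q lam I2 I1 1 = 0 \<and> phi p q lam I3 I1 1 = 0")
    case True
    then show ?thesis by (intro exI[of _ 1] exI[of _ 0]) auto
  next
    case False
    then show ?thesis
      using D unfolding dir_det_eq[OF p]
      by (intro exI[of _ "phi p q lam I3 I1 1"] exI[of _ "- phi p q lam I2 I1 1"]) (auto simp: algebra_simps)
  qed
  then show "dir_eigenvalue p q lam"
    using dir_eigenfunI[OF p] unfolding dir_eigenvalue_def by blast
qed

section \<open>Reflection symmetry of the three-point spectrum\<close>

lemma dir_sol_reflect:
  assumes p: "smallpot p q" and "dir_sol p q lam g y"
  shows "dir_sol (\<lambda>x. p (1 - x)) (\<lambda>x. - q (1 - x)) (- lam) (\<lambda>t. - g (2 - t)) (\<lambda>t. y (2 - t))"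
proof -
  obtain Y where Y: "osolv 2 p q lam g Y" "Y I1 = y" "y 0 = 0" "y 1 = 0" "y 2 = 0"
    using assms(2) unfolding dir_sol_osolv by auto
  then show ?thesis
    unfolding dir_sol_osolv using osolv_reflect[OF p Y(1)] by fastforce
qed

lemma dir_eigenfun_reflect:
  assumes p: "smallpot p q" and f: "dir_eigenfun p q lam y"
  shows "dir_eigenfun (\<lambda>x. p (1 - x)) (\<lambda>x. - q (1 - x)) (- lam) (\<lambda>t. y (2 - t))"
proof -
  obtain x where "x \<in> {0..2}" "y x \<noteq> 0" using f unfolding dir_eigenfun_def by blast
  then have "\<exists>x\<in>{0..2}. y (2 - x) \<noteq> 0"
    by (intro bexI[of _ "2 - x"]) auto
  then show ?thesis
    using dir_sol_reflect[OF p, of lam "\<lambda>_. 0" y] f unfolding dir_eigenfun_def by simp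
qed

lemma pot_reflect_adjoint: "pot d p q \<Longrightarrow> pot d (\<lambda>x. p (1 - x)) (\<lambda>x. - q (1 - x))"
  by (rule pot_uminus[OF pot_reflect])

lemma dir_eigenvalue_reflect:
  assumes p: "smallpot p q"
  shows "dir_eigenvalue (\<lambda>x. p (1 - x)) (\<lambda>x. - q (1 - x)) (- lam) \<longleftrightarrow> dir_eigenvalue p q lam"
  using dir_eigenfun_reflect[OF p, of lam]
    dir_eigenfun_reflect[OF pot_reflect_adjoint[OF p], of "- lam"] unfolding dir_eigenvalue_def by auto

lemma dir_simple_reflect:
  assumes p: "smallpot p q" and s: "dir_simple p q lam"
  shows "dir_simple (\<lambda>x. p (1 - x)) (\<lambda>x. - q (1 - x)) (- lam)"
proof -
  let ?pr = "\<lambda>x. p (1 - x)" and ?qr = "\<lambda>x. - q (1 - x)"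
  note bk = dir_eigenfun_reflect[OF pot_reflect_adjoint[OF p], of "- lam", simplified]
  show ?thesis
    unfolding dir_simple_def
  proof (intro conjI allI impI)
    show "dir_eigenvalue ?pr ?qr (- lam)"
      using s dir_eigenvalue_reflect[OF p] unfolding dir_simple_def by blast
  next
    fix f g assume "dir_eigenfun ?pr ?qr (- lam) f \<and> dir_eigenfun ?pr ?qr (- lam) g"
    then have "dir_eigenfun p q lam (\<lambda>t. f (2 - t))" "dir_eigenfun p q lam (\<lambda>t. g (2 - t))"
      using bk by auto
    then obtain c where c: "\<And>x. x \<in> {0..2} \<Longrightarrow> g (2 - x) = c * f (2 - x)"
      using s unfolding dir_simple_def by blast
    have "g x = c * f x" if "x \<in> {0..2}" for x
      using c[of "2 - x"] that by simp
    then show "\<exists>c. \<forall>x\<in>{0..2}. g x = c * f x" by blast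
  next
    fix f assume "dir_eigenfun ?pr ?qr (- lam) f"
    then have f: "dir_eigenfun p q lam (\<lambda>t. f (2 - t))" using bk by auto
    show "\<not> (\<exists>y. dir_sol ?pr ?qr (- lam) f y)"
    proof
      assume "\<exists>y. dir_sol ?pr ?qr (- lam) f y"
      then obtain y where "dir_sol ?pr ?qr (- lam) f y" by blast
      from dir_sol_reflect[OF pot_reflect_adjoint[OF p] this]
      have *: "dir_sol p q lam (\<lambda>t. - f (2 - t)) (\<lambda>t. y (2 - t))" by simp
      then have "dir_sol p q lam (\<lambda>t. f (2 - t)) (\<lambda>t. - y (2 - t))"
      proof -
        obtain Y where Y: "osolv 2 p q lam (\<lambda>t. - f (2 - t)) Y" "Y I1 = (\<lambda>t. y (2 - t))" "y 0 = 0" "y 1 = 0" "y 2 = 0"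
          using * unfolding dir_sol_osolv by auto
        have "osolv 2 p q lam (\<lambda>t. f (2 - t)) (\<lambda>i t. - Y i t)"
          using osolv_lincomb[OF Y(1) Y(1), where c = "-1" and e = 0] by simp
        then show ?thesis unfolding dir_sol_osolv using Y by fastforce
      qed
      then show False using s f unfolding dir_simple_def by blast
    qed
  qed
qed

section \<open>Dependence on the spectral parameter\<close>

lemma cbrt_cube: "cbrt lam ^ 3 = lam"
proof (cases "lam = 0")
  case False
  then have "cbrt lam ^ 3 = exp (of_nat 3 * (Ln lam / 3))"
    unfolding exp_of_nat_mult by (simp add: cbrt_def)
  also have "\<dots> = lam" using False by simp
  finally show ?thesis .
qed (simp add: cbrt_def)

lemma growth_le_norm: "growth z \<le> cmod z"
  using complex_Re_le_cmod[of z] complex_Re_le_cmod[of "omega * z"] complex_Re_le_cmod[of "omega\<^sup>2 * z"]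
  unfolding growth_def norm_mult norm_omega by simp

definition phi_bd :: "real \<Rightarrow> real" where "phi_bd r = 8 * (1 + r) ^ 2 * exp (2 * (1 + r))"

lemma phi_bd_nonneg: "0 \<le> r \<Longrightarrow> 0 \<le> phi_bd r"
  by (simp add: phi_bd_def)

lemma phi_bound:
  assumes p: "smallpot p q" and x: "x \<in> {0..2}" and r: "cmod lam \<le> r"
  shows "cmod (phi p q lam j i x) \<le> phi_bd r"
proof -
  define z where "z = cbrt lam"
  have z: "z ^ 3 = lam" by (simp add: z_def cbrt_cube)
  have zl: "cmod z \<le> 1 + cmod lam"
  proof (cases "cmod z \<le> 1")
    case False
    then have "cmod z ^ 1 \<le> cmod z ^ 3" by (intro power_increasing) auto
    then show ?thesis using z by (simp flip: norm_power)
  qed (use norm_ge_zero[of lam] in linarith)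
  have s: "1 \<le> scale z" "scale z \<le> 1 + r" using zl r order_trans[OF norm_ge_zero r] by (auto simp: scale_def)
  have "cmod (phi p q lam j i x) * 1 \<le> cmod (phi p q lam j i x) * scale z ^ weight j"
    using s by (intro mult_left_mono one_le_power) auto
  also have "\<dots> \<le> 8 * scale z ^ weight i * exp (growth z * x)"
    using phi_estimate(1)[OF p order_refl x, of z j i] z by simp
  also have "\<dots> \<le> 8 * scale z ^ 2 * exp (2 * (1 + r))"
  proof (intro mult_mono)
    show "scale z ^ weight i \<le> scale z ^ 2"
      using s by (intro power_increasing) (cases i; simp add: weight_def)+
    have "growth z * x \<le> (1 + r) * 2"
      using growth_le_norm[of z] growth_nonneg[of z] zl r x order_trans[OF norm_ge_zero r] by (intro mult_mono) auto
    then show "exp (growth z * x) \<le> exp (2 * (1 + r))" by simp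
  qed (use s in auto)
  also have "\<dots> \<le> phi_bd r"
    unfolding phi_bd_def using s by (intro mult_right_mono mult_left_mono power_mono) auto
  finally show ?thesis by simp
qed

lemma cofac_bound:
  assumes p: "smallpot p q" and x: "x \<in> {0..2}" and r: "cmod lam \<le> r"
  shows "cmod (cofac p q lam j x) \<le> 2 * phi_bd r ^ 2"
proof -
  have b: "cmod (phi p q lam a b x * phi p q lam c e x) \<le> phi_bd r ^ 2" for a b c e
    unfolding norm_mult power2_eq_square using phi_bound[OF p x r]
    by (intro mult_mono) (auto intro: order_trans[OF norm_ge_zero])
  have d: "cmod (u - v) \<le> 2 * phi_bd r ^ 2" if "cmod u \<le> phi_bd r ^ 2" "cmod v \<le> phi_bd r ^ 2" for u v :: complex
    using norm_triangle_ineq4[of u v] that by linarith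
  show ?thesis
    by (cases j) (auto simp: cofac_def norm_minus_commute intro!: d b)
qed

lemma cofac_continuous_on: "smallpot p q \<Longrightarrow> continuous_on {0..2} (cofac p q lam j)"
  unfolding cofac_def[abs_def] by (cases j) (auto intro!: continuous_intros phi_continuous_on)

lemma integral_unit_bound:
  fixes F :: "real \<Rightarrow> complex"
  assumes "continuous_on {0..1} F" "x \<in> {0..1}" "\<And>t. t \<in> {0..1} \<Longrightarrow> cmod (F t) \<le> B"
  shows "cmod (integral {0..x} F) \<le> B"
proof -
  have "cmod (integral {0..x} F) \<le> B * (x - 0)"
    by (rule integral_bound) (use assms in \<open>auto intro: continuous_on_subset\<close>)
  also have "\<dots> \<le> B * 1"
    using assms(2) order_trans[OF norm_ge_zero assms(3)[OF assms(2)]] by (intro mult_left_mono) auto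
  finally show ?thesis by simp
qed

text \<open>Besides giving analyticity of \<open>phi\<close>, the case \<open>D = 0\<close> is used
  to exclude associated vectors.\<close>

lemma has_field_derivative_quadratic_bound:
  fixes f :: "complex \<Rightarrow> complex"
  assumes "\<And>w. cmod (w - z) < 1 \<Longrightarrow> cmod (f w - f z - D * (w - z)) \<le> C * cmod (w - z) ^ 2"
  shows "(f has_field_derivative D) (at z)"
  unfolding has_field_derivative_iff
proof (rule Lim_transform2[where f = "\<lambda>_. D"])
  have "((\<lambda>w. (f w - f z) / (w - z) - D) \<longlongrightarrow> 0) (at z)"
  proof (rule Lim_null_comparison)
    show "\<forall>\<^sub>F w in at z. norm ((f w - f z) / (w - z) - D) \<le> C * cmod (w - z)"
      unfolding eventually_at
    proof (intro exI[of _ 1] conjI ballI impI)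
      fix w assume w: "w \<noteq> z \<and> dist w z < 1"
      then have "(f w - f z) / (w - z) - D = (f w - f z - D * (w - z)) / (w - z)"
        by (simp add: field_simps)
      also have "cmod \<dots> \<le> C * cmod (w - z) ^ 2 / cmod (w - z)"
        unfolding norm_divide using assms[of w] w by (intro divide_right_mono) (auto simp: dist_norm)
      also have "\<dots> = C * cmod (w - z)"
        using w by (simp add: power2_eq_square)
      finally show "norm ((f w - f z) / (w - z) - D) \<le> C * cmod (w - z)" .
    qed auto
    show "((\<lambda>w. C * cmod (w - z)) \<longlongrightarrow> 0) (at z)"
      by (auto intro!: tendsto_eq_intros)
  qed
  then show "((\<lambda>w. D - (f w - f z) / (w - z)) \<longlongrightarrow> 0) (at z)"
    using tendsto_minus by fastforce
qed auto

text \<open>Variation of constants based at \<open>lam0\<close> writes the difference as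
  \<open>lam - lam0\<close> times integrals of the solution at \<open>lam\<close>. A first use gives
  a Lipschitz bound, a second one replaces \<open>lam\<close> by \<open>lam0\<close> under the
  integral with a quadratic error.\<close>

lemma phi_holomorphic:
  assumes p: "smallpot p q"
  shows "(\<lambda>lam. phi p q lam j i 1) holomorphic_on S"
proof -
  have "\<exists>D. ((\<lambda>lam. phi p q lam j i 1) has_field_derivative D) (at lam0)" for lam0
  proof -
    define r where "r = cmod lam0 + 1"
    define B where "B = phi_bd r"
    have r0: "0 \<le> r" by (simp add: r_def)
    have B0: "0 \<le> B" unfolding B_def by (rule phi_bd_nonneg[OF r0])
    have pb: "cmod (phi p q lam j i x) \<le> B" if "cmod (lam - lam0) < 1" "x \<in> {0..1}" for lam j i x
    proof -
      have "cmod lam \<le> r"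
        using that(1) norm_triangle_ineq[of "lam - lam0" lam0] by (simp add: r_def)
      then show ?thesis unfolding B_def using phi_bound[OF p _ , of x lam r] that by auto
    qed
    have cb: "cmod (cofac p q lam0 k x) \<le> 2 * B ^ 2" if "x \<in> {0..1}" for k x
      unfolding B_def by (rule cofac_bound[OF p]) (use that in \<open>auto simp: r_def\<close>)
    have vc: "phi p q lam j i x - phi p q lam0 j i x = (lam - lam0) * (\<Sum>k\<in>UNIV. phi p q lam0 k i x *
        integral {0..x} (\<lambda>t. phi p q lam j I1 t * cofac p q lam0 k t))" if x: "x \<in> {0..1}" for lam i x
    proof -
      have "phi p q lam j i x = (\<Sum>k\<in>UNIV. phi p q lam0 k i x * (phi p q lam j k 0 +
        integral {0..x} (\<lambda>t. ((lam - lam0) * phi p q lam j I1 t + 0) * cofac p q lam0 k t)))"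
        using x by (intro variation_of_constants[OF p order_refl continuous_on_const phi(1)[OF p]]) auto
      also have "\<dots> = (\<Sum>k\<in>UNIV. phi p q lam0 k i x * phi p q lam j k 0 + (lam - lam0) *
         (phi p q lam0 k i x * integral {0..x} (\<lambda>t. phi p q lam j I1 t * cofac p q lam0 k t)))"
        by (simp add: mult.assoc distrib_left mult.left_commute)
      also have "\<dots> = phi p q lam0 j i x + (lam - lam0) * (\<Sum>k\<in>UNIV. phi p q lam0 k i x *
        integral {0..x} (\<lambda>t. phi p q lam j I1 t * cofac p q lam0 k t))"
        by (cases j) (simp_all add: sum_idx3 phi(2)[OF p] algebra_simps)
      finally show ?thesis by simp
    qed
    have c1: "continuous_on {0..1} (phi p q lam j i)" "continuous_on {0..1} (cofac p q lam k)" for lam j i k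
      using continuous_on_subset[OF phi_continuous_on[OF p]] continuous_on_subset[OF cofac_continuous_on[OF p]] by auto
    have norm3: "cmod (\<Sum>k\<in>UNIV. f k) \<le> 3 * M" if "\<And>k. cmod (f k) \<le> M" for f :: "idx3 \<Rightarrow> complex" and M
      using that[of I1] that[of I2] that[of I3] unfolding sum_idx3
      by (intro order_trans[OF norm_triangle_ineq] order_trans[OF add_mono[OF norm_triangle_ineq order_refl]]) linarith
    have m2: "cmod (a * b) \<le> K * L" if "cmod a \<le> K" "cmod b \<le> L" for a b :: complex and K L
      unfolding norm_mult using that by (intro mult_mono) (auto intro: order_trans[OF norm_ge_zero])
    have lip: "cmod (phi p q lam j i x - phi p q lam0 j i x) \<le> cmod (lam - lam0) * (3 * (B * (B * (2 * B ^ 2))))"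
      if "cmod (lam - lam0) < 1" "x \<in> {0..1}" for lam i x
      unfolding vc[OF that(2)] norm_mult
      by (intro mult_left_mono norm3)
        (auto simp: norm_mult B0 intro!: mult_mono integral_unit_bound[OF _ that(2)] continuous_intros c1 pb cb that)
    define D where "D = (\<Sum>k\<in>UNIV. phi p q lam0 k i 1 * integral {0..1} (\<lambda>t. phi p q lam0 j I1 t * cofac p q lam0 k t))"
    have "((\<lambda>lam. phi p q lam j i 1) has_field_derivative D) (at lam0)"
    proof (rule has_field_derivative_quadratic_bound)
      fix lam assume l: "cmod (lam - lam0) < 1"
      have one: "(1::real) \<in> {0..1}" by simp
      let ?L = "3 * (B * (B * (2 * B ^ 2)))"
      have int: "(\<lambda>t. phi p q lam j I1 t * cofac p q lam0 k t) integrable_on {0..1}" for lam k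
        by (intro integrable_continuous_real continuous_intros c1)
      have "phi p q lam j i 1 - phi p q lam0 j i 1 - D * (lam - lam0) =
        (lam - lam0) * (\<Sum>k\<in>UNIV. phi p q lam0 k i 1 *
        integral {0..1} (\<lambda>t. (phi p q lam j I1 t - phi p q lam0 j I1 t) * cofac p q lam0 k t))"
        unfolding vc[OF one] D_def left_diff_distrib integral_diff[OF int int] right_diff_distrib sum_subtractf
        by (simp add: mult.commute)
      also have "cmod \<dots> \<le> cmod (lam - lam0) * (3 * (B * (cmod (lam - lam0) * ?L * (2 * B ^ 2))))"
        unfolding norm_mult[of "lam - lam0"]
        by (intro mult_left_mono norm3 m2 integral_unit_bound[OF _ one] continuous_intros c1 pb cb l lip) auto
      also have "\<dots> = 3 * (B * (?L * (2 * B ^ 2))) * cmod (lam - lam0) ^ 2"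
        by (simp add: power2_eq_square)
      finally show "cmod (phi p q lam j i 1 - phi p q lam0 j i 1 - D * (lam - lam0)) \<le> 3 * (B * (?L * (2 * B ^ 2))) * cmod (lam - lam0) ^ 2" .
    qed
    then show ?thesis by blast
  qed
  then show ?thesis
    by (auto simp: holomorphic_on_def field_differentiable_def intro: has_field_derivative_at_within)
qed

lemma phi_holomorphic_minus:
  assumes "smallpot p q"
  shows "(\<lambda>lam. phi p q (- lam) j i 1) holomorphic_on S"
proof -
  have "(\<lambda>lam. phi p q lam j i 1) \<circ> uminus holomorphic_on S"
    by (rule holomorphic_on_compose[OF _ phi_holomorphic[OF assms]]) (auto intro!: holomorphic_intros)
  then show ?thesis by (simp add: o_def)
qed

lemma mtrace_holomorphic:
  assumes "smallpot p q"
  shows "mtrace p q holomorphic_on S" "(\<lambda>lam. mtrace p q (- lam)) holomorphic_on S"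
  unfolding mtrace_def[abs_def]
  by (intro holomorphic_on_sum phi_holomorphic phi_holomorphic_minus assms)+

lemma rho_holomorphic:
  assumes "smallpot p q"
  shows "rho p q holomorphic_on S"
proof -
  have "rho p q = (\<lambda>lam. cubic_disc (mtrace p q lam) (mtrace p (\<lambda>x. - q x) (- lam)))"
    using rho_eq_disc3[OF assms] by auto
  then show ?thesis
    unfolding cubic_disc_def using mtrace_holomorphic[OF assms] mtrace_holomorphic[OF pot_uminus[OF assms]]
    by (auto intro!: holomorphic_intros)
qed

lemma dir_det_holomorphic:
  assumes "smallpot p q"
  shows "dir_det p q holomorphic_on S"
  unfolding dir_det_def[abs_def]
  by (intro holomorphic_intros phi_holomorphic[OF assms] phi_holomorphic_minus[OF pot_uminus[OF assms]])

lemma dir_det_cnj: "smallpot p q \<Longrightarrow> dir_det p q (cnj lam) = cnj (dir_det p q lam)"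
  using phi_cnj[of p "\<lambda>x. - q x" 1 "- lam"] by (simp add: dir_det_def phi_cnj pot_uminus)

text \<open>Where both entries vanish, so do the minors multiplying them in \<open>dir_det\<close>, and the zero is double.\<close>
lemma dir_det_simple_zero_imp_entries:
  assumes p: "smallpot p q" and D: "deriv (dir_det p q) lam0 \<noteq> 0"
  shows "phi p q lam0 I2 I1 1 \<noteq> 0 \<or> phi p q lam0 I3 I1 1 \<noteq> 0"
proof (rule ccontr)
  assume "\<not> ?thesis"
  then have z: "phi p q lam0 I2 I1 1 = 0" "phi p q lam0 I3 I1 1 = 0" by auto
  have d: "((\<lambda>lam. phi p q lam j i 1) has_field_derivative deriv (\<lambda>lam. phi p q lam j i 1) lam0) (at lam0)" for j i
    using phi_holomorphic[OF p, of j i UNIV] by (simp add: holomorphic_derivI)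
  have "((\<lambda>lam. phi p q lam I2 I1 1 * (phi p q lam I2 I1 1 * phi p q lam I3 I2 1 - phi p q lam I2 I2 1 * phi p q lam I3 I1 1)
    + phi p q lam I3 I1 1 * (phi p q lam I2 I1 1 * phi p q lam I3 I3 1 - phi p q lam I2 I3 1 * phi p q lam I3 I1 1))
    has_field_derivative 0) (at lam0)"
    by (rule derivative_eq_intros d refl)+ (simp add: z)
  then have "(dir_det p q has_field_derivative 0) (at lam0)"
    unfolding dir_det_eq[OF p, abs_def] .
  then show False using D DERIV_imp_deriv by blast
qed

text \<open>The eigenspace is a line because the entries in the condition at \<open>1\<close> do not
  both vanish. If moreover \<open>(H - lam0) Y = f\<close> were solvable,
  \<open>f + (lam - lam0) * Y\<close> would solve the problem at \<open>lam\<close> up to an error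
  of second order, so the determinant times its initial data would vanish to second order,
  contradicting a simple zero.\<close>

lemma dir_det_simple_zero_imp_dir_simple:
  assumes p: "smallpot p q" and D0: "dir_det p q lam0 = 0" and D: "deriv (dir_det p q) lam0 \<noteq> 0"
  shows "dir_simple p q lam0"
  unfolding dir_simple_def
proof (intro conjI allI impI)
  note n = dir_det_simple_zero_imp_entries[OF p D]
  show "dir_eigenvalue p q lam0"
    using D0 dir_eigenvalue_iff[OF p] by blast
  {
    fix f g assume fg: "dir_eigenfun p q lam0 f \<and> dir_eigenfun p q lam0 g"
    let ?m = "phi p q lam0 I2 I1 1" and ?n = "phi p q lam0 I3 I1 1"
    obtain a b where f: "a \<noteq> 0 \<or> b \<noteq> 0" "\<And>x. x \<in> {0..2} \<Longrightarrow> f x = a * phi p q lam0 I2 I1 x + b * phi p q lam0 I3 I1 x"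
      "?m * a + ?n * b = 0"
      using dir_eigenfunE[OF p, of lam0 f] fg by metis
    obtain a' b' where g: "\<And>x. x \<in> {0..2} \<Longrightarrow> g x = a' * phi p q lam0 I2 I1 x + b' * phi p q lam0 I3 I1 x"
      "?m * a' + ?n * b' = 0"
      using dir_eigenfunE[OF p, of lam0 g] fg by metis
    have "\<exists>c. a' = c * a \<and> b' = c * b"
    proof -
      have cr: "a' * b = a * b'"
      proof -
        have "?m * (a' * b - a * b') = 0" "?n * (a' * b - a * b') = 0"
          using f(3) g(2) by algebra+
        then show ?thesis using n by auto
      qed
      show ?thesis
      proof (cases "a = 0")
        case True
        then show ?thesis using f(1) cr by (intro exI[of _ "b' / b"]) auto
      next
        case False
        then show ?thesis using cr by (intro exI[of _ "a' / a"]) (auto simp: field_simps)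
      qed
    qed
    then obtain c where "a' = c * a" "b' = c * b" by blast
    then have "g x = c * f x" if "x \<in> {0..2}" for x
      using f(2)[OF that] g(1)[OF that] by (simp add: algebra_simps)
    then show "\<exists>c. \<forall>x\<in>{0..2}. g x = c * f x" by blast
  }
  fix f assume f: "dir_eigenfun p q lam0 f"
  show "\<not> (\<exists>y. dir_sol p q lam0 f y)"
  proof
    assume "\<exists>y. dir_sol p q lam0 f y"
    then obtain Y where Y: "osolv 2 p q lam0 f Y" "Y I1 0 = 0" "Y I1 1 = 0" "Y I1 2 = 0"
      unfolding dir_sol_osolv by auto
    obtain F where F: "osolv 2 p q lam0 (\<lambda>_. 0) F" "F I1 = f" "F I2 0 \<noteq> 0 \<or> F I3 0 \<noteq> 0"
      using dir_eigenfunE[OF p f] by metis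
    have f0: "F I1 0 = 0" "F I1 1 = 0" "F I1 2 = 0"
      using f F(2) unfolding dir_eigenfun_def dir_sol_def by auto
    \<comment> \<open>\<open>(H - lam) W = - (lam - lam0)^2 * Y\<close>, since the terms of lower
      order cancel; \<open>W\<close> still satisfies all three boundary conditions.\<close>
    define W where "W = (\<lambda>lam i t. 1 * F i t + (lam - lam0) * Y i t)"
    have W: "osolv 2 p q lam0 (\<lambda>t. (lam - lam0) * f t) (W lam)" for lam
      unfolding W_def using osolv_lincomb[OF F(1) Y(1), where c = 1 and e = "lam - lam0"] by simp
    have cf: "continuous_on {0..2} f"
      using osolv_continuous_on[OF F(1), of I1] F(2) by simp
    have cY: "continuous_on {0..2} (Y i)" for i
      using osolv_continuous_on[OF Y(1)] .
    define R where "R = (\<lambda>s lam j. integral {0..1} (\<lambda>t. Y I1 (t + s) * cofac p q lam j t))"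
    \<comment> \<open>\<open>s = 0\<close> and \<open>s = 1\<close> treat the two periods. Variation
      of constants is based at \<open>lam\<close>, not at \<open>lam0\<close>, so that the entries
      of \<open>dir_det p q lam\<close> appear.\<close>
    have WR: "W lam i (1 + s) = (\<Sum>j\<in>UNIV. phi p q lam j i 1 * (W lam j s - (lam - lam0) ^ 2 * R s lam j))"
      if s: "s = 0 \<or> s = 1" for lam i s
    proof -
      have S: "osolv 1 p q lam0 (\<lambda>t. (lam - lam0) * f (t + s)) (\<lambda>i t. W lam i (t + s))"
        using s osolv_subset[OF W, of 1 lam] osolv_translate[OF p W, of lam] by auto
      have c: "continuous_on {0..1} (\<lambda>t. (lam - lam0) * f (t + s))"
        using s by (intro continuous_intros continuous_on_compose2[OF cf]) auto
      have "W lam i (1 + s) = (\<Sum>j\<in>UNIV. phi p q lam j i 1 *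
        (W lam j (0 + s) + integral {0..1} (\<lambda>t. ((lam0 - lam) * W lam I1 (t + s) + (lam - lam0) * f (t + s)) * cofac p q lam j t)))"
        by (rule variation_of_constants[OF p _ c S]) auto
      moreover have "(\<lambda>t. ((lam0 - lam) * W lam I1 (t + s) + (lam - lam0) * f (t + s)) * cofac p q lam j t) =
        (\<lambda>t. - ((lam - lam0) ^ 2) * (Y I1 (t + s) * cofac p q lam j t))" for j
        by (auto simp: W_def F(2) power2_eq_square algebra_simps)
      ultimately show ?thesis by (simp add: R_def)
    qed
    define r where "r = cmod lam0 + 1"
    obtain M where M: "\<And>t. t \<in> {0..2} \<Longrightarrow> cmod (Y I1 t) \<le> M"
    proof -
      have "bounded (Y I1 ` {0..2})"
        using compact_continuous_image[OF cY] compact_imp_bounded by blast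
      then show ?thesis using that unfolding bounded_iff by blast
    qed
    have M0: "0 \<le> M" using order_trans[OF norm_ge_zero M[of 0]] by simp
    define B where "B = phi_bd r"
    have B0: "0 \<le> B" unfolding B_def by (rule phi_bd_nonneg) (simp add: r_def)
    have lr: "cmod lam \<le> r" if "cmod (lam - lam0) < 1" for lam
      using that norm_triangle_ineq[of "lam - lam0" lam0] by (simp add: r_def)
    have N: "cmod (phi p q lam j i 1) \<le> B" if "cmod (lam - lam0) < 1" for lam j i
      unfolding B_def using phi_bound[OF p _ lr[OF that]] by auto
    define Q where "Q = M * (2 * B ^ 2)"
    have Q0: "0 \<le> Q" using M0 B0 by (simp add: Q_def)
    have RB: "cmod (R s lam j) \<le> Q" if "s = 0 \<or> s = 1" "cmod (lam - lam0) < 1" for s lam j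
      unfolding R_def Q_def
    proof (rule integral_unit_bound)
      show "continuous_on {0..1} (\<lambda>t. Y I1 (t + s) * cofac p q lam j t)"
        using that by (intro continuous_intros continuous_on_compose2[OF cY]
            continuous_on_subset[OF cofac_continuous_on[OF p]]) auto
      show "cmod (Y I1 (t + s) * cofac p q lam j t) \<le> M * (2 * B\<^sup>2)" if "t \<in> {0..1}" for t
        unfolding norm_mult B_def using M0 that \<open>s = 0 \<or> s = 1\<close>
        by (intro mult_mono M cofac_bound[OF p _ lr[OF \<open>cmod (lam - lam0) < 1\<close>]]) auto
    qed auto
    let ?N = "\<lambda>lam j i. phi p q lam j i 1"
    define X where "X = (\<lambda>lam. ?N lam I1 I1 * R 0 lam I1 + ?N lam I2 I1 * R 0 lam I2 + ?N lam I3 I1 * R 0 lam I3)"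
    define Z where "Z = (\<lambda>lam. ?N lam I1 I1 * R 1 lam I1 + ?N lam I2 I1 * R 1 lam I2 + ?N lam I3 I1 * R 1 lam I3)"
    define X2 where "X2 = (\<lambda>lam. ?N lam I1 I2 * R 0 lam I1 + ?N lam I2 I2 * R 0 lam I2 + ?N lam I3 I2 * R 0 lam I3)"
    define X3 where "X3 = (\<lambda>lam. ?N lam I1 I3 * R 0 lam I1 + ?N lam I2 I3 * R 0 lam I2 + ?N lam I3 I3 * R 0 lam I3)"
    have W0: "W lam I1 0 = 0" "W lam I1 1 = 0" "W lam I1 2 = 0" for lam
      by (simp_all add: W_def f0 Y)
    have e1: "?N lam I2 I1 * W lam I2 0 + ?N lam I3 I1 * W lam I3 0 = (lam - lam0) ^ 2 * X lam" for lam
      using WR[of 0 lam I1] W0[of lam] by (simp add: sum_idx3 X_def algebra_simps)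
    have e2: "?N lam I2 I1 * W lam I2 1 + ?N lam I3 I1 * W lam I3 1 = (lam - lam0) ^ 2 * Z lam" for lam
      using WR[of 1 lam I1] W0[of lam] by (simp add: sum_idx3 Z_def algebra_simps)
    have e3: "W lam I2 1 = ?N lam I2 I2 * W lam I2 0 + ?N lam I3 I2 * W lam I3 0 - (lam - lam0) ^ 2 * X2 lam" for lam
      using WR[of 0 lam I2] W0[of lam] by (simp add: sum_idx3 X2_def algebra_simps)
    have e4: "W lam I3 1 = ?N lam I2 I3 * W lam I2 0 + ?N lam I3 I3 * W lam I3 0 - (lam - lam0) ^ 2 * X3 lam" for lam
      using WR[of 0 lam I3] W0[of lam] by (simp add: sum_idx3 X3_def algebra_simps)
    have t3: "cmod (a + b + c) \<le> 3 * K" if "cmod a \<le> K" "cmod b \<le> K" "cmod c \<le> K" for a b c :: complex and K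
      using that norm_triangle_ineq[of "a + b" c] norm_triangle_ineq[of a b] by linarith
    have m2: "cmod (a * b) \<le> K * L" if "cmod a \<le> K" "cmod b \<le> L" for a b :: complex and K L
      unfolding norm_mult using that by (intro mult_mono) (auto intro: order_trans[OF norm_ge_zero])
    have XB: "cmod (X lam) \<le> 3 * (B * Q)" "cmod (Z lam) \<le> 3 * (B * Q)" "cmod (X2 lam) \<le> 3 * (B * Q)" "cmod (X3 lam) \<le> 3 * (B * Q)"
      if "cmod (lam - lam0) < 1" for lam
      unfolding X_def Z_def X2_def X3_def using that by (auto intro!: t3 m2 N RB)
    define G where "G = (\<lambda>lam. Z lam + ?N lam I2 I1 * X2 lam + ?N lam I3 I1 * X3 lam)"
    have GB: "cmod (G lam) \<le> 3 * (3 * (B * Q) + B * (3 * (B * Q)))" if "cmod (lam - lam0) < 1" for lam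
    proof -
      have "0 \<le> 3 * (B * Q)" "0 \<le> B * (3 * (B * Q))" using B0 Q0 by auto
      then show ?thesis
        unfolding G_def using XB[OF that] m2[OF N[OF that, of I2 I1] XB(3)[OF that]] m2[OF N[OF that, of I3 I1] XB(4)[OF that]]
        by (intro t3; linarith)
    qed
    \<comment> \<open>Cramer's rule for the conditions at \<open>1\<close> and \<open>2\<close>,
      whose right-hand sides carry the factor \<open>(lam - lam0)^2\<close>.\<close>
    have D2: "dir_det p q lam * W lam I2 0 = (lam - lam0) ^ 2 * ((?N lam I2 I1 * ?N lam I3 I2 + ?N lam I3 I1 * ?N lam I3 I3) * X lam - ?N lam I3 I1 * G lam)" for lam
      using e1[of lam] e2[of lam] unfolding e3 e4 dir_det_eq[OF p] G_def by algebra
    have D3: "dir_det p q lam * W lam I3 0 = (lam - lam0) ^ 2 * (?N lam I2 I1 * G lam - (?N lam I2 I1 * ?N lam I2 I2 + ?N lam I3 I1 * ?N lam I2 I3) * X lam)" for lam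
      using e1[of lam] e2[of lam] unfolding e3 e4 dir_det_eq[OF p] G_def by algebra
    define K where "K = 2 * (B * B) * (3 * (B * Q)) + B * (3 * (3 * (B * Q) + B * (3 * (B * Q))))"
    have NN: "cmod (?N lam a b * ?N lam c d + ?N lam a' b' * ?N lam c' d') \<le> 2 * (B * B)" if "cmod (lam - lam0) < 1" for lam a b c d a' b' c' d'
      using m2[OF N[OF that, of a b] N[OF that, of c d]] m2[OF N[OF that, of a' b'] N[OF that, of c' d']]
        norm_triangle_ineq[of "?N lam a b * ?N lam c d" "?N lam a' b' * ?N lam c' d'"] by linarith
    have diffb: "cmod (u - v) \<le> a + b" "cmod (v - u) \<le> a + b" if "cmod u \<le> a" "cmod v \<le> b" for u v :: complex and a b
      using norm_triangle_ineq4[of u v] norm_triangle_ineq4[of v u] that by linarith+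
    have "cmod (dir_det p q lam * W lam I2 0) \<le> K * cmod (lam - lam0) ^ 2" "cmod (dir_det p q lam * W lam I3 0) \<le> K * cmod (lam - lam0) ^ 2"
      if l: "cmod (lam - lam0) < 1" for lam
      unfolding D2 D3 norm_mult[of "(lam - lam0)\<^sup>2"] norm_power K_def mult.commute[of _ "cmod (lam - lam0) ^ 2"]
      by (intro mult_left_mono diffb m2[OF NN[OF l] XB(1)[OF l]] m2[OF N[OF l] GB[OF l]]; simp)+
    then have q: "((\<lambda>lam. dir_det p q lam * W lam I2 0) has_field_derivative 0) (at lam0)"
      "((\<lambda>lam. dir_det p q lam * W lam I3 0) has_field_derivative 0) (at lam0)"
      using D0 by (auto intro!: has_field_derivative_quadratic_bound[where C = K])
    have dD: "(dir_det p q has_field_derivative deriv (dir_det p q) lam0) (at lam0)"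
      using dir_det_holomorphic[OF p, of UNIV] by (simp add: holomorphic_derivI)
    \<comment> \<open>At the zero \<open>lam0\<close> the product rule leaves the derivative of the
      determinant times the initial data of the eigenfunction, which do not all vanish.\<close>
    have "((\<lambda>lam. dir_det p q lam * W lam i 0) has_field_derivative deriv (dir_det p q) lam0 * F i 0) (at lam0)" for i
      unfolding W_def by (auto intro!: derivative_eq_intros dD simp: D0)
    then have "deriv (dir_det p q) lam0 * F I2 0 = 0" "deriv (dir_det p q) lam0 * F I3 0 = 0"
      using q DERIV_unique by blast+
    then show False using D F(3) by auto
  qed
qed

section \<open>The free model and its perturbations\<close>

definition vdm :: "complex \<Rightarrow> complex" where
  "vdm z = (exp z - exp (omega * z)) * (exp z - exp (omega\<^sup>2 * z)) * (exp (omega * z) - exp (omega\<^sup>2 * z))"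

definition growth2 :: "complex \<Rightarrow> real" where "growth2 z = growth z + growth (- z)"

abbreviation rho0 :: "complex \<Rightarrow> complex" where "rho0 \<equiv> rho (\<lambda>_. 0) (\<lambda>_. 0)"
abbreviation dir_det0 :: "complex \<Rightarrow> complex" where "dir_det0 \<equiv> dir_det (\<lambda>_. 0) (\<lambda>_. 0)"
abbreviation mtrace0 :: "complex \<Rightarrow> complex" where "mtrace0 \<equiv> mtrace (\<lambda>_. 0) (\<lambda>_. 0)"

lemma smallpot_0: "smallpot (\<lambda>_. 0) (\<lambda>_. 0)"
  by (rule pot_0) simp

lemma minus_cube: "- (z ^ 3) = (- z) ^ 3" for z :: complex
  by (simp add: power3_eq_cube)

lemma exp_omega_prod: "exp z * exp (omega * z) * exp (omega\<^sup>2 * z) = 1"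
proof -
  have "z + omega * z + omega\<^sup>2 * z = (1 + omega + omega\<^sup>2) * z" by (simp add: algebra_simps)
  then show ?thesis by (simp only: omega_sum flip: exp_add) simp
qed

lemma exp_omega_minus:
  "exp (- z) = exp (omega * z) * exp (omega\<^sup>2 * z)" "exp (omega * - z) = exp z * exp (omega\<^sup>2 * z)"
  "exp (omega\<^sup>2 * - z) = exp z * exp (omega * z)"
  using exp_omega_prod[of z] by (simp_all add: exp_minus field_simps)

lemma mtrace0_cube: "mtrace0 (z ^ 3) = exp z + exp (omega * z) + exp (omega\<^sup>2 * z)"
  "mtrace0 (- (z ^ 3)) = exp z * exp (omega * z) + exp z * exp (omega\<^sup>2 * z) + exp (omega * z) * exp (omega\<^sup>2 * z)"
proof -
  have T: "mtrace0 (z ^ 3) = exp z + exp (omega * z) + exp (omega\<^sup>2 * z)" for z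
    by (simp add: mtrace_def sum_idx3 phi_free phi0_def ker0_def field_simps)
  show "mtrace0 (z ^ 3) = exp z + exp (omega * z) + exp (omega\<^sup>2 * z)" by (rule T)
  show "mtrace0 (- (z ^ 3)) = exp z * exp (omega * z) + exp z * exp (omega\<^sup>2 * z) + exp (omega * z) * exp (omega\<^sup>2 * z)"
    unfolding minus_cube T exp_omega_minus by simp
qed

lemma rho0_cube: "rho0 (z ^ 3) = vdm z ^ 2"
  using cubic_disc_roots[OF exp_omega_prod[of z]] rho_eq_disc3[OF smallpot_0, of "z ^ 3"] mtrace0_cube[of z]
  by (simp add: vdm_def power_mult_distrib)

text \<open>The exponentials in the adjoint kernels are products of two of \<open>a\<close>,
  \<open>b\<close>, \<open>c\<close>, because \<open>a * b * c = 1\<close>; what remains is a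
  polynomial identity modulo \<open>omega ^ 3 = 1\<close>.\<close>

lemma dir_det0_cube: "9 * z ^ 3 * dir_det0 (z ^ 3) = (omega\<^sup>2 - omega) * vdm z"
proof (cases "z = 0")
  case True
  then show ?thesis by (simp add: vdm_def)
next
  case False
  define a b c where "a = exp z" and "b = exp (omega * z)" and "c = exp (omega\<^sup>2 * z)"
  have D: "dir_det0 (z ^ 3) = ker1 z 1 * ker2 (- z) 1 + ker2 z 1 * ker1 (- z) 1"
    unfolding dir_det_def minus_cube using phi_free[of 1 z] phi_free[of 1 "- z"] by (simp add: phi0_def)
  have e: "exp (- z) = b * c" "exp (omega * - z) = a * c" "exp (omega\<^sup>2 * - z) = a * b"
    unfolding a_def b_def c_def by (rule exp_omega_minus)+
  have C: "3 * z * ker1 z 1 = a + omega\<^sup>2 * b + omega * c" "3 * z\<^sup>2 * ker2 z 1 = a + omega * b + omega\<^sup>2 * c"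
    using False by (simp_all add: ker1_def ker2_def a_def b_def c_def)
  have C': "3 * z * ker1 (- z) 1 = - (b * c + omega\<^sup>2 * (a * c) + omega * (a * b))"
     "3 * z\<^sup>2 * ker2 (- z) 1 = b * c + omega * (a * c) + omega\<^sup>2 * (a * b)"
    using False e by (simp_all add: ker1_def ker2_def)
  have abc: "a * b * c = 1" unfolding a_def b_def c_def by (rule exp_omega_prod)
  have "9 * z ^ 3 * dir_det0 (z ^ 3) = (3 * z * ker1 z 1) * (3 * z\<^sup>2 * ker2 (- z) 1) + (3 * z\<^sup>2 * ker2 z 1) * (3 * z * ker1 (- z) 1)"
    unfolding D by (simp add: power2_eq_square power3_eq_cube algebra_simps)
  also have "\<dots> = (a + omega\<^sup>2 * b + omega * c) * (b * c + omega * (a * c) + omega\<^sup>2 * (a * b))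
     - (a + omega * b + omega\<^sup>2 * c) * (b * c + omega\<^sup>2 * (a * c) + omega * (a * b))"
    unfolding C C' mult_minus_right by simp
  also have "\<dots> = (omega\<^sup>2 - omega) * ((a - b) * (a - c) * (b - c))"
    using omega_cube by algebra
  finally show ?thesis by (simp add: vdm_def a_def b_def c_def)
qed

lemma omega_diff_square: "(omega\<^sup>2 - omega)\<^sup>2 = - 3"
  using omega_cube omega_sum by algebra

lemma omega_diff: "omega - omega\<^sup>2 = \<i> * of_real (sqrt 3)"
  unfolding omega_square unfolding omega_def by (simp add: complex_eq_iff)

lemma norm_omega_diff: "cmod (omega\<^sup>2 - omega) = sqrt 3"
proof -
  have "cmod (omega\<^sup>2 - omega) = cmod (omega - omega\<^sup>2)" by (rule norm_minus_commute)
  then show ?thesis unfolding omega_diff by (simp add: norm_mult)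
qed

text \<open>Squaring \<open>dir_det0_cube\<close> removes the dependence on the choice of cube root,
  so the origin can be treated in the variable \<open>lam\<close> itself.\<close>

lemma rho0_Del0: "rho0 lam = - 27 * lam\<^sup>2 * dir_det0 lam ^ 2"
proof -
  define z where "z = cbrt lam"
  have z: "z ^ 3 = lam" by (simp add: z_def cbrt_cube)
  have "(9 * lam * dir_det0 lam)\<^sup>2 = (omega\<^sup>2 - omega)\<^sup>2 * rho0 lam"
    using dir_det0_cube[of z] rho0_cube[of z] z by (simp add: power_mult_distrib)
  then show ?thesis unfolding omega_diff_square by algebra
qed

lemma dir_det0_0: "dir_det0 0 = 1"
proof -
  have "dir_det0 (0 ^ 3) = ker1 0 1 * ker2 0 1 + ker2 0 1 * ker1 0 1"
    using phi_free[of 1 0] by (simp add: dir_det_def phi0_def)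
  then show ?thesis by (simp add: ker1_def ker2_def)
qed

section \<open>Zeros of the free Vandermonde product and lower bounds away from them\<close>

lemma exp_eq_omega:
  "exp (omega * z) = exp (omega\<^sup>2 * z) \<longleftrightarrow> (\<exists>k::int. z = of_real (2 * pi * k / sqrt 3))"
  "exp z = exp (omega * z) \<longleftrightarrow> (\<exists>k::int. omega\<^sup>2 * z = of_real (2 * pi * k / sqrt 3))"
  "exp z = exp (omega\<^sup>2 * z) \<longleftrightarrow> (\<exists>k::int. omega * z = of_real (2 * pi * k / sqrt 3))"
proof -
  have s3: "complex_of_real (sqrt 3) \<noteq> 0" by simp
  have E: "u = v + of_int (2 * n) * of_real pi * \<i> \<longleftrightarrow> w = of_real (2 * pi * n / sqrt 3)"
    if "u - v = (\<i> * of_real (sqrt 3)) * w" for u v w :: complex and n :: int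
  proof -
    have "u = v + of_int (2 * n) * of_real pi * \<i> \<longleftrightarrow> \<i> * (of_real (sqrt 3) * w) = \<i> * (of_int (2 * n) * of_real pi)"
      using that by (auto simp: algebra_simps)
    also have "\<dots> \<longleftrightarrow> of_real (sqrt 3) * w = of_int (2 * n) * of_real pi" by simp
    also have "\<dots> \<longleftrightarrow> w = of_real (2 * pi * n / sqrt 3)" using s3 by (auto simp: field_simps)
    finally show ?thesis .
  qed
  \<comment> \<open>Up to sign, each difference of two exponents is \<open>\<i> * sqrt 3\<close>
    times the remaining cube root, so the coincidence of two multipliers is a condition on that root
    alone.\<close>
  have 0: "omega * z - omega\<^sup>2 * z = (\<i> * of_real (sqrt 3)) * z"
    by (simp only: omega_diff flip: left_diff_distrib)
  show "exp (omega * z) = exp (omega\<^sup>2 * z) \<longleftrightarrow> (\<exists>k::int. z = of_real (2 * pi * k / sqrt 3))"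
    unfolding exp_eq using E[OF 0] by simp
  have 1: "z - omega * z = (\<i> * of_real (sqrt 3)) * (omega\<^sup>2 * z)"
    unfolding omega_diff[symmetric] using omega_cube by algebra
  show "exp z = exp (omega * z) \<longleftrightarrow> (\<exists>k::int. omega\<^sup>2 * z = of_real (2 * pi * k / sqrt 3))"
    unfolding exp_eq using E[OF 1] by simp
  have 2: "omega\<^sup>2 * z - z = (\<i> * of_real (sqrt 3)) * (omega * z)"
    unfolding omega_diff[symmetric] using omega_cube by algebra
  show "exp z = exp (omega\<^sup>2 * z) \<longleftrightarrow> (\<exists>k::int. omega * z = of_real (2 * pi * k / sqrt 3))"
    unfolding eq_commute[of "exp z"] unfolding exp_eq using E[OF 2] by simp
qed

lemma vdm_eq_0_iff:
  "vdm z = 0 \<longleftrightarrow> (\<exists>k::int. \<exists>w\<in>{z, omega * z, omega\<^sup>2 * z}. w = of_real (2 * pi * k / sqrt 3))"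
  unfolding vdm_def mult_eq_0_iff right_minus_eq exp_eq_omega by blast

text \<open>Reducing the imaginary part modulo \<open>2 * pi\<close> leaves a compact part of the
  strip \<open>-1 <= Re w <= 0\<close>, on which \<open>1 - exp w\<close> has no zero at distance at
  least \<open>1\<close> from the origin. For \<open>Re w <= -1\<close> the bound is
  explicit.\<close>

lemma one_minus_exp_lower:
  "\<exists>c>0. \<forall>w. Re w \<le> 0 \<and> (\<forall>k::int. 1 \<le> cmod (w - of_real (2 * pi * k) * \<i>)) \<longrightarrow> c \<le> cmod (1 - exp w)"
proof -
  define K where "K = {w. -1 \<le> Re w} \<inter> {w. Re w \<le> 0} \<inter> {w. - pi \<le> Im w} \<inter> {w. Im w \<le> pi} \<inter> {w. 1 \<le> cmod w}"
  have clK: "closed K"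
    unfolding K_def by (intro closed_Int closed_Collect_le continuous_intros)
  have "K \<subseteq> cball 0 (1 + pi)"
  proof
    fix w assume "w \<in> K"
    then have "\<bar>Re w\<bar> \<le> 1" "\<bar>Im w\<bar> \<le> pi" by (auto simp: K_def)
    then show "w \<in> cball 0 (1 + pi)" using cmod_le[of w] by auto
  qed
  then have cK: "compact K"
    using clK bounded_subset[OF bounded_cball] compact_eq_bounded_closed by blast
  have neK: "- 1 \<in> K" by (simp add: K_def)
  have "continuous_on K (\<lambda>w. cmod (1 - exp w))"
    by (intro continuous_intros)
  then obtain w0 where w0: "w0 \<in> K" "\<And>w. w \<in> K \<Longrightarrow> cmod (1 - exp w0) \<le> cmod (1 - exp w)"
    using continuous_attains_inf[OF cK, of "\<lambda>w. cmod (1 - exp w)"] neK by blast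
  have nz: "cmod (1 - exp w0) > 0"
  proof (rule ccontr)
    assume "\<not> ?thesis"
    then have "exp w0 = 1" by simp
    then obtain n :: int where n: "Re w0 = 0" "Im w0 = of_int (2 * n) * pi"
      unfolding exp_eq_1 by auto
    have "\<bar>Im w0\<bar> \<le> 1 * pi" using w0(1) by (auto simp: K_def)
    then have "\<bar>of_int (2 * n) * pi\<bar> \<le> 1 * pi" unfolding n(2) .
    then have "\<bar>of_int (2 * n) :: real\<bar> \<le> 1"
      unfolding abs_mult using mult_le_cancel_right_pos[OF pi_gt_zero] by auto
    then have "n = 0" by linarith
    then have "w0 = 0" using n by (simp add: complex_eq_iff)
    then show False using w0(1) by (simp add: K_def)
  qed
  have e1: "exp (-1::real) < 1" by simp
  let ?c = "min (cmod (1 - exp w0)) (1 - exp (-1))"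
  have "?c \<le> cmod (1 - exp w)" if w: "Re w \<le> 0" "\<forall>k::int. 1 \<le> cmod (w - of_real (2 * pi * k) * \<i>)" for w
  proof (cases "Re w \<le> - 1")
    case True
    then have "cmod (exp w) \<le> exp (-1)" by simp
    moreover have "1 - cmod (exp w) \<le> cmod (1 - exp w)"
      using norm_triangle_ineq2[of 1 "exp w"] by simp
    ultimately show ?thesis by linarith
  next
    case False
    define k where "k = round (Im w / (2 * pi))"
    define w' where "w' = w - of_real (2 * pi * k) * \<i>"
    have "\<bar>of_int k - Im w / (2 * pi)\<bar> \<le> 1 / 2"
      unfolding k_def by (rule of_int_round_abs_le)
    then have "\<bar>of_int k - Im w / (2 * pi)\<bar> * (2 * pi) \<le> 1 / 2 * (2 * pi)"
      by (intro mult_right_mono) auto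
    also have "\<bar>of_int k - Im w / (2 * pi)\<bar> * (2 * pi) = \<bar>(of_int k - Im w / (2 * pi)) * (2 * pi)\<bar>"
      by (simp add: abs_mult)
    also have "(of_int k - Im w / (2 * pi)) * (2 * pi) = 2 * pi * of_int k - Im w"
      by (simp add: field_simps)
    finally have "\<bar>2 * pi * of_int k - Im w\<bar> \<le> pi" by simp
    then have "w' \<in> K"
      using w False unfolding K_def w'_def by auto
    moreover have "exp w' = exp w"
      unfolding exp_eq w'_def by (intro exI[of _ "- k"]) simp
    ultimately show ?thesis using w0(2)[of w'] by simp
  qed
  then show ?thesis
    using nz e1 by (intro exI[of _ ?c]) auto
qed

lemma exp_diff_lower:
  "\<exists>c>0. \<forall>u v. (\<forall>k::int. 1 \<le> cmod (u - v - of_real (2 * pi * k) * \<i>)) \<longrightarrow>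
     c * exp (max (Re u) (Re v)) \<le> cmod (exp u - exp v)"
proof -
  obtain c where c: "c > 0" "\<And>w. Re w \<le> 0 \<Longrightarrow> (\<And>k::int. 1 \<le> cmod (w - of_real (2 * pi * k) * \<i>)) \<Longrightarrow> c \<le> cmod (1 - exp w)"
    using one_minus_exp_lower by blast
  have half: "c * exp (Re u) \<le> cmod (exp u - exp v)"
    if uv: "Re v \<le> Re u" "\<And>k::int. 1 \<le> cmod (v - u - of_real (2 * pi * k) * \<i>)" for u v
  proof -
    have "exp u - exp v = exp u * (1 - exp (v - u))"
      by (simp add: exp_diff field_simps)
    then have "cmod (exp u - exp v) = exp (Re u) * cmod (1 - exp (v - u))"
      by (simp add: norm_mult)
    moreover have "c \<le> cmod (1 - exp (v - u))"
      using uv by (intro c(2)) auto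
    ultimately show ?thesis by (simp add: mult.commute)
  qed
  have "c * exp (max (Re u) (Re v)) \<le> cmod (exp u - exp v)"
    if uv: "\<forall>k::int. 1 \<le> cmod (u - v - of_real (2 * pi * k) * \<i>)" for u v
  proof (cases "Re v \<le> Re u")
    case True
    have "cmod (v - u - of_real (2 * pi * k) * \<i>) = cmod (u - v - of_real (2 * pi * (- k)) * \<i>)" for k :: int
      by (subst norm_minus_cancel[symmetric]) (simp add: algebra_simps)
    then have "1 \<le> cmod (v - u - of_real (2 * pi * k) * \<i>)" for k :: int
      using uv by metis
    from half[OF True this] show ?thesis using True by simp
  next
    case False
    then show ?thesis using half[of u v] uv by (simp add: norm_minus_commute)
  qed
  with c(1) show ?thesis by blast
qed

text \<open>Unit distance from the free zeros is demanded of all three cube roots, which makes this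
  a property of \<open>z ^ 3\<close>. The discs have radius \<open>2 / sqrt 3 > 1\<close>, so their
  boundaries can qualify.\<close>

definition separated :: "complex \<Rightarrow> bool" where
  "separated z \<longleftrightarrow> (\<forall>k::int. \<forall>w\<in>{z, omega * z, omega\<^sup>2 * z}. 1 \<le> cmod (w - of_real (2 * pi * k / sqrt 3)))"

lemma Re_omega_sum: "Re z + Re (omega * z) + Re (omega\<^sup>2 * z) = 0"
  unfolding Re_omega by simp

text \<open>With real parts \<open>a1 >= a2 >= a3\<close> of sum zero, the pairwise maxima are
  \<open>a1\<close>, \<open>a1\<close>, \<open>a2\<close>, and
  \<open>2 * a1 + a2 = a1 - a3\<close>.\<close>

lemma growth2_eq: "max (Re z) (Re (omega * z)) + max (Re z) (Re (omega\<^sup>2 * z)) + max (Re (omega * z)) (Re (omega\<^sup>2 * z)) = growth2 z"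
proof -
  have "growth (- z) = max (- Re z) (max (- Re (omega * z)) (- Re (omega\<^sup>2 * z)))"
    unfolding growth_def by simp
  then show ?thesis
    using Re_omega_sum[of z] unfolding growth2_def growth_def by linarith
qed

text \<open>As the real parts have sum zero, the largest is minus the sum of the other two, hence at
  most minus twice the smallest; the second bound is the same for \<open>- z\<close>.\<close>

lemma growth_le_double: "growth z \<le> 2 * growth (- z)" "growth (- z) \<le> 2 * growth z"
proof -
  have "growth (- z) = max (- Re z) (max (- Re (omega * z)) (- Re (omega\<^sup>2 * z)))"
    unfolding growth_def by simp
  then show "growth z \<le> 2 * growth (- z)" "growth (- z) \<le> 2 * growth z"
    using Re_omega_sum[of z] unfolding growth_def by linarith+
qed

lemma vdm_lower: "\<exists>c>0. \<forall>z. separated z \<longrightarrow> c * exp (growth2 z) \<le> cmod (vdm z)"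
proof -
  obtain c where c: "c > 0" "\<And>u v. (\<And>k::int. 1 \<le> cmod (u - v - of_real (2 * pi * k) * \<i>)) \<Longrightarrow>
     c * exp (max (Re u) (Re v)) \<le> cmod (exp u - exp v)"
    using exp_diff_lower by blast
  have "c ^ 3 * exp (growth2 z) \<le> cmod (vdm z)" if z: "separated z" for z
  proof -
    have D: "1 \<le> cmod (u - v - of_real (2 * pi * k) * \<i>)"
      if "u - v = (\<i> * of_real (sqrt 3)) * w" "w \<in> {z, omega * z, omega\<^sup>2 * z}" for u v w and k :: int
    proof -
      have "u - v - of_real (2 * pi * k) * \<i> = (\<i> * of_real (sqrt 3)) * (w - of_real (2 * pi * k / sqrt 3))"
        unfolding that by (simp add: field_simps)
      then have "cmod (u - v - of_real (2 * pi * k) * \<i>) = sqrt 3 * cmod (w - of_real (2 * pi * k / sqrt 3))"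
        by (simp only: norm_mult) simp
      also have "\<dots> \<ge> 1 * 1"
        using z that(2) unfolding separated_def by (intro mult_mono) auto
      finally show ?thesis by simp
    qed
    have 1: "z - omega * z = (\<i> * of_real (sqrt 3)) * (omega\<^sup>2 * z)"
      "omega\<^sup>2 * z - z = (\<i> * of_real (sqrt 3)) * (omega * z)" "omega * z - omega\<^sup>2 * z = (\<i> * of_real (sqrt 3)) * z"
      unfolding omega_diff[symmetric] using omega_cube by (algebra, algebra) (rule left_diff_distrib[symmetric])
    have "c * exp (max (Re z) (Re (omega * z))) \<le> cmod (exp z - exp (omega * z))"
      by (rule c(2), rule D[OF 1(1)]) auto
    moreover have "c * exp (max (Re z) (Re (omega\<^sup>2 * z))) \<le> cmod (exp z - exp (omega\<^sup>2 * z))"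
      unfolding max.commute[of "Re z"] norm_minus_commute[of "exp z"]
      by (rule c(2), rule D[OF 1(2)]) auto
    moreover have "c * exp (max (Re (omega * z)) (Re (omega\<^sup>2 * z))) \<le> cmod (exp (omega * z) - exp (omega\<^sup>2 * z))"
      by (rule c(2), rule D[OF 1(3)]) auto
    ultimately have "(c * exp (max (Re z) (Re (omega * z)))) * (c * exp (max (Re z) (Re (omega\<^sup>2 * z)))) * (c * exp (max (Re (omega * z)) (Re (omega\<^sup>2 * z)))) \<le> cmod (vdm z)"
      unfolding vdm_def norm_mult using c(1) by (intro mult_mono) auto
    also have "(c * exp (max (Re z) (Re (omega * z)))) * (c * exp (max (Re z) (Re (omega\<^sup>2 * z)))) * (c * exp (max (Re (omega * z)) (Re (omega\<^sup>2 * z)))) = c ^ 3 * exp (growth2 z)"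
      unfolding growth2_eq[symmetric] exp_add by (simp only: power3_eq_cube mult_ac)
    finally show ?thesis .
  qed
  then show ?thesis using c(1) by (intro exI[of _ "c ^ 3"]) auto
qed

text \<open>\<open>x\<close> and \<open>y\<close> are the sizes of the two traces. The cubes must
  not exceed \<open>x^2 * y^2\<close>, which is where \<open>x <= y^2\<close> and
  \<open>y <= x^2\<close> enter; \<open>7000\<close> rounds up
  \<open>4212 + 2 * 1116 + 324 = 6768\<close>.\<close>

lemma cubic_disc_perturbation:
  fixes T E T0 E0 :: complex
  assumes T: "cmod T \<le> 15 * x" "cmod T0 \<le> 3 * x" "cmod (T - T0) \<le> D * x"
    and E: "cmod E \<le> 15 * y" "cmod E0 \<le> 3 * y" "cmod (E - E0) \<le> D * y"
    and xy: "1 \<le> x" "1 \<le> y" "x \<le> y\<^sup>2" "y \<le> x\<^sup>2" and D: "0 \<le> D"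
  shows "cmod (cubic_disc T E - cubic_disc T0 E0) \<le> 7000 * D * (x * y)\<^sup>2"
proof -
  have m: "cmod (a * b) \<le> K * L" if "cmod a \<le> K" "cmod b \<le> L" for a b :: complex and K L
    unfolding norm_mult using that by (intro mult_mono) (auto intro: order_trans[OF norm_ge_zero])
  have add: "cmod (a + b) \<le> K + L" if "cmod a \<le> K" "cmod b \<le> L" for a b :: complex and K L
    using norm_triangle_ineq[of a b] that by linarith
  have add4: "cmod (a - b - c + e) \<le> K + L + M + P" if "cmod a \<le> K" "cmod b \<le> L" "cmod c \<le> M" "cmod e \<le> P"
    for a b c e :: complex and K L M P
    using norm_triangle_ineq[of "a - b - c" e] norm_triangle_ineq4[of "a - b" c] norm_triangle_ineq4[of a b] that by linarith
  have c4: "cmod (4 :: complex) \<le> 4" "cmod (18 :: complex) \<le> 18" by simp_all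
  have id: "cubic_disc T E - cubic_disc T0 E0 =
      ((T - T0) * (T + T0)) * (E * E) + (T0 * T0) * ((E - E0) * (E + E0))
      - 4 * ((T - T0) * (T * T + T * T0 + T0 * T0)) - 4 * ((E - E0) * (E * E + E * E0 + E0 * E0))
      + 18 * ((T - T0) * E + T0 * (E - E0))"
    unfolding cubic_disc_def by (simp add: power2_eq_square power3_eq_cube algebra_simps)
  have "cmod (cubic_disc T E - cubic_disc T0 E0) \<le>
      (((D * x) * (15 * x + 3 * x)) * ((15 * y) * (15 * y)) + ((3 * x) * (3 * x)) * ((D * y) * (15 * y + 3 * y)))
      + 4 * ((D * x) * ((15 * x) * (15 * x) + (15 * x) * (3 * x) + (3 * x) * (3 * x)))
      + 4 * ((D * y) * ((15 * y) * (15 * y) + (15 * y) * (3 * y) + (3 * y) * (3 * y)))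
      + 18 * ((D * x) * (15 * y) + (3 * x) * (D * y))"
    unfolding id by (intro add4 add m T E c4)
  also have "\<dots> = D * (4212 * (x * y)\<^sup>2 + 1116 * (x\<^sup>2 * x) + 1116 * (y\<^sup>2 * y) + 324 * (x * y))"
    by (simp add: power2_eq_square algebra_simps)
  also have "\<dots> \<le> D * (4212 * (x * y)\<^sup>2 + 1116 * (x\<^sup>2 * y\<^sup>2) + 1116 * (y\<^sup>2 * x\<^sup>2) + 324 * (x * y)\<^sup>2)"
  proof -
    have "1 * 1 \<le> x * y" using xy by (intro mult_mono) auto
    then have "x * y \<le> (x * y)\<^sup>2" by (intro self_le_power) auto
    moreover have "x\<^sup>2 * x \<le> x\<^sup>2 * y\<^sup>2" "y\<^sup>2 * y \<le> y\<^sup>2 * x\<^sup>2"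
      using xy by (auto intro!: mult_left_mono)
    ultimately show ?thesis using D by (intro mult_left_mono) linarith+
  qed
  also have "\<dots> = 6768 * (D * (x * y)\<^sup>2)"
    by (simp add: power_mult_distrib algebra_simps)
  also have "\<dots> \<le> 7000 * (D * (x * y)\<^sup>2)" using D by (intro mult_right_mono) auto
  finally show ?thesis by simp
qed

section \<open>Perturbation estimates and the choice of the size of the potentials\<close>

lemma norm_three: "cmod a \<le> K \<Longrightarrow> cmod b \<le> K \<Longrightarrow> cmod c \<le> K \<Longrightarrow> cmod (a + b + c) \<le> 3 * K"
  using norm_triangle_ineq[of "a + b" c] norm_triangle_ineq[of a b] by linarith

lemma mtrace_estimate:
  assumes p: "pot d p q" and d: "d \<le> 1/48"
  shows "cmod (mtrace p q (z ^ 3) - mtrace0 (z ^ 3)) \<le> 576 * d * exp (growth z)"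
    "cmod (mtrace0 (z ^ 3)) \<le> 3 * exp (growth z)" "cmod (mtrace p q (z ^ 3)) \<le> 15 * exp (growth z)"
proof -
  have one: "(1::real) \<in> {0..2}" by simp
  have "cmod (phi p q (z ^ 3) i i 1 - phi0 z i i 1) \<le> 192 * d * exp (growth z)" for i
    using phi_estimate(2)[OF p d one, of z i i] scale_ge(3)[of z] by (simp add: mult.assoc mult.left_commute)
  then have "cmod ((phi p q (z ^ 3) I1 I1 1 - phi0 z I1 I1 1) + (phi p q (z ^ 3) I2 I2 1 - phi0 z I2 I2 1)
     + (phi p q (z ^ 3) I3 I3 1 - phi0 z I3 I3 1)) \<le> 3 * (192 * d * exp (growth z))"
    by (intro norm_three)
  then show 1: "cmod (mtrace p q (z ^ 3) - mtrace0 (z ^ 3)) \<le> 576 * d * exp (growth z)"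
    by (simp add: mtrace_def sum_idx3 phi_free algebra_simps)
  show 2: "cmod (mtrace0 (z ^ 3)) \<le> 3 * exp (growth z)"
    unfolding mtrace0_cube using norm_exp_growth[of 1 z] by (intro norm_three) auto
  \<comment> \<open>\<open>576 / 48 = 12\<close>, hence the bound \<open>15 = 3 + 12\<close> for the
    perturbed trace.\<close>
  have "576 * d * exp (growth z) \<le> 12 * exp (growth z)" using d by (intro mult_right_mono) auto
  then show "cmod (mtrace p q (z ^ 3)) \<le> 15 * exp (growth z)"
    using 1 2 norm_triangle_sub[of "mtrace p q (z ^ 3)" "mtrace0 (z ^ 3)"] by linarith
qed

lemma rho_estimate:
  assumes p: "pot d p q" and d: "d \<le> 1/48"
  shows "cmod (rho p q (z ^ 3) - rho0 (z ^ 3)) \<le> 7000 * (576 * d) * exp (growth2 z) ^ 2"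
proof -
  have sp: "smallpot p q" using pot_mono[OF p d] .
  note t = mtrace_estimate[OF p d, of z] and t' = mtrace_estimate[OF pot_uminus[OF p] d, of "- z"]
  have x: "1 \<le> exp (growth z)" "1 \<le> exp (growth (- z))" using growth_nonneg by auto
  have xy: "exp (growth z) \<le> exp (growth (- z)) ^ 2" "exp (growth (- z)) \<le> exp (growth z) ^ 2"
    using growth_le_double[of z] by (simp_all flip: exp_double)
  have "cmod (cubic_disc (mtrace p q (z ^ 3)) (mtrace p (\<lambda>x. - q x) (- (z ^ 3))) - cubic_disc (mtrace0 (z ^ 3)) (mtrace0 (- (z ^ 3))))
    \<le> 7000 * (576 * d) * (exp (growth z) * exp (growth (- z)))\<^sup>2"
    unfolding minus_cube[of z] using potD(5)[OF p]
    by (intro cubic_disc_perturbation t t' x xy) auto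
  then show ?thesis
    using rho_eq_disc3[OF sp, of "z ^ 3"] rho_eq_disc3[OF smallpot_0, of "z ^ 3"]
    by (simp add: growth2_def exp_add)
qed

lemma scale_minus: "scale (- z) = scale z"
  by (simp add: scale_def)

text \<open>Each of the two products has total weight three, hence \<open>scale z ^ 3\<close>.
  Splitting \<open>a * b - a' * b'\<close> costs \<open>2 * 8 * 192 = 3072\<close> for each of
  them.\<close>

lemma dir_det_estimate:
  assumes p: "pot d p q" and d: "d \<le> 1/48"
  shows "cmod (dir_det p q (z ^ 3) - dir_det0 (z ^ 3)) * scale z ^ 3 \<le> 6144 * d * exp (growth2 z)"
proof -
  have one: "(1::real) \<in> {0..2}" by simp
  have s: "scale z > 0" using scale_ge(3) .
  let ?x = "exp (growth z)" and ?y = "exp (growth (- z))"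
  define n1 where "n1 = phi p q (z ^ 3) I2 I1 1 * scale z"
  define n2 where "n2 = phi p q (z ^ 3) I3 I1 1 * scale z ^ 2"
  define b1 where "b1 = phi p (\<lambda>x. - q x) ((- z) ^ 3) I3 I1 1 * scale z ^ 2"
  define b2 where "b2 = phi p (\<lambda>x. - q x) ((- z) ^ 3) I3 I2 1 * scale z"
  define n1' where "n1' = phi0 z I1 I2 1 * scale z"
  define n2' where "n2' = phi0 z I1 I3 1 * scale z ^ 2"
  define b1' where "b1' = phi0 (- z) I1 I3 1 * scale z ^ 2"
  define b2' where "b2' = phi0 (- z) I2 I3 1 * scale z"
  note E = phi_estimate[OF p d one] phi_estimate[OF pot_uminus[OF p] d one]
  note F = phi_estimate(1)[OF smallpot_0 order_refl one, unfolded phi_free[OF one]]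
  have n: "cmod n1 \<le> 8 * ?x" "cmod n2 \<le> 8 * ?x"
    using E(1)[of z I2 I1] E(1)[of z I3 I1] s
    by (simp_all add: n1_def n2_def weight_def norm_mult norm_power)
  have nd: "cmod (n1 - n1') \<le> 192 * d * ?x" "cmod (n2 - n2') \<le> 192 * d * ?x"
    using E(2)[of z I2 I1] E(2)[of z I3 I1] s
    by (simp_all add: n1_def n2_def n1'_def n2'_def weight_def norm_mult norm_power flip: left_diff_distrib)
  have b': "cmod b1' \<le> 8 * ?y" "cmod b2' \<le> 8 * ?y"
    using F[of "- z" I1 I3] F[of "- z" I2 I3] s
    by (simp_all add: b1'_def b2'_def weight_def norm_mult norm_power scale_minus power2_eq_square mult.assoc[symmetric])
  have bd: "cmod (b1 - b1') \<le> 192 * d * ?y" "cmod (b2 - b2') \<le> 192 * d * ?y"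
    using E(4)[of "- z" I3 I1] E(4)[of "- z" I3 I2] s
    by (simp_all add: b1_def b2_def b1'_def b2'_def weight_def norm_mult norm_power scale_minus power2_eq_square mult.assoc[symmetric]
        flip: left_diff_distrib)
  have D: "(dir_det p q (z ^ 3) - dir_det0 (z ^ 3)) * scale z ^ 3 = (n1 * b1 - n1' * b1') + (n2 * b2 - n2' * b2')"
    unfolding dir_det_def minus_cube n1_def n2_def b1_def b2_def n1'_def n2'_def b1'_def b2'_def
    using phi_free[OF one, of z] phi_free[OF one, of "- z"]
    by (simp add: power2_eq_square power3_eq_cube algebra_simps)
  have m: "cmod (a * b) \<le> K * L" if "cmod a \<le> K" "cmod b \<le> L" for a b :: complex and K L
    unfolding norm_mult using that by (intro mult_mono) (auto intro: order_trans[OF norm_ge_zero])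
  have prod: "cmod (a * b - a' * b') \<le> 3072 * d * (?x * ?y)"
    if "cmod a \<le> 8 * ?x" "cmod (a - a') \<le> 192 * d * ?x" "cmod b' \<le> 8 * ?y" "cmod (b - b') \<le> 192 * d * ?y" for a b a' b' :: complex
  proof -
    have "a * b - a' * b' = a * (b - b') + (a - a') * b'" by (simp add: algebra_simps)
    then have "cmod (a * b - a' * b') \<le> cmod (a * (b - b')) + cmod ((a - a') * b')"
      by (metis norm_triangle_ineq)
    also have "\<dots> \<le> (8 * ?x) * (192 * d * ?y) + (192 * d * ?x) * (8 * ?y)"
      by (intro add_mono m that)
    finally show ?thesis by (simp add: algebra_simps)
  qed
  have "cmod ((dir_det p q (z ^ 3) - dir_det0 (z ^ 3)) * scale z ^ 3) \<le> 3072 * d * (?x * ?y) + 3072 * d * (?x * ?y)"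
    unfolding D by (intro order_trans[OF norm_triangle_ineq] add_mono prod n nd b' bd)
  then show ?thesis using s by (simp add: norm_mult norm_power growth2_def exp_add)
qed

text \<open>The cube root of the first free eigenvalue has modulus \<open>2 * pi / sqrt 3\<close>,
  well beyond the radius \<open>2 / sqrt 3\<close>; the origin is settled by
  \<open>dir_det0 0 = 1\<close>.\<close>

lemma dir_det0_nonzero:
  assumes "cmod lam \<le> (2 / sqrt 3) ^ 3"
  shows "dir_det0 lam \<noteq> 0"
proof (cases "lam = 0")
  case False
  define z where "z = cbrt lam"
  have z: "z ^ 3 = lam" by (simp add: z_def cbrt_cube)
  have "cmod z ^ 3 \<le> (2 / sqrt 3) ^ 3" using assms z by (simp flip: norm_power)
  then have z2: "cmod z \<le> 2 / sqrt 3" using power_le_imp_le_base[of "cmod z" 2 "2 / sqrt 3"] by (simp add: numeral_3_eq_3)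
  have "vdm z \<noteq> 0"
  proof
    assume "vdm z = 0"
    then obtain k :: int and w where w: "w \<in> {z, omega * z, omega\<^sup>2 * z}" "w = of_real (2 * pi * k / sqrt 3)"
      unfolding vdm_eq_0_iff by blast
    have wz: "cmod w = cmod z" using w(1) by (auto simp: norm_mult norm_omega)
    have "cmod w = 2 * pi * \<bar>of_int k\<bar> / sqrt 3"
      unfolding w(2) norm_of_real by (simp add: abs_mult)
    then have "2 * pi * \<bar>of_int k\<bar> / sqrt 3 \<le> 2 / sqrt 3" using wz z2 by simp
    then have "pi * \<bar>real_of_int k\<bar> \<le> 1" by (simp add: divide_le_cancel)
    moreover have "k \<noteq> 0" using w(2) wz False z by auto
    then have "pi * 1 \<le> pi * \<bar>real_of_int k\<bar>" by (intro mult_left_mono) auto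
    ultimately show False using pi_gt3 by linarith
  qed
  then have "(omega\<^sup>2 - omega) * vdm z \<noteq> 0" using norm_omega_diff by force
  then show ?thesis using dir_det0_cube[of z] z by auto
qed (simp add: dir_det0_0)

lemma separated_norm_ge: "separated z \<Longrightarrow> 1 \<le> cmod z"
  unfolding separated_def by (auto dest!: spec[of _ 0])

text \<open>At separated points the lower bound for \<open>vdm\<close> controls both functions. In
  the disc around \<open>0\<close>, where \<open>vdm\<close> vanishes at the origin although
  \<open>dir_det0\<close> does not, a minimum over the compact disc takes its place. The cap
  \<open>1/50000\<close> serves the numerical estimates at real eigenvalues.\<close>

lemma perturbation_bounds:
  "\<exists>d>0. d \<le> 1/50000 \<and> (\<forall>p q. pot d p q \<longrightarrow>
     (\<forall>z. separated z \<longrightarrow> cmod (rho p q (z ^ 3) - rho0 (z ^ 3)) < cmod (rho0 (z ^ 3)) \<and>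
        cmod (dir_det p q (z ^ 3) - dir_det0 (z ^ 3)) < cmod (dir_det0 (z ^ 3))) \<and>
     (\<forall>lam. cmod lam \<le> (2 / sqrt 3) ^ 3 \<longrightarrow> cmod (dir_det p q lam - dir_det0 lam) < cmod (dir_det0 lam)))"
proof -
  obtain c where c: "c > 0" "\<And>z. separated z \<Longrightarrow> c * exp (growth2 z) \<le> cmod (vdm z)"
    using vdm_lower by blast
  have "continuous_on (cball 0 ((2 / sqrt 3) ^ 3)) (\<lambda>lam. cmod (dir_det0 lam))"
    using holomorphic_on_imp_continuous_on[OF dir_det_holomorphic[OF smallpot_0]] by (intro continuous_intros)
  then obtain l0 where l0: "cmod l0 \<le> (2 / sqrt 3) ^ 3"
    "\<And>lam. cmod lam \<le> (2 / sqrt 3) ^ 3 \<Longrightarrow> cmod (dir_det0 l0) \<le> cmod (dir_det0 lam)"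
    using continuous_attains_inf[OF compact_cball, of 0 "(2 / sqrt 3) ^ 3" "\<lambda>lam. cmod (dir_det0 lam)"] by auto
  define c0 where "c0 = cmod (dir_det0 l0)"
  have c0: "c0 > 0" using dir_det0_nonzero[OF l0(1)] by (simp add: c0_def)
  \<comment> \<open>The constants of \<open>rho_estimate\<close> and \<open>dir_det_estimate\<close>
    with room for strict inequality: \<open>8064000 = 2 * 7000 * 576\<close>,
    \<open>61440 = 10 * 6144\<close> against the factor \<open>9\<close> in
    \<open>dir_det0_cube\<close>, and \<open>12288 = 2 * 6144\<close>.\<close>
  define d where "d = min (1/50000) (min (c\<^sup>2 / 8064000) (min (c / 61440) (c0 / (12288 * exp 4))))"
  have dpos: "d > 0" using c c0 by (simp add: d_def)
  have "d \<le> c\<^sup>2 / 8064000" "d \<le> c / 61440" "d \<le> c0 / (12288 * exp 4)" and d1: "d \<le> 1/50000"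
    by (simp_all add: d_def)
  then have d2: "d * 8064000 \<le> c\<^sup>2" and d3: "d * 61440 \<le> c" and d4: "d * (12288 * exp 4) \<le> c0"
    by (simp_all add: field_simps)
  have d48: "d \<le> 1/48" using d1 by simp
  show ?thesis
  proof (intro exI[of _ d] conjI allI impI dpos d1)
    fix p q z assume p: "pot d p q" and z: "separated z"
    have E: "exp (growth2 z) > 0" by simp
    have "cmod (rho p q (z ^ 3) - rho0 (z ^ 3)) \<le> 7000 * (576 * d) * exp (growth2 z) ^ 2"
      by (rule rho_estimate[OF p d48])
    also have "\<dots> < (d * 8064000) * exp (growth2 z) ^ 2"
      using dpos by (intro mult_strict_right_mono) auto
    also have "\<dots> \<le> c\<^sup>2 * exp (growth2 z) ^ 2" using d2 by (intro mult_right_mono) auto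
    also have "\<dots> = (c * exp (growth2 z))\<^sup>2" by (simp add: power_mult_distrib)
    also have "\<dots> \<le> cmod (vdm z) ^ 2" using c z by (intro power_mono) auto
    also have "\<dots> = cmod (rho0 (z ^ 3))" by (simp add: rho0_cube norm_power)
    finally show "cmod (rho p q (z ^ 3) - rho0 (z ^ 3)) < cmod (rho0 (z ^ 3))" .
    have z1: "1 \<le> cmod z" using separated_norm_ge[OF z] .
    then have sz: "scale z = cmod z" by (simp add: scale_def)
    have s3: "1 \<le> sqrt 3" by simp
    have "9 * cmod z ^ 3 * cmod (dir_det p q (z ^ 3) - dir_det0 (z ^ 3)) \<le> 9 * (6144 * d * exp (growth2 z))"
      using dir_det_estimate[OF p d48, of z] unfolding sz by (simp add: mult_ac)
    also have "\<dots> < (d * 61440) * exp (growth2 z)" using dpos by simp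
    also have "\<dots> \<le> c * exp (growth2 z)" using d3 by (intro mult_right_mono) auto
    also have "\<dots> \<le> cmod (vdm z)" using c(2)[OF z] .
    also have "\<dots> \<le> sqrt 3 * cmod (vdm z)" using mult_right_mono[OF s3, of "cmod (vdm z)"] by simp
    also have "\<dots> = cmod (9 * z ^ 3 * dir_det0 (z ^ 3))"
      unfolding dir_det0_cube norm_mult norm_omega_diff by simp
    also have "\<dots> = 9 * cmod z ^ 3 * cmod (dir_det0 (z ^ 3))" by (simp add: norm_mult norm_power)
    finally have "9 * cmod z ^ 3 * cmod (dir_det p q (z ^ 3) - dir_det0 (z ^ 3)) < 9 * cmod z ^ 3 * cmod (dir_det0 (z ^ 3))" .
    then show "cmod (dir_det p q (z ^ 3) - dir_det0 (z ^ 3)) < cmod (dir_det0 (z ^ 3))"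
      by (rule mult_less_cancel_left_pos[THEN iffD1, rotated]) (use z1 in auto)
  next
    fix p q lam assume p: "pot d p q" and lam: "cmod lam \<le> (2 / sqrt 3) ^ 3"
    define z where "z = cbrt lam"
    have z: "z ^ 3 = lam" by (simp add: z_def cbrt_cube)
    have "cmod z ^ 3 \<le> (2 / sqrt 3) ^ 3" using lam z by (simp flip: norm_power)
    then have z2: "cmod z \<le> 2 / sqrt 3" using power_le_imp_le_base[of "cmod z" 2 "2 / sqrt 3"] by (simp add: numeral_3_eq_3)
    have "2 / sqrt 3 \<le> 2 / 1" by (intro divide_left_mono) auto
    then have "growth2 z \<le> 4" using growth_le_norm[of z] growth_le_norm[of "- z"] z2 unfolding growth2_def by simp
    then have e4: "exp (growth2 z) \<le> exp 4" by simp
    have "cmod (dir_det p q lam - dir_det0 lam) * 1 \<le> cmod (dir_det p q lam - dir_det0 lam) * scale z ^ 3"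
      using scale_ge(1)[of z] by (intro mult_left_mono one_le_power) auto
    also have "\<dots> \<le> 6144 * d * exp (growth2 z)"
      using dir_det_estimate[OF p d48, of z] z by simp
    also have "\<dots> \<le> 6144 * d * exp 4" using e4 dpos by (intro mult_left_mono) auto
    also have "\<dots> < d * (12288 * exp 4)" using dpos by simp
    also have "\<dots> \<le> c0" by (rule d4)
    also have "\<dots> \<le> cmod (dir_det0 lam)" using l0(2)[OF lam] by (simp add: c0_def)
    finally show "cmod (dir_det p q lam - dir_det0 lam) < cmod (dir_det0 lam)" by simp
  qed
qed

section \<open>Zero counting and the geometry of the discs\<close>

lemma entire_finite_zeros:
  assumes "f holomorphic_on UNIV" "f w \<noteq> 0" "compact K"
  shows "finite {z \<in> K. f z = 0}"
proof (cases "f constant_on UNIV")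
  case True
  then obtain c where c: "\<And>x. f x = c" unfolding constant_on_def by blast
  then show ?thesis using assms(2) by simp
qed (use holomorphic_compact_finite_zeros[of f UNIV K] assms in auto)

lemma Rouche_theorem_ball:
  assumes f: "f holomorphic_on UNIV" and g: "g holomorphic_on UNIV" and r: "0 < r"
    and less: "\<And>z. cmod (z - a) = r \<Longrightarrow> cmod (g z) < cmod (f z)"
  shows "(\<Sum>z\<in>{z\<in>ball a r. f z + g z = 0}. zorder (\<lambda>z. f z + g z) z) = (\<Sum>z\<in>{z\<in>ball a r. f z = 0}. zorder f z)"
proof -
  let ?S = "ball a (r + 1)"
  have w: "cmod ((a + of_real r) - a) = r" using r by simp
  have nz: "f (a + of_real r) \<noteq> 0" using less[OF w] by auto
  have nz': "f (a + of_real r) + g (a + of_real r) \<noteq> 0"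
    using less[OF w] by (metis add_eq_0_iff norm_minus_cancel order_less_irrefl)
  have fin: "finite {z \<in> ?S. f z = 0}" "finite {z \<in> ?S. f z + g z = 0}"
    using finite_subset[OF _ entire_finite_zeros[OF f nz compact_cball[of a "r + 1"]], of "{z \<in> ?S. f z = 0}"]
      finite_subset[OF _ entire_finite_zeros[OF holomorphic_on_add[OF f g] nz' compact_cball[of a "r + 1"]], of "{z \<in> ?S. f z + g z = 0}"]
    by (auto simp: subset_eq)
  have out: "winding_number (circlepath a r) z = 0" if "z \<notin> cball a r" for z
    by (rule winding_number_zero_outside[OF _ convex_cball[of a r]]) (use that r in auto)
  have R: "(\<Sum>p\<in>{p \<in> ?S. f p + g p = 0}. winding_number (circlepath a r) p * of_int (zorder (\<lambda>p. f p + g p) p)) =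
     (\<Sum>p\<in>{p \<in> ?S. f p = 0}. winding_number (circlepath a r) p * of_int (zorder f p))"
  proof (rule Rouche_theorem)
    show "f holomorphic_on ?S" "g holomorphic_on ?S" using f g holomorphic_on_subset by blast+
    show "\<forall>z\<in>path_image (circlepath a r). cmod (g z) < cmod (f z)"
      using less r by (auto simp: sphere_def dist_norm norm_minus_commute)
    show "\<forall>z. z \<notin> ?S \<longrightarrow> winding_number (circlepath a r) z = 0"
      using out by auto
  qed (use fin r in \<open>auto simp: sphere_def\<close>)
  have S: "(\<Sum>p\<in>{p \<in> ?S. h p = 0}. winding_number (circlepath a r) p * of_int (zorder h p)) =
      of_int (\<Sum>z\<in>{z\<in>ball a r. h z = 0}. zorder h z)"
    if h: "\<And>z. cmod (z - a) = r \<Longrightarrow> h z \<noteq> 0" and fi: "finite {p \<in> ?S. h p = 0}" for h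
  proof -
    have "(\<Sum>p\<in>{p \<in> ?S. h p = 0}. winding_number (circlepath a r) p * of_int (zorder h p)) =
       (\<Sum>p\<in>{z\<in>ball a r. h z = 0}. winding_number (circlepath a r) p * of_int (zorder h p))"
    proof (rule sum.mono_neutral_right[OF fi])
      show "\<forall>i\<in>{p \<in> ?S. h p = 0} - {z\<in>ball a r. h z = 0}. winding_number (circlepath a r) i * of_int (zorder h i) = 0"
      proof
        fix i assume i: "i \<in> {p \<in> ?S. h p = 0} - {z\<in>ball a r. h z = 0}"
        then have "cmod (i - a) \<noteq> r" using h[of i] by auto
        then have "i \<notin> cball a r" using i by (auto simp: dist_norm norm_minus_commute)
        then show "winding_number (circlepath a r) i * of_int (zorder h i) = 0" using out by simp
      qed
    qed auto
    also have "\<dots> = (\<Sum>p\<in>{z\<in>ball a r. h z = 0}. of_int (zorder h p))"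
      by (intro sum.cong refl) (simp add: winding_number_circlepath dist_norm norm_minus_commute)
    finally show ?thesis by simp
  qed
  have nf: "f z \<noteq> 0" if "cmod (z - a) = r" for z using less[OF that] by auto
  have nfg: "f z + g z \<noteq> 0" if "cmod (z - a) = r" for z
    using less[OF that] by (metis add_eq_0_iff norm_minus_cancel order_less_irrefl)
  have "complex_of_int (\<Sum>z\<in>{z\<in>ball a r. f z + g z = 0}. zorder (\<lambda>z. f z + g z) z) = of_int (\<Sum>z\<in>{z\<in>ball a r. f z = 0}. zorder f z)"
    using R S[of f, OF nf fin(1)] S[of "\<lambda>z. f z + g z", OF nfg fin(2)] by simp
  then show ?thesis
    by (simp only: of_int_eq_iff)
qed

lemma entire_eventually_nonzero:
  assumes "f holomorphic_on UNIV" "f w \<noteq> 0"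
  shows "eventually (\<lambda>u. f u \<noteq> 0) (at z)"
  using non_zero_neighbour_alt[OF assms(1) open_UNIV connected_UNIV _ _ assms(2), of z] by simp

lemma entire_frequently_nonzero:
  assumes "f holomorphic_on UNIV" "f w \<noteq> 0"
  shows "frequently (\<lambda>u. f u \<noteq> 0) (at z)"
  using entire_eventually_nonzero[OF assms] eventually_frequently trivial_limit_at by blast

lemma entire_zorder_pos:
  assumes "f holomorphic_on UNIV" "f w \<noteq> 0" "f z = 0"
  shows "zorder f z > 0"
  using zorder_pos_iff[OF assms(1) open_UNIV _ entire_frequently_nonzero[OF assms(1,2)]] assms(3) by simp

text \<open>Away from \<open>0\<close> cubing is locally biholomorphic, so multiplicities may be
  counted in the cube-root variable.\<close>

lemma zorder_cube:
  assumes f: "f holomorphic_on UNIV" "f w \<noteq> 0" and z: "z \<noteq> 0"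
  shows "zorder (\<lambda>z. f (z ^ 3)) z = zorder f (z ^ 3)"
proof -
  have an: "f analytic_on {z ^ 3}"
    using f(1) analytic_on_holomorphic by blast
  have hol: "(\<lambda>x. x ^ 3 - z ^ 3) holomorphic_on UNIV" by (intro holomorphic_intros)
  have "zorder (f \<circ> (\<lambda>z. z ^ 3)) z = zorder f (z ^ 3) * zorder (\<lambda>x. x ^ 3 - z ^ 3) z"
  proof (rule zorder_compose')
    show "isolated_singularity_at f (z ^ 3)" by (rule isolated_singularity_at_analytic[OF an])
    show "not_essential f (z ^ 3)" by (rule not_essential_analytic[OF an])
    show "(\<lambda>z. z ^ 3) analytic_on {z}" by (intro analytic_intros)
    show "\<forall>\<^sub>F w in at (z ^ 3). f w \<noteq> 0" by (rule entire_eventually_nonzero[OF f])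
    have "\<forall>\<^sub>F u in at z. u ^ 3 - z ^ 3 \<noteq> 0"
      by (rule entire_eventually_nonzero[OF hol, of 0]) (use z in auto)
    then show "\<forall>\<^sub>F w in at z. w ^ 3 \<noteq> z ^ 3" by simp
  qed
  also have "zorder (\<lambda>x. x ^ 3 - z ^ 3) z = 1"
  proof (rule zorder_zero_eqI[OF hol])
    have "deriv (\<lambda>x. x ^ 3 - z ^ 3) z = 3 * z\<^sup>2"
      by (rule DERIV_imp_deriv) (auto intro!: derivative_eq_intros)
    then show "(deriv ^^ nat 1) (\<lambda>x. x ^ 3 - z ^ 3) z \<noteq> 0" using z by simp
  qed auto
  finally show ?thesis by (simp add: o_def)
qed

lemma entire_simple_zero_deriv:
  assumes "f holomorphic_on UNIV" "f w \<noteq> 0" "f z = 0" "zorder f z = 1"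
  shows "deriv f z \<noteq> 0"
proof
  assume d: "deriv f z = 0"
  have fr: "frequently (\<lambda>u. f u \<noteq> 0) (at z)" by (rule entire_frequently_nonzero[OF assms(1,2)])
  obtain r where r: "zorder f z = of_nat 1" "0 < r" "cball z r \<subseteq> UNIV" 
     "zor_poly f z holomorphic_on cball z r" "\<forall>u\<in>cball z r. f u = zor_poly f z u * (u - z) ^ 1 \<and> zor_poly f z u \<noteq> 0"
    using zorder_exist_zero[OF assms(1) open_UNIV connected_UNIV, of z] assms by auto
  let ?P = "zor_poly f z"
  have "?P holomorphic_on ball z r" using r(4) holomorphic_on_subset ball_subset_cball by blast
  then have P: "(?P has_field_derivative deriv ?P z) (at z)"
    using r(2) by (intro holomorphic_derivI[of _ "ball z r"]) auto
  have "((\<lambda>u. ?P u * (u - z)) has_field_derivative ?P z) (at z)"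
    by (auto intro!: derivative_eq_intros P)
  then have "(f has_field_derivative ?P z) (at z)"
  proof (rule has_field_derivative_transform_within[OF _ r(2)])
    show "?P u * (u - z) = f u" if "dist u z < r" for u
      using r(5) that by (auto simp: dist_commute)
  qed auto
  then have "deriv f z = ?P z" by (rule DERIV_imp_deriv)
  then show False using d r(2,5) by auto
qed

lemma sum_pos_eq_1:
  fixes f :: "'a \<Rightarrow> int"
  assumes "finite S" "\<And>x. x \<in> S \<Longrightarrow> f x > 0" "sum f S = 1"
  obtains a where "S = {a}" "f a = 1"
proof -
  have "S \<noteq> {}" using assms(3) by auto
  then obtain a where a: "a \<in> S" by blast
  have s: "sum f S = f a + sum f (S - {a})" by (rule sum.remove[OF assms(1) a])
  have "sum f (S - {a}) \<ge> of_nat (card (S - {a})) * 1"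
    by (rule sum_bounded_below) (use assms(2) in force)
  moreover have "f a \<ge> 1" using assms(2)[OF a] by simp
  ultimately have "int (card (S - {a})) \<le> 0" using s assms(3) by simp
  then have "S - {a} = {}" using assms(1) by simp
  then have "S = {a}" using a by blast
  then show ?thesis using that assms(3) by auto
qed

lemma sum_pos_eq_2:
  fixes f :: "'a \<Rightarrow> int"
  assumes "finite S" "\<And>x. x \<in> S \<Longrightarrow> f x > 0" "sum f S = 2"
  obtains a where "S = {a}" "f a = 2" | a b where "S = {a, b}" "a \<noteq> b" "f a = 1" "f b = 1"
proof -
  have "S \<noteq> {}" using assms(3) by auto
  then obtain a where a: "a \<in> S" by blast
  have s: "sum f S = f a + sum f (S - {a})" by (rule sum.remove[OF assms(1) a])
  show ?thesis
  proof (cases "S = {a}")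
    case True
    then show ?thesis using that(1) assms(3) by auto
  next
    case False
    then obtain b where b: "b \<in> S - {a}" using a by blast
    have s': "sum f (S - {a}) = f b + sum f (S - {a} - {b})" by (rule sum.remove) (use assms b in auto)
    have nn: "sum f (S - {a} - {b}) \<ge> of_nat (card (S - {a} - {b})) * 1"
      by (rule sum_bounded_below) (use assms(2) in force)
    have "f a \<ge> 1" "f b \<ge> 1" using assms(2) a b by force+
    then have "f a = 1" "f b = 1" "int (card (S - {a} - {b})) \<le> 0" using s s' nn assms(3) by linarith+
    moreover from this have "S - {a} - {b} = {}" using assms(1) by simp
    then have "S = {a, b}" using a b by blast
    ultimately show ?thesis using that(2)[of a b] b by auto
  qed
qed

section \<open>Cube roots, sectors and the discs in the cube-root variable\<close>

lemma cube_eq_cases: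
  fixes u z :: complex
  assumes "u ^ 3 = z ^ 3"
  shows "u = z \<or> u = omega * z \<or> u = omega\<^sup>2 * z"
proof -
  have "(u - z) * (u - omega * z) * (u - omega\<^sup>2 * z) = 0"
    using assms omega_cube omega_sum by algebra
  then show ?thesis by simp
qed

text \<open>The argument of \<open>cbrt lam\<close> is at most \<open>pi / 3\<close> in modulus, and
  \<open>tan (pi / 3) = sqrt 3\<close>.\<close>

lemma cbrt_sector:
  assumes "lam \<noteq> 0"
  shows "0 < Re (cbrt lam)" "\<bar>Im (cbrt lam)\<bar> \<le> sqrt 3 * Re (cbrt lam)"
proof -
  define t where "t = Im (Ln lam) / 3"
  define r where "r = exp (Re (Ln lam) / 3)"
  have t: "\<bar>t\<bar> \<le> pi / 3"
    using mpi_less_Im_Ln[OF assms] Im_Ln_le_pi[OF assms] unfolding t_def by linarith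
  have c: "Re (cbrt lam) = r * cos t" "Im (cbrt lam) = r * sin t"
    using assms by (simp_all add: cbrt_def Re_exp Im_exp t_def r_def)
  have "cos (pi / 3) \<le> cos \<bar>t\<bar>" using t by (intro cos_monotone_0_pi_le) auto
  then have ct: "1 / 2 \<le> cos t" by (simp add: cos_60)
  have r: "r > 0" by (simp add: r_def)
  show "0 < Re (cbrt lam)" unfolding c using r ct by simp
  have "(1/2)\<^sup>2 \<le> (cos t)\<^sup>2" using ct by (intro power_mono) auto
  then have "(sin t)\<^sup>2 \<le> 3 * (cos t)\<^sup>2"
    using sin_cos_squared_add[of t] by (simp add: power2_eq_square)
  also have "\<dots> = (sqrt 3 * cos t)\<^sup>2" by (simp add: power_mult_distrib)
  finally have "\<bar>sin t\<bar> \<le> sqrt 3 * cos t"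
    using ct unfolding abs_le_square_iff[symmetric] by simp
  then show "\<bar>Im (cbrt lam)\<bar> \<le> sqrt 3 * Re (cbrt lam)"
    unfolding c using mult_left_mono[of "\<bar>sin t\<bar>" "sqrt 3 * cos t" r] r by (simp add: abs_mult mult_ac)
qed

text \<open>The strict inequality excludes the boundary rays, where the branch matters; in the open
  sector the two rotated cube roots violate \<open>cbrt_sector\<close>.\<close>

lemma cbrt_cube_sector:
  assumes "0 < Re z" "\<bar>Im z\<bar> < sqrt 3 * Re z"
  shows "cbrt (z ^ 3) = z"
proof -
  have z: "z ^ 3 \<noteq> 0" using assms(1) by auto
  define u where "u = cbrt (z ^ 3)"
  have u: "u ^ 3 = z ^ 3" by (simp add: u_def cbrt_cube)
  have s: "0 < Re u" "\<bar>Im u\<bar> \<le> sqrt 3 * Re u"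
    using cbrt_sector[OF z] by (simp_all add: u_def)
  have r3: "sqrt 3 * (sqrt 3 * x) = 3 * x" for x :: real
    by (simp flip: mult.assoc)
  from cube_eq_cases[OF u] have "u = z"
  proof (elim disjE)
    assume e: "u = omega * z"
    have "sqrt 3 / 2 * Re z - Im z / 2 \<le> sqrt 3 * (- Re z / 2 - sqrt 3 / 2 * Im z)"
      using s(2) unfolding e Re_omega by linarith
    then have "sqrt 3 / 2 * Re z - Im z / 2 \<le> - (sqrt 3 * Re z / 2) - 3 / 2 * Im z"
      using r3[of "Im z"] by (simp add: algebra_simps)
    then show ?thesis using assms(2) by linarith
  next
    assume e: "u = omega\<^sup>2 * z"
    have "sqrt 3 / 2 * Re z + Im z / 2 \<le> sqrt 3 * (- Re z / 2 + sqrt 3 / 2 * Im z)"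
      using s(2) unfolding e Re_omega by linarith
    then have "sqrt 3 / 2 * Re z + Im z / 2 \<le> - (sqrt 3 * Re z / 2) + 3 / 2 * Im z"
      using r3[of "Im z"] by (simp add: algebra_simps)
    then show ?thesis using assms(2) by linarith
  qed
  then show ?thesis by (simp add: u_def)
qed

definition ctr :: "int \<Rightarrow> real" where "ctr n = 2 * pi * n / sqrt 3"

lemma sqrt3_bounds: "1 < sqrt 3" "sqrt 3 < 1.7321" "sqrt 3 < 2"
proof -
  have "sqrt 3 < sqrt ((1.7321)\<^sup>2)"
    by (intro real_sqrt_less_mono) (simp add: power2_eq_square)
  then show "sqrt 3 < 1.7321" by simp
  show "sqrt 3 < 2" using real_sqrt_less_mono[of 3 4] by simp
qed simp

lemma ctr_diff: "sqrt 3 * ctr n = 2 * pi * n"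
  by (simp add: ctr_def)

lemma Dn_nonneg: "0 \<le> n \<Longrightarrow> Dn n = {lam. cmod (cbrt lam - of_real (ctr n)) < 2 / sqrt 3}"
  by (simp add: Dn_def ctr_def)

lemma Dn_uminus: "n \<noteq> 0 \<Longrightarrow> Dn (- n) = uminus ` Dn n"
proof -
  have *: "Dn (- n) = uminus ` Dn n" if "n > 0" for n
  proof (intro equalityI subsetI)
    fix lam assume "lam \<in> Dn (- n)"
    then have "- lam \<in> Dn n" using that by (simp add: Dn_def)
    then show "lam \<in> uminus ` Dn n" by (intro image_eqI[of _ _ "- lam"]) auto
  next
    fix lam assume "lam \<in> uminus ` Dn n"
    then show "lam \<in> Dn (- n)" using that by (auto simp: Dn_def)
  qed
  assume "n \<noteq> 0"
  then show ?thesis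
  proof (cases "n > 0")
    case False
    then have "Dn n = uminus ` Dn (- n)" using *[of "- n"] \<open>n \<noteq> 0\<close> by simp
    then show ?thesis by (simp add: image_image)
  qed (use * in auto)
qed

text \<open>\<open>sqrt 3 * Re z >= 2 * pi - 2 >= 4\<close> and \<open>4 / 1.7321 > 2.3\<close>;
  this threshold is the one of \<open>exp_large\<close>. The rotated cube roots stay at distance
  \<open>1\<close> from the real axis, hence from all free zeros.\<close>

lemma cball_ctr:
  assumes n: "1 \<le> n" and z: "cmod (z - of_real (ctr n)) \<le> 2 / sqrt 3"
  shows "2.3 \<le> Re z" "\<bar>Im z\<bar> < sqrt 3 * Re z" "1 \<le> \<bar>Im (omega * z)\<bar>" "1 \<le> \<bar>Im (omega\<^sup>2 * z)\<bar>" "z \<noteq> 0"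
proof -
  have "\<bar>Re z - ctr n\<bar> \<le> 2 / sqrt 3" "\<bar>Im z\<bar> \<le> 2 / sqrt 3"
    using order_trans[OF abs_Re_le_cmod z] order_trans[OF abs_Im_le_cmod z] by simp_all
  then have "sqrt 3 * \<bar>Re z - ctr n\<bar> \<le> 2" and i: "sqrt 3 * \<bar>Im z\<bar> \<le> 2"
    by (simp_all add: field_simps)
  then have "\<bar>sqrt 3 * (Re z - ctr n)\<bar> \<le> 2"
    by (simp add: abs_mult)
  then have r: "\<bar>sqrt 3 * Re z - 2 * pi * n\<bar> \<le> 2"
    unfolding right_diff_distrib ctr_diff .
  have "2 * pi * 1 \<le> 2 * pi * n" using n by (intro mult_left_mono) auto
  then have r4: "4 \<le> sqrt 3 * Re z" using r pi_gt3 by linarith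
  have i2: "\<bar>Im z\<bar> \<le> 2" using mult_right_mono[OF less_imp_le[OF sqrt3_bounds(1)], of "\<bar>Im z\<bar>"] i by simp
  show "2.3 \<le> Re z"
  proof (rule ccontr)
    assume "\<not> 2.3 \<le> Re z"
    then have "sqrt 3 * Re z \<le> sqrt 3 * 2.3" by (intro mult_left_mono) auto
    also have "sqrt 3 * 2.3 < 1.7321 * 2.3" using sqrt3_bounds(2) by (intro mult_strict_right_mono) auto
    finally show False using r4 by simp
  qed
  then show "z \<noteq> 0" by auto
  show "\<bar>Im z\<bar> < sqrt 3 * Re z" using r4 i2 by linarith
  have "Im z \<le> 2" "- Im z \<le> 2" using i2 by linarith+
  then have "1 \<le> sqrt 3 / 2 * Re z - Im z / 2" "- sqrt 3 / 2 * Re z - Im z / 2 \<le> - 1"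
    using r4 by (simp_all add: field_simps)
  then show "1 \<le> \<bar>Im (omega * z)\<bar>" "1 \<le> \<bar>Im (omega\<^sup>2 * z)\<bar>"
    unfolding Re_omega by linarith+
qed

text \<open>The ball lies in the open sector where \<open>cbrt\<close> inverts cubing, so all
  counting for \<open>n >= 1\<close> can be done on a round disc in the cube-root variable.\<close>

lemma Dn_pos_image:
  assumes n: "1 \<le> n"
  shows "Dn n = (\<lambda>z. z ^ 3) ` ball (of_real (ctr n)) (2 / sqrt 3)" "inj_on (\<lambda>z. z ^ 3) (ball (complex_of_real (ctr n)) (2 / sqrt 3))"
proof -
  let ?B = "ball (complex_of_real (ctr n)) (2 / sqrt 3)"
  have cb: "cbrt (z ^ 3) = z" if "z \<in> ?B" for z
  proof -
    have "cmod (z - of_real (ctr n)) \<le> 2 / sqrt 3" using that by (simp add: dist_norm norm_minus_commute)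
    from cball_ctr[OF n this] show ?thesis by (intro cbrt_cube_sector) auto
  qed
  show "inj_on (\<lambda>z. z ^ 3) ?B" by (rule inj_on_inverseI[of _ cbrt]) (rule cb)
  show "Dn n = (\<lambda>z. z ^ 3) ` ?B"
  proof (intro equalityI subsetI)
    fix lam assume "lam \<in> Dn n"
    then have "cbrt lam \<in> ?B" using n by (auto simp: Dn_nonneg dist_norm norm_minus_commute)
    then show "lam \<in> (\<lambda>z. z ^ 3) ` ?B" using cbrt_cube[of lam] by (metis imageI)
  next
    fix lam assume "lam \<in> (\<lambda>z. z ^ 3) ` ?B"
    then obtain z where z: "z \<in> ?B" "lam = z ^ 3" by blast
    then show "lam \<in> Dn n" using n cb[OF z(1)] by (auto simp: Dn_nonneg dist_norm norm_minus_commute)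
  qed
qed

lemma Dn_0: "Dn 0 = ball 0 ((2 / sqrt 3) ^ 3)"
proof -
  have e: "cmod lam < (2 / sqrt 3) ^ 3 \<longleftrightarrow> cmod (cbrt lam) < 2 / sqrt 3" for lam
  proof -
    have c: "cmod lam = cmod (cbrt lam) ^ 3" using cbrt_cube[of lam] by (metis norm_power)
    show ?thesis
    proof
      assume "cmod lam < (2 / sqrt 3) ^ 3"
      then show "cmod (cbrt lam) < 2 / sqrt 3"
        unfolding c by (rule power_less_imp_less_base) simp
    next
      assume "cmod (cbrt lam) < 2 / sqrt 3"
      then show "cmod lam < (2 / sqrt 3) ^ 3"
        unfolding c by (intro power_strict_mono) auto
    qed
  qed
  show ?thesis
    unfolding set_eq_iff Dn_nonneg[OF order_refl] mem_Collect_eq mem_ball_0 e by (simp add: ctr_def)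
qed

lemma two_sqrt3: "1 \<le> 2 / sqrt 3"
  using sqrt3_bounds by (simp add: field_simps)

lemma separatedI:
  assumes "\<And>k. 1 \<le> cmod (z - of_real (ctr k))" "\<And>k. 1 \<le> cmod (omega * z - of_real (ctr k))"
    "\<And>k. 1 \<le> cmod (omega\<^sup>2 * z - of_real (ctr k))"
  shows "separated z"
  unfolding separated_def ctr_def[symmetric] using assms by blast

text \<open>Neighbouring centres are \<open>2 * pi / sqrt 3\<close> apart, more than
  \<open>6 / sqrt 3\<close>, so the other free zeros keep distance \<open>4 / sqrt 3\<close> from
  the circle. The rotated roots are settled by their imaginary parts.\<close>

lemma separated_circle:
  assumes n: "1 \<le> n" and z: "cmod (z - of_real (ctr n)) = 2 / sqrt 3"
  shows "separated z"
proof -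
  have z': "cmod (z - of_real (ctr n)) \<le> 2 / sqrt 3" using z by simp
  have I: "1 \<le> cmod (w - of_real x)" if "1 \<le> \<bar>Im w\<bar>" for w x
    using order_trans[OF that] abs_Im_le_cmod[of "w - of_real x"] by simp
  have "1 \<le> cmod (z - of_real (2 * pi * k / sqrt 3))" for k :: int
  proof (cases "k = n")
    case True
    then show ?thesis using z two_sqrt3 unfolding ctr_def by simp
  next
    case False
    have "1 \<le> \<bar>real_of_int (n - k)\<bar>" using False by linarith
    then have "2 * pi * 1 \<le> 2 * pi * \<bar>real_of_int (n - k)\<bar>" by (intro mult_left_mono) auto
    also have "\<dots> = sqrt 3 * \<bar>ctr n - ctr k\<bar>"
    proof -
      have "sqrt 3 * (ctr n - ctr k) = 2 * pi * real_of_int (n - k)" using ctr_diff[of n] ctr_diff[of k] by (simp add: algebra_simps)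
      then have "\<bar>sqrt 3 * (ctr n - ctr k)\<bar> = \<bar>2 * pi * real_of_int (n - k)\<bar>" by simp
      then show ?thesis by (simp add: abs_mult)
    qed
    finally have d: "6 \<le> sqrt 3 * \<bar>ctr n - ctr k\<bar>" using pi_gt3 by linarith
    have "\<bar>ctr n - ctr k\<bar> = cmod ((z - of_real (ctr k)) - (z - of_real (ctr n)))"
      by (simp flip: of_real_diff)
    also have "\<dots> \<le> cmod (z - of_real (ctr k)) + 2 / sqrt 3"
      using norm_triangle_ineq4[of "z - of_real (ctr k)" "z - of_real (ctr n)"] z by simp
    finally have "sqrt 3 * \<bar>ctr n - ctr k\<bar> \<le> sqrt 3 * cmod (z - of_real (ctr k)) + 2"
      by (simp add: field_simps)
    then have "4 \<le> sqrt 3 * cmod (z - of_real (ctr k))" using d by linarith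
    also have "\<dots> \<le> 2 * cmod (z - of_real (ctr k))" using sqrt3_bounds by (intro mult_right_mono) auto
    finally show ?thesis unfolding ctr_def by simp
  qed
  then show ?thesis
    using I[OF cball_ctr(3)[OF n z']] I[OF cball_ctr(4)[OF n z']] by (intro separatedI) (auto simp only: ctr_def)
qed

text \<open>The principal root of \<open>lam\<close> is one cube root, and minus the principal root
  of \<open>- lam\<close> is a second one; these are what the discs of nonnegative and of negative
  index see. The third cube root has imaginary part at least \<open>1\<close> in modulus.\<close>

lemma separated_outside:
  assumes out: "\<And>n. lam \<notin> Dn n"
  shows "separated (cbrt lam)"
proof -
  define z where "z = cbrt lam"
  have l0: "lam \<noteq> 0" using out[of 0] by (auto simp: Dn_0)
  have ml0: "- lam \<noteq> 0" using l0 by simp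
  have z: "0 < Re z" "\<bar>Im z\<bar> \<le> sqrt 3 * Re z" using cbrt_sector[OF l0] by (simp_all add: z_def)
  define w where "w = cbrt (- lam)"
  have w: "0 < Re w" "\<bar>Im w\<bar> \<le> sqrt 3 * Re w" using cbrt_sector[OF ml0] by (simp_all add: w_def)
  have out1: "2 / sqrt 3 \<le> cmod (z - of_real (ctr n))" if "0 \<le> n" for n
    using out[of n] that by (simp add: Dn_nonneg z_def)
  have out2: "2 / sqrt 3 \<le> cmod (w - of_real (ctr n))" if "0 < n" for n
    using out[of "- n"] that by (simp add: Dn_def w_def ctr_def)
  have znorm: "2 / sqrt 3 \<le> cmod z" using out1[of 0] by (simp add: ctr_def)
  have wz: "w ^ 3 = (- z) ^ 3" by (simp add: w_def z_def cbrt_cube)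
  have wn: "cmod w = cmod z"
    using cube_eq_cases[OF wz] by (auto simp: norm_mult norm_omega)
  have far: "1 \<le> cmod (u - of_real (ctr k))" if "0 < Re u" "k < 0" for u and k :: int
  proof -
    have "2 * pi * 1 \<le> 2 * pi * real_of_int (- k)" using that(2) by (intro mult_left_mono) auto
    then have "6 \<le> - (sqrt 3 * ctr k)" unfolding ctr_diff using pi_gt3 by simp
    then have "6 \<le> sqrt 3 * - ctr k" by simp
    moreover have "0 \<le> - ctr k" using that(2) by (simp add: ctr_def field_simps mult_nonneg_nonpos)
    then have "sqrt 3 * - ctr k \<le> 2 * - ctr k" using sqrt3_bounds by (intro mult_right_mono) auto
    ultimately have "1 \<le> Re (u - of_real (ctr k))" using that(1) by simp
    then show ?thesis using complex_Re_le_cmod[of "u - of_real (ctr k)"] by linarith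
  qed
  have g0: "1 \<le> cmod (z - of_real (ctr k))" for k
    using order_trans[OF two_sqrt3 out1[of k]] far[OF z(1), of k] by (cases "0 \<le> k") (blast, linarith)
  have gw: "1 \<le> cmod (- w - of_real (ctr k))" for k
  proof -
    have e: "cmod (- w - of_real (ctr k)) = cmod (w - of_real (ctr (- k)))"
      by (subst norm_minus_cancel[symmetric]) (simp add: ctr_def)
    show ?thesis
    proof (cases k "0 :: int" rule: linorder_cases)
      case less
      then show ?thesis unfolding e using order_trans[OF two_sqrt3 out2[of "- k"]] by simp
    next
      case equal
      then show ?thesis using order_trans[OF two_sqrt3 znorm] wn by (simp add: ctr_def)
    next
      case greater
      then show ?thesis unfolding e using far[OF w(1), of "- k"] by simp
    qed
  qed
  have gi: "1 \<le> cmod (u - of_real x)" if "1 \<le> (Im u)\<^sup>2" for u x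
  proof -
    have "1 \<le> \<bar>Im u\<bar>" using power2_le_imp_le[of 1 "\<bar>Im u\<bar>"] that by simp
    then show ?thesis using abs_Im_le_cmod[of "u - of_real x"] by simp
  qed
  have nz: "4 / 3 \<le> (Re z)\<^sup>2 + (Im z)\<^sup>2"
  proof -
    have "(2 / sqrt 3)\<^sup>2 \<le> (cmod z)\<^sup>2" using znorm by (intro power_mono) auto
    then show ?thesis by (simp add: cmod_power2 power_divide)
  qed
  have s3: "(sqrt 3)\<^sup>2 = (3::real)" by simp
  \<comment> \<open>The radius fits exactly: in the sector the square is at least
    \<open>3/4 * |z|^2\<close>, and \<open>|z| >= 2 / sqrt 3\<close> makes this at least
    \<open>1\<close>.\<close>
  have third: "1 \<le> (sqrt 3 / 2 * Re z + \<bar>Im z\<bar> / 2)\<^sup>2"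
  proof -
    have "\<bar>Im z\<bar> * \<bar>Im z\<bar> \<le> sqrt 3 * Re z * \<bar>Im z\<bar>" using z(2) by (intro mult_right_mono) auto
    then have "3 / 4 * (Re z)\<^sup>2 + 3 / 4 * (Im z)\<^sup>2 \<le> 3 / 4 * (Re z)\<^sup>2 + (Im z)\<^sup>2 / 4 + sqrt 3 / 2 * Re z * \<bar>Im z\<bar>"
      by (simp add: power2_eq_square abs_if mult_ac split: if_splits)
    also have "\<dots> = (sqrt 3 / 2 * Re z + \<bar>Im z\<bar> / 2)\<^sup>2"
      by (simp add: power2_sum power_mult_distrib power_divide algebra_simps)
    finally show ?thesis using nz by linarith
  qed
  have r3: "sqrt 3 * (sqrt 3 * x) = 3 * x" for x :: real
    by (simp flip: mult.assoc)
  consider "w = - z" | "w = - (omega * z)" | "w = - (omega\<^sup>2 * z)"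
    using cube_eq_cases[OF wz] by auto
  then show ?thesis
  proof cases
    case 1
    then show ?thesis using w(1) z(1) by simp
  next
    case 2
    have "sqrt 3 / 2 * Re z - Im z / 2 \<le> sqrt 3 * - (- Re z / 2 - sqrt 3 / 2 * Im z)"
      using w(2) unfolding 2 uminus_complex.sel Re_omega by linarith
    then have "0 \<le> Im z" using r3[of "Im z"] by (simp add: algebra_simps)
    then have "1 \<le> (Im (omega\<^sup>2 * z))\<^sup>2"
      using third unfolding Re_omega by (simp add: power2_eq_square algebra_simps)
    then have "1 \<le> cmod (omega\<^sup>2 * z - of_real (ctr k))" for k by (rule gi)
    moreover have "1 \<le> cmod (omega * z - of_real (ctr k))" for k using gw[of k] unfolding 2 by simp
    ultimately show ?thesis using g0 unfolding z_def by (intro separatedI) blast+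
  next
    case 3
    have "- (- sqrt 3 / 2 * Re z - Im z / 2) \<le> sqrt 3 * - (- Re z / 2 + sqrt 3 / 2 * Im z)"
      using w(2) unfolding 3 uminus_complex.sel Re_omega by linarith
    then have "Im z \<le> 0" using r3[of "Im z"] by (simp add: algebra_simps)
    then have "1 \<le> (Im (omega * z))\<^sup>2"
      using third unfolding Re_omega by (simp add: power2_eq_square algebra_simps)
    then have "1 \<le> cmod (omega * z - of_real (ctr k))" for k by (rule gi)
    moreover have "1 \<le> cmod (omega\<^sup>2 * z - of_real (ctr k))" for k using gw[of k] unfolding 3 by simp
    ultimately show ?thesis using g0 unfolding z_def by (intro separatedI) blast+
  qed
qed

text \<open>Together with \<open>separated_outside\<close> this makes the boundary of the central
  disc separated, as Rouche's theorem needs there.\<close>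

lemma Dn_0_circle:
  assumes "cmod lam = (2 / sqrt 3) ^ 3"
  shows "lam \<notin> Dn n"
proof -
  have c: "cmod (cbrt mu) = 2 / sqrt 3" if "cmod mu = (2 / sqrt 3) ^ 3" for mu
  proof -
    have "cmod (cbrt mu) ^ 3 = (2 / sqrt 3) ^ 3" using cbrt_cube[of mu] that by (metis norm_power)
    then show ?thesis using power_eq_imp_eq_base[of "cmod (cbrt mu)" 3 "2 / sqrt 3"] by simp
  qed
  have far: "2 / sqrt 3 \<le> cmod (u - of_real (ctr k))" if "cmod u = 2 / sqrt 3" "k \<ge> 1" for u and k :: int
  proof -
    have "2 * pi * 1 \<le> 2 * pi * real_of_int k" using that(2) by (intro mult_left_mono) auto
    then have "6 \<le> sqrt 3 * ctr k" unfolding ctr_diff using pi_gt3 by linarith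
    then have "6 / sqrt 3 \<le> ctr k" by (simp add: field_simps)
    moreover have "cmod (of_real (ctr k) :: complex) \<le> cmod u + cmod (u - of_real (ctr k))"
      using norm_triangle_ineq4[of u "u - of_real (ctr k)"] by simp
    moreover have "cmod (of_real (ctr k) :: complex) \<ge> ctr k" by simp
    ultimately have "6 / sqrt 3 \<le> 2 / sqrt 3 + cmod (u - of_real (ctr k))" using that(1) by linarith
    moreover have "6 / sqrt 3 = 3 * (2 / sqrt 3)" by simp
    ultimately show ?thesis using two_sqrt3 by linarith
  qed
  have m: "cmod (- lam) = (2 / sqrt 3) ^ 3" using assms by simp
  consider "n = 0" | "n \<ge> 1" | "n \<le> -1" by linarith
  then show ?thesis
  proof cases
    case 1
    then show ?thesis using assms by (simp add: Dn_0)
  next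
    case 2
    then show ?thesis using far[OF c[OF assms] 2] by (auto simp: Dn_nonneg)
  next
    case 3
    then show ?thesis using far[OF c[OF m], of "- n"] by (auto simp: Dn_def ctr_def)
  qed
qed

section \<open>Real ramifications and the main result\<close>

text \<open>\<open>3/2 * 2.3 = 3.45\<close>, and \<open>(1 + 3.45 / 32) ^ 32\<close> already exceeds
  \<open>25\<close>.\<close>

lemma exp_large:
  assumes "2.3 \<le> (x::real)"
  shows "25 * exp (x / 2) \<le> exp (2 * x)"
proof -
  have "1 + 345/3200 \<le> exp (345/3200 :: real)" by (rule exp_ge_add_one_self)
  then have "(1 + 345/3200) ^ 32 \<le> exp (345/3200 :: real) ^ 32" by (intro power_mono) auto
  also have "\<dots> = exp (3.45)" by (simp flip: exp_of_nat_mult)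
  also have "\<dots> \<le> exp (3 / 2 * x)" using assms by simp
  finally have "25 \<le> exp (3 / 2 * x)" by (simp add: power_numeral_reduce divide_simps)
  then have "25 * exp (x / 2) \<le> exp (3 / 2 * x) * exp (x / 2)" by (intro mult_right_mono) auto
  also have "\<dots> = exp (2 * x)" by (simp flip: exp_add)
  finally show ?thesis .
qed

lemma growth_of_real: "0 \<le> x \<Longrightarrow> growth (of_real x) = x" "0 \<le> x \<Longrightarrow> growth (- of_real x) = x / 2"
  unfolding growth_def Re_omega by auto

text \<open>If the quadratic factor had complex roots, its constant term \<open>1 / t\<close> would exceed
  \<open>4 / 25 * X\<^sup>2\<close>, yet it is smaller than \<open>E\<close>.\<close>
lemma cubic_disc_nonneg:
  fixes T E t X Y :: real
  assumes root: "t ^ 3 - T * t\<^sup>2 + E * t - 1 = 0" and t: "\<bar>t\<bar> \<le> X / 10" and T: "9 / 10 * X \<le> T"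
    and E: "\<bar>E\<bar> \<le> 4 * Y" and X: "0 < X" "25 * Y \<le> X\<^sup>2" and Y: "0 < Y"
  shows "0 \<le> cubic_disc T E"
proof -
  define b where "b = t - T"
  define c where "c = E + t * b"
  have tc: "t * c = 1"
    using root unfolding c_def b_def by (simp add: power2_eq_square power3_eq_cube algebra_simps)
  \<comment> \<open>The cubic is \<open>(z - t) * (z^2 + b * z + c)\<close>; its discriminant is
    that of the quadratic factor times the squared value of this factor at \<open>t\<close>.\<close>
  have "cubic_disc (t - b) (c - t * b) = (t\<^sup>2 + b * t + c)\<^sup>2 * (b\<^sup>2 - 4 * c)"
    using tc unfolding cubic_disc_def by algebra
  then have d: "cubic_disc T E = (t\<^sup>2 + b * t + c)\<^sup>2 * (b\<^sup>2 - 4 * c)"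
    by (simp add: b_def c_def)
  have "0 \<le> b\<^sup>2 - 4 * c"
  proof (rule ccontr)
    assume "\<not> ?thesis"
    then have bc: "b\<^sup>2 < 4 * c" by simp
    then have c: "0 < c" using zero_le_power2[of b] by linarith
    have t0: "0 < t" using tc c by (metis zero_less_mult_pos2 zero_less_one mult.commute)
    have b8: "8 / 10 * X \<le> - b" using t T unfolding b_def by linarith
    have "(8 / 10 * X)\<^sup>2 \<le> (- b)\<^sup>2" using b8 X by (intro power_mono) auto
    then have "16 / 100 * X\<^sup>2 < c" using bc by (simp add: power_mult_distrib power_divide)
    also have "c \<le> E" 
    proof -
      have "t * b \<le> 0" using t0 b8 X by (intro mult_nonneg_nonpos) auto
      then show ?thesis unfolding c_def by linarith
    qed
    also have "E \<le> 4 * Y" using E by linarith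
    also have "\<dots> \<le> 4 / 25 * X\<^sup>2" using X by linarith
    finally show False by simp
  qed
  then show ?thesis unfolding d by simp
qed

text \<open>\<open>(1, omega^2 / z, omega / z^2)\<close> is a left eigenvector of the free matrix
  for \<open>exp (omega * z)\<close>, a small multiplier when \<open>z > 0\<close>. Only the columns
  of the second and third datum are stated: it will be paired with vectors whose first component is
  zero.\<close>

lemma phi0_left_eigenvector:
  assumes "z \<noteq> 0"
  shows "phi0 z I1 I2 1 + omega\<^sup>2 / z * phi0 z I2 I2 1 + omega / z\<^sup>2 * phi0 z I3 I2 1 = exp (omega * z) * (omega\<^sup>2 / z)"
    "phi0 z I1 I3 1 + omega\<^sup>2 / z * phi0 z I2 I3 1 + omega / z\<^sup>2 * phi0 z I3 I3 1 = exp (omega * z) * (omega / z\<^sup>2)"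
proof -
  define a b c where "a = exp z" and "b = exp (omega * z)" and "c = exp (omega\<^sup>2 * z)"
  have S: "(a + omega\<^sup>2 * b + omega * c) + omega\<^sup>2 * (a + b + c) + omega * (a + omega * b + omega\<^sup>2 * c) = 3 * (omega\<^sup>2 * b)"
    "(a + omega * b + omega\<^sup>2 * c) + omega\<^sup>2 * (a + omega\<^sup>2 * b + omega * c) + omega * (a + b + c) = 3 * (omega * b)"
    using omega_sum omega_cube by algebra+
  define P Q R where "P = a + b + c" and "Q = a + omega * b + omega\<^sup>2 * c" and "R = a + omega\<^sup>2 * b + omega * c"
  have C: "ker0 z 1 = P / 3" "ker1 z 1 = R / (3 * z)" "ker2 z 1 = Q / (3 * z\<^sup>2)"
    using assms by (simp_all add: ker0_def ker1_def ker2_def a_def b_def c_def P_def Q_def R_def)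
  have "phi0 z I1 I2 1 + omega\<^sup>2 / z * phi0 z I2 I2 1 + omega / z\<^sup>2 * phi0 z I3 I2 1 = (R + omega\<^sup>2 * P + omega * Q) / (3 * z)"
    using assms by (simp add: phi0_def C field_simps power2_eq_square[of z] power3_eq_cube)
  then show "phi0 z I1 I2 1 + omega\<^sup>2 / z * phi0 z I2 I2 1 + omega / z\<^sup>2 * phi0 z I3 I2 1 = exp (omega * z) * (omega\<^sup>2 / z)"
    unfolding P_def Q_def R_def S by (simp add: b_def)
  have "phi0 z I1 I3 1 + omega\<^sup>2 / z * phi0 z I2 I3 1 + omega / z\<^sup>2 * phi0 z I3 I3 1 = (Q + omega\<^sup>2 * R + omega * P) / (3 * z\<^sup>2)"
    using assms by (simp add: phi0_def C field_simps power2_eq_square[of z] power3_eq_cube)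
  then show "phi0 z I1 I3 1 + omega\<^sup>2 / z * phi0 z I2 I3 1 + omega / z\<^sup>2 * phi0 z I3 I3 1 = exp (omega * z) * (omega / z\<^sup>2)"
    unfolding P_def Q_def R_def S by (simp add: b_def)
qed

text \<open>The matrix has first row \<open>(a, m, n)\<close>, which annihilates
  \<open>(0, n, - m)\<close>; the two equations say the same of the other rows, so this vector lies
  in the kernel.\<close>

lemma det3_kernel:
  fixes a b c d e f g m n :: "'a::idom"
  assumes "c * n = d * m" "f * n = g * m" "m \<noteq> 0 \<or> n \<noteq> 0"
  shows "a * (c * g - d * f) - m * (b * g - d * e) + n * (b * f - c * e) = 0"
proof -
  have "(c * g - d * f) * n = 0" "(c * g - d * f) * m = 0"
    using assms(1,2) by algebra+
  then have 1: "c * g - d * f = 0" using assms(3) by auto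
  have "n * (b * f - c * e) = m * (b * g - d * e)"
    using assms(1,2) by algebra
  with 1 show ?thesis by simp
qed

text \<open>A quantitative form of the linear independence of \<open>omega^2\<close> and
  \<open>omega\<close> over the reals, namely
  \<open>(|x| + |y|)^2 <= 4 * (x^2 - x * y + y^2)\<close>. It keeps the pairing with the left
  eigenvector away from zero.\<close>

lemma norm_omega_comb:
  fixes x y :: real
  shows "\<bar>x\<bar> + \<bar>y\<bar> \<le> 2 * cmod (omega\<^sup>2 * of_real x + omega * of_real y)"
proof -
  have "(cmod (omega\<^sup>2 * of_real x + omega * of_real y))\<^sup>2 = (- x / 2 - y / 2)\<^sup>2 + (sqrt 3 / 2 * y - sqrt 3 / 2 * x)\<^sup>2"
    unfolding omega_square unfolding omega_def by (simp add: cmod_power2 algebra_simps)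
  also have "\<dots> = x\<^sup>2 - x * y + y\<^sup>2"
    by (simp add: power2_eq_square field_simps)
  finally have e: "(2 * cmod (omega\<^sup>2 * of_real x + omega * of_real y))\<^sup>2 = 4 * (x\<^sup>2 - x * y + y\<^sup>2)"
    by (simp add: power_mult_distrib)
  have "(\<bar>x\<bar> + \<bar>y\<bar>)\<^sup>2 \<le> 4 * (x\<^sup>2 - x * y + y\<^sup>2)"
  proof -
    have "0 \<le> 3 * (\<bar>x\<bar> - \<bar>y\<bar>)\<^sup>2 + 4 * (\<bar>x * y\<bar> - x * y)" by simp
    then show ?thesis by (simp add: power2_eq_square abs_mult algebra_simps)
  qed
  then show ?thesis unfolding e[symmetric] by (rule power2_le_imp_le) simp
qed

lemma rho_of_real:
  assumes "smallpot p q"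
  shows "rho p q (of_real t) = of_real (Re (rho p q (of_real t)))"
  using rho_cnj[OF assms, of "of_real t"] by (simp add: complex_eq_iff)

text \<open>The vanishing determinant makes \<open>(0, n2, - n1)\<close> an eigenvector of the real
  fundamental matrix at \<open>1\<close>, with multiplier \<open>t\<close>. Pairing with the free
  left eigenvector shows that \<open>t\<close> differs from \<open>exp (omega * x)\<close> by a
  small multiple of \<open>exp x\<close>, so \<open>cubic_disc_nonneg\<close> applies.\<close>

lemma rho_nonneg_at_eigenvalue:
  assumes p: "pot (1/50000) p q" and x: "2.3 \<le> x" and D: "dir_det p q ((of_real x) ^ 3) = 0"
    and nz: "phi p q ((of_real x) ^ 3) I2 I1 1 \<noteq> 0 \<or> phi p q ((of_real x) ^ 3) I3 I1 1 \<noteq> 0"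
  shows "0 \<le> Re (rho p q ((of_real x) ^ 3))"
proof -
  have sp: "smallpot p q" using pot_mono[OF p] by simp
  let ?z = "complex_of_real x"
  let ?lam = "?z ^ 3"
  have x0: "0 < x" "1 \<le> x" using x by auto
  have z0: "?z \<noteq> 0" using x0 by simp
  have one: "(1::real) \<in> {0..2}" by simp
  have mmz: "growth ?z = x" "growth (- ?z) = x / 2" using growth_of_real[of x] x0 by auto
  have scz: "scale ?z = x" using x0 by (simp add: scale_def)
  define r where "r = (\<lambda>j i. Re (phi p q ?lam j i 1))"
  have ph: "phi p q ?lam j i 1 = of_real (r j i)" for j i
    using phi_cnj[OF sp one, of ?lam j i] by (simp add: r_def complex_eq_iff)
  define n1 n2 where "n1 = r I2 I1" and "n2 = r I3 I1"
  have n: "n1 \<noteq> 0 \<or> n2 \<noteq> 0" using nz ph by (simp add: n1_def n2_def)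
  have "complex_of_real (n1 * (n1 * r I3 I2 - r I2 I2 * n2) + n2 * (n1 * r I3 I3 - r I2 I3 * n2)) = 0"
    using D unfolding dir_det_eq[OF sp] ph by (simp add: n1_def n2_def)
  then have D': "n1 * (n1 * r I3 I2 - r I2 I2 * n2) + n2 * (n1 * r I3 I3 - r I2 I3 * n2) = 0"
    by (simp only: of_real_eq_0_iff)
  \<comment> \<open>The solution with initial data \<open>(0, n2, - n1)\<close> vanishes at
    \<open>1\<close> by construction; \<open>D'\<close> says that its remaining data at
    \<open>1\<close> are parallel to the initial ones.\<close>
  obtain t where t: "r I2 I2 * n2 - r I3 I2 * n1 = t * n2" "r I2 I3 * n2 - r I3 I3 * n1 = - t * n1"
  proof (cases "n2 = 0")
    case True
    then have n1: "n1 \<noteq> 0" using n by auto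
    then have "r I3 I2 = 0" using D' True by simp
    then show ?thesis using that[of "r I3 I3"] True by simp
  next
    case False
    have "n2 * (r I2 I3 * n2 - r I3 I3 * n1) = - ((r I2 I2 * n2 - r I3 I2 * n1) * n1)"
      using D' by algebra
    then show ?thesis
      using False by (intro that[of "(r I2 I2 * n2 - r I3 I2 * n1) / n2"]) (auto simp: field_simps)
  qed
  define T where "T = r I1 I1 + r I2 I2 + r I3 I3"
  define E where "E = (r I1 I1 * r I2 I2 - r I1 I2 * r I2 I1) + (r I1 I1 * r I3 I3 - r I1 I3 * r I3 I1)
    + (r I2 I2 * r I3 I3 - r I2 I3 * r I3 I2)"
  have TT: "mtrace p q ?lam = of_real T" by (simp add: mtrace_def sum_idx3 ph T_def)
  have EE: "mtrace p (\<lambda>x. - q x) (- ?lam) = of_real E"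
    unfolding mtrace_def sum_idx3 phi_minors[OF sp one] sel3_simps ph by (simp add: E_def)
  have "complex_of_real (r I3 I3 * (r I1 I1 * r I2 I2 - r I1 I2 * r I2 I1) - r I3 I2 * (r I1 I1 * r I2 I3 - r I1 I3 * r I2 I1)
    + r I3 I1 * (r I1 I2 * r I2 I3 - r I1 I3 * r I2 I2)) = of_real 1"
    using phi_det[OF sp one, of ?lam] unfolding ph by simp
  then have det: "r I3 I3 * (r I1 I1 * r I2 I2 - r I1 I2 * r I2 I1) - r I3 I2 * (r I1 I1 * r I2 I3 - r I1 I3 * r I2 I1)
    + r I3 I1 * (r I1 I2 * r I2 I3 - r I1 I3 * r I2 I2) = 1"
    by (simp only: of_real_eq_iff)
  have "(r I1 I1 - t) * ((r I2 I2 - t) * (r I3 I3 - t) - r I3 I2 * r I2 I3)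
    - n1 * (r I1 I2 * (r I3 I3 - t) - r I3 I2 * r I1 I3) + n2 * (r I1 I2 * r I2 I3 - (r I2 I2 - t) * r I1 I3) = 0"
    using t n by (intro det3_kernel) (auto simp: algebra_simps)
  then have root: "t ^ 3 - T * t\<^sup>2 + E * t - 1 = 0"
    unfolding det[symmetric] T_def E_def n1_def n2_def by (simp add: power2_eq_square power3_eq_cube algebra_simps)
  let ?v2 = "n2 / x" and ?v3 = "- n1 / x\<^sup>2"
  define L where "L = omega\<^sup>2 * of_real ?v2 + omega * of_real ?v3"
  define e where "e = (\<lambda>j i. phi p q ?lam j i 1 - phi0 ?z i j 1)"
  have eb: "cmod (e j i) * x ^ weight j \<le> 192 / 50000 * x ^ weight i * exp x" for j i
    using phi_estimate(2)[OF p _ one, of ?z j i] unfolding scz mmz e_def by simp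
  have e2: "cmod (e I2 I1) * x \<le> 192 / 50000 * exp x" "cmod (e I2 I2) \<le> 192 / 50000 * exp x" "cmod (e I2 I3) \<le> 192 / 50000 * exp x * x"
    using eb[of I2 I1] eb[of I2 I2] eb[of I2 I3] x0 by (simp_all add: weight_def power2_eq_square mult_ac)
  have e3: "cmod (e I3 I1) * x\<^sup>2 \<le> 192 / 50000 * exp x" "cmod (e I3 I2) * x \<le> 192 / 50000 * exp x" "cmod (e I3 I3) \<le> 192 / 50000 * exp x"
    using eb[of I3 I1] eb[of I3 I2] eb[of I3 I3] x0 by (simp_all add: weight_def power2_eq_square)
  define e2' where "e2' = e I2 I1 + omega\<^sup>2 / ?z * e I2 I2 + omega / ?z\<^sup>2 * e I2 I3"
  define e3' where "e3' = e I3 I1 + omega\<^sup>2 / ?z * e I3 I2 + omega / ?z\<^sup>2 * e I3 I3"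
  have b2: "cmod e2' \<le> 3 * (192 / 50000 * exp x / x)"
    unfolding e2'_def using e2 x0
    by (intro norm_three) (simp_all add: norm_mult norm_divide norm_power norm_omega field_simps power2_eq_square)
  have b3: "cmod e3' \<le> 3 * (192 / 50000 * exp x / x\<^sup>2)"
    unfolding e3'_def using e3 x0
    by (intro norm_three) (simp_all add: norm_mult norm_divide norm_power norm_omega field_simps power2_eq_square)
  \<comment> \<open>\<open>L\<close> is the left eigenvector applied to
    \<open>(0, n2, - n1)\<close>; \<open>e2'\<close> and \<open>e3'\<close> are the same vector
    applied to the perturbations of the second and third column.\<close>
  have key: "of_real t * L = exp (omega * ?z) * L + (e2' * of_real n2 - e3' * of_real n1)"
  proof -
    have pe: "of_real (r j i) = phi0 ?z i j 1 + e j i" for j i by (simp add: e_def ph)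
    have "of_real t * L = of_real (r I2 I1 * n2 - r I3 I1 * n1) + omega\<^sup>2 / ?z * of_real (t * n2) + omega / ?z\<^sup>2 * of_real (- t * n1)"
      by (simp add: L_def n1_def n2_def algebra_simps)
    also have "\<dots> = of_real (r I2 I1 * n2 - r I3 I1 * n1) + omega\<^sup>2 / ?z * of_real (r I2 I2 * n2 - r I3 I2 * n1)
        + omega / ?z\<^sup>2 * of_real (r I2 I3 * n2 - r I3 I3 * n1)"
      unfolding t ..
    also have "\<dots> = (phi0 ?z I1 I2 1 + omega\<^sup>2 / ?z * phi0 ?z I2 I2 1 + omega / ?z\<^sup>2 * phi0 ?z I3 I2 1) * of_real n2
       - (phi0 ?z I1 I3 1 + omega\<^sup>2 / ?z * phi0 ?z I2 I3 1 + omega / ?z\<^sup>2 * phi0 ?z I3 I3 1) * of_real n1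
       + (e2' * of_real n2 - e3' * of_real n1)"
      unfolding e2'_def e3'_def of_real_diff of_real_mult pe by (simp only: algebra_simps)
    also have "\<dots> = exp (omega * ?z) * L + (e2' * of_real n2 - e3' * of_real n1)"
      unfolding phi0_left_eigenvector[OF z0] by (simp add: L_def algebra_simps)
    finally show ?thesis .
  qed
  have "L \<noteq> 0"
  proof
    assume "L = 0"
    then have "\<bar>?v2\<bar> + \<bar>?v3\<bar> \<le> 0" using norm_omega_comb[of ?v2 ?v3] by (simp add: L_def)
    then have "?v2 = 0" "?v3 = 0" by linarith+
    then show False using n x0 by simp
  qed
  then have L0: "0 < cmod L" by simp
  have "cmod (of_real t - exp (omega * ?z)) * cmod L = cmod (e2' * of_real n2 - e3' * of_real n1)"
  proof -
    have "(of_real t - exp (omega * ?z)) * L = e2' * of_real n2 - e3' * of_real n1"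
      unfolding left_diff_distrib key by simp
    then show ?thesis by (simp only: flip: norm_mult)
  qed
  also have "\<dots> \<le> cmod e2' * \<bar>n2\<bar> + cmod e3' * \<bar>n1\<bar>"
    using norm_triangle_ineq4[of "e2' * of_real n2" "e3' * of_real n1"] by (simp add: norm_mult)
  also have "\<dots> \<le> 3 * (192 / 50000 * exp x / x) * \<bar>n2\<bar> + 3 * (192 / 50000 * exp x / x\<^sup>2) * \<bar>n1\<bar>"
    using b2 b3 by (intro add_mono mult_right_mono) auto
  also have "\<dots> = (576 / 50000 * exp x) * (\<bar>?v2\<bar> + \<bar>?v3\<bar>)"
    using x0 by (simp add: algebra_simps)
  also have "\<dots> \<le> (576 / 50000 * exp x) * (2 * cmod L)"
    unfolding L_def by (intro mult_left_mono norm_omega_comb) auto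
  finally have "cmod (of_real t - exp (omega * ?z)) * cmod L \<le> (1152 / 50000 * exp x) * cmod L"
    by simp
  then have td: "cmod (of_real t - exp (omega * ?z)) \<le> 1152 / 50000 * exp x"
    using L0 by simp
  have small: "25 * exp (- x / 2) \<le> exp x"
  proof -
    have "25 * exp (x / 2) * exp (- x) \<le> exp (2 * x) * exp (- x)"
      using exp_large[OF x] by (intro mult_right_mono) auto
    also have "exp (2 * x) * exp (- x) = exp x" by (simp flip: exp_add)
    also have "25 * exp (x / 2) * exp (- x) = 25 * exp (- x / 2)" by (simp add: mult.assoc flip: exp_add)
    finally show ?thesis .
  qed
  have om1: "cmod (exp (omega * ?z)) = exp (- x / 2)" "cmod (exp (omega\<^sup>2 * ?z)) = exp (- x / 2)"
    using Re_omega[of ?z] by simp_all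
  \<comment> \<open>\<open>1152 / 50000 + 1 / 25 < 1 / 10\<close>; the trace below leaves
    \<open>576 / 50000 + 2 / 25 < 1 / 10\<close>.\<close>
  have "\<bar>t\<bar> \<le> exp x / 10"
    using norm_triangle_sub[of "of_real t" "exp (omega * ?z)"] td om1 small by simp
  moreover have "9 / 10 * exp x \<le> T"
  proof -
    have "cmod (of_real T - exp ?z) \<le> cmod (of_real T - mtrace0 ?lam) + cmod (exp (omega * ?z) + exp (omega\<^sup>2 * ?z))"
      using norm_triangle_ineq[of "of_real T - mtrace0 ?lam" "exp (omega * ?z) + exp (omega\<^sup>2 * ?z)"] by (simp add: mtrace0_cube algebra_simps)
    also have "\<dots> \<le> 576 * (1 / 50000) * exp x + (exp (- x / 2) + exp (- x / 2))"
      using mtrace_estimate(1)[OF p _, of ?z] om1 norm_triangle_ineq[of "exp (omega * ?z)" "exp (omega\<^sup>2 * ?z)"]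
      by (intro add_mono) (simp_all add: TT mmz)
    also have "\<dots> \<le> 1 / 10 * exp x"
    proof -
      have "exp (- x / 2) \<le> exp x / 25" using small by simp
      then have "576 * (1 / 50000) * exp x + (exp (- x / 2) + exp (- x / 2)) \<le> (576 / 50000 + 2 / 25) * exp x"
        by (simp add: algebra_simps)
      also have "\<dots> \<le> 1 / 10 * exp x" by (intro mult_right_mono) auto
      finally show ?thesis .
    qed
    finally have "cmod (of_real (T - exp x)) \<le> 1 / 10 * exp x" by (simp add: exp_of_real)
    then have "\<bar>T - exp x\<bar> \<le> 1 / 10 * exp x" unfolding norm_of_real .
    then show ?thesis by linarith
  qed
  moreover have "\<bar>E\<bar> \<le> 4 * exp (x / 2)"
  proof -
    have "cmod (mtrace p (\<lambda>x. - q x) ((- ?z) ^ 3)) \<le> cmod (mtrace0 ((- ?z) ^ 3)) + cmod (mtrace p (\<lambda>x. - q x) ((- ?z) ^ 3) - mtrace0 ((- ?z) ^ 3))"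
      by (rule norm_triangle_sub)
    also have "\<dots> \<le> 3 * exp (x / 2) + 576 * (1 / 50000) * exp (x / 2)"
      using mtrace_estimate(1,2)[OF pot_uminus[OF p], of "- ?z"] unfolding mmz by (intro add_mono) simp_all
    also have "\<dots> \<le> 4 * exp (x / 2)" by simp
    finally have "cmod (mtrace p (\<lambda>x. - q x) (- ?lam)) \<le> 4 * exp (x / 2)" by (simp only: minus_cube)
    then show ?thesis unfolding EE by simp
  qed
  ultimately have "0 \<le> cubic_disc T E"
    using exp_large[OF x] by (intro cubic_disc_nonneg[OF root, of "exp x" "exp (x / 2)"]) (auto simp: exp_double)
  moreover have "rho p q ?lam = of_real (cubic_disc T E)"
    unfolding rho_eq_disc3[OF sp] TT EE by (simp add: cubic_disc_def)
  ultimately show ?thesis by simp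
qed

section \<open>Rouche counts in the discs\<close>

definition near_free :: "(real \<Rightarrow> real) \<Rightarrow> (real \<Rightarrow> real) \<Rightarrow> bool" where
  "near_free p q \<longleftrightarrow> pot (1/50000) p q \<and>
     (\<forall>z. separated z \<longrightarrow> cmod (rho p q (z ^ 3) - rho0 (z ^ 3)) < cmod (rho0 (z ^ 3)) \<and>
        cmod (dir_det p q (z ^ 3) - dir_det0 (z ^ 3)) < cmod (dir_det0 (z ^ 3))) \<and>
     (\<forall>lam. cmod lam \<le> (2 / sqrt 3) ^ 3 \<longrightarrow> cmod (dir_det p q lam - dir_det0 lam) < cmod (dir_det0 lam))"

lemma near_freeD:
  assumes "near_free p q"
  shows "pot (1/50000) p q" "smallpot p q"
    "separated z \<Longrightarrow> cmod (rho p q (z ^ 3) - rho0 (z ^ 3)) < cmod (rho0 (z ^ 3))"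
    "separated z \<Longrightarrow> cmod (dir_det p q (z ^ 3) - dir_det0 (z ^ 3)) < cmod (dir_det0 (z ^ 3))"
    "cmod lam \<le> (2 / sqrt 3) ^ 3 \<Longrightarrow> cmod (dir_det p q lam - dir_det0 lam) < cmod (dir_det0 lam)"
  using assms pot_mono[of "1/50000" p q "1/48"] unfolding near_free_def by auto

lemma near_free_outside:
  assumes "near_free p q" "separated z"
  shows "rho p q (z ^ 3) \<noteq> 0" "dir_det p q (z ^ 3) \<noteq> 0"
  using near_freeD(3,4)[OF assms] by auto

lemma Dn_0_circle_good:
  assumes "cmod lam = (2 / sqrt 3) ^ 3"
  shows "separated (cbrt lam)"
  by (rule separated_outside) (rule Dn_0_circle[OF assms])

text \<open>A single separated point shows that \<open>rho\<close> and \<open>dir_det\<close> do not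
  vanish identically, which the order calculus requires.\<close>

lemma separated_exists: "separated (of_real (ctr 1 + 2 / sqrt 3))"
  by (rule separated_circle[of 1]) (simp_all add: norm_of_real del: of_real_add of_real_divide flip: of_real_diff)

lemma near_free_nonzero:
  assumes "near_free p q"
  obtains w u where "rho p q w \<noteq> 0" "dir_det p q u \<noteq> 0"
  using near_free_outside[OF assms separated_exists] that by blast

lemma vdm_holomorphic: "vdm holomorphic_on S"
  unfolding vdm_def by (intro holomorphic_intros)

lemma vdm_ball:
  assumes n: "1 \<le> n"
  shows "{z \<in> ball (of_real (ctr n)) (2 / sqrt 3). vdm z = 0} = {of_real (ctr n)}"
    "zorder vdm (of_real (ctr n)) = 1"
proof -
  let ?c = "complex_of_real (ctr n)"
  have c0: "0 < ctr n" using n by (simp add: ctr_def)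
  have V0: "vdm ?c = 0" unfolding vdm_eq_0_iff ctr_def by blast
  show "{z \<in> ball ?c (2 / sqrt 3). vdm z = 0} = {?c}"
  proof (intro equalityI subsetI)
    fix z assume "z \<in> {z \<in> ball ?c (2 / sqrt 3). vdm z = 0}"
    then have zb: "cmod (z - ?c) < 2 / sqrt 3" and V: "vdm z = 0" by (auto simp: dist_norm norm_minus_commute)
    obtain k :: int and w where w: "w \<in> {z, omega * z, omega\<^sup>2 * z}" "w = of_real (ctr k)"
      using V unfolding vdm_eq_0_iff ctr_def by blast
    have "Im w = 0" using w(2) by simp
    then have "w = z" using w(1) cball_ctr(3,4)[OF n less_imp_le[OF zb]] by auto
    then have "cmod (of_real (ctr k) - ?c) < 2 / sqrt 3" using zb w(2) by simp
    then have "\<bar>ctr k - ctr n\<bar> < 2 / sqrt 3" by (simp only: norm_of_real flip: of_real_diff)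
    then have "sqrt 3 * \<bar>ctr k - ctr n\<bar> < 2" by (simp add: field_simps)
    then have "\<bar>sqrt 3 * (ctr k - ctr n)\<bar> < 2" by (simp add: abs_mult)
    then have "\<bar>2 * pi * (real_of_int (k - n))\<bar> < 2" unfolding right_diff_distrib ctr_diff by (simp add: algebra_simps)
    then have "pi * \<bar>real_of_int (k - n)\<bar> < 1" by (simp add: abs_mult)
    moreover have "k \<noteq> n \<Longrightarrow> pi * 1 \<le> pi * \<bar>real_of_int (k - n)\<bar>" by (intro mult_left_mono) auto
    ultimately have "k = n" using pi_gt3 by linarith
    then show "z \<in> {?c}" using \<open>w = z\<close> w(2) by simp
  qed (use V0 in auto)
  \<comment> \<open>At the centre the two small multipliers coincide and differ from the large one,
    so exactly one factor of \<open>vdm\<close> vanishes, to first order.\<close>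
  have e12: "exp (omega * ?c) = exp (omega\<^sup>2 * ?c)" unfolding exp_eq_omega(1) ctr_def by blast
  have ne: "exp ?c \<noteq> exp (omega * ?c)"
  proof
    assume "exp ?c = exp (omega * ?c)"
    then have "exp (Re ?c) = exp (Re (omega * ?c))" by (metis norm_exp_eq_Re)
    then show False using c0 unfolding Re_omega by simp
  qed
  have "(vdm has_field_derivative (exp ?c - exp (omega * ?c)) * (exp ?c - exp (omega\<^sup>2 * ?c)) * (omega * exp (omega * ?c) - omega\<^sup>2 * exp (omega\<^sup>2 * ?c))) (at ?c)"
    unfolding vdm_def[abs_def] by (auto intro!: derivative_eq_intros simp: e12)
  then have "deriv vdm ?c = (exp ?c - exp (omega * ?c)) * (exp ?c - exp (omega * ?c)) * ((omega - omega\<^sup>2) * exp (omega * ?c))"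
    unfolding e12[symmetric] by (auto dest!: DERIV_imp_deriv simp: algebra_simps)
  then have "deriv vdm ?c \<noteq> 0" using ne omega_diff by simp
  then show "zorder vdm ?c = 1"
    using V0 by (intro zorder_zero_eqI[OF vdm_holomorphic open_UNIV]) auto
qed

lemma holomorphic_cube:
  assumes "f holomorphic_on UNIV"
  shows "(\<lambda>z. f (z ^ 3)) holomorphic_on UNIV"
proof -
  have "(f \<circ> (\<lambda>z. z ^ 3)) holomorphic_on UNIV"
    by (intro holomorphic_on_compose holomorphic_intros) (rule holomorphic_on_subset[OF assms], simp)
  then show ?thesis by (simp add: o_def)
qed

lemma sum_zorder_Dn:
  assumes n: "1 \<le> n" and f: "f holomorphic_on UNIV" "f w \<noteq> 0"
  shows "(\<Sum>lam\<in>zeros_in f (Dn n). zorder f lam) =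
     (\<Sum>z\<in>{z \<in> ball (of_real (ctr n)) (2 / sqrt 3). f (z ^ 3) = 0}. zorder (\<lambda>z. f (z ^ 3)) z)"
    "finite (zeros_in f (Dn n))"
proof -
  let ?B = "ball (complex_of_real (ctr n)) (2 / sqrt 3)"
  have nz: "z \<noteq> 0" if "z \<in> ?B" for z
    using cball_ctr(5)[OF n, of z] that by (simp add: dist_norm norm_minus_commute)
  have im: "zeros_in f (Dn n) = (\<lambda>z. z ^ 3) ` {z \<in> ?B. f (z ^ 3) = 0}"
    unfolding zeros_in_def Dn_pos_image(1)[OF n] by auto
  have inj: "inj_on (\<lambda>z. z ^ 3) {z \<in> ?B. f (z ^ 3) = 0}"
    by (rule inj_on_subset[OF Dn_pos_image(2)[OF n]]) auto
  show "(\<Sum>lam\<in>zeros_in f (Dn n). zorder f lam) = (\<Sum>z\<in>{z \<in> ?B. f (z ^ 3) = 0}. zorder (\<lambda>z. f (z ^ 3)) z)"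
    unfolding im sum.reindex[OF inj] o_def
    by (intro sum.cong refl zorder_cube[OF f, symmetric]) (use nz in auto)
  have "f (cbrt w ^ 3) \<noteq> 0" using f(2) by (simp add: cbrt_cube)
  from entire_finite_zeros[OF holomorphic_cube[OF f(1)] this compact_cball[of "of_real (ctr n)" "2 / sqrt 3"]]
  have "finite {z \<in> ?B. f (z ^ 3) = 0}" by (rule finite_subset[rotated]) auto
  then show "finite (zeros_in f (Dn n))" unfolding im by simp
qed

lemma rho_count:
  assumes p: "near_free p q" and n: "1 \<le> n"
  shows "(\<Sum>lam\<in>zeros_in (rho p q) (Dn n). zorder (rho p q) lam) = 2" "finite (zeros_in (rho p q) (Dn n))"
proof -
  let ?B = "ball (complex_of_real (ctr n)) (2 / sqrt 3)"
  note sp = near_freeD(2)[OF p]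
  obtain w where w: "rho p q w \<noteq> 0" using near_free_nonzero[OF p] by blast
  note S = sum_zorder_Dn[OF n rho_holomorphic[OF sp] w]
  show "finite (zeros_in (rho p q) (Dn n))" by (rule S(2))
  define f where "f = (\<lambda>z. rho0 (z ^ 3))"
  define g where "g = (\<lambda>z. rho p q (z ^ 3) - rho0 (z ^ 3))"
  have fh: "f holomorphic_on UNIV" "g holomorphic_on UNIV"
    unfolding f_def g_def by (intro holomorphic_on_diff holomorphic_cube rho_holomorphic sp smallpot_0)+
  have fV: "f = (\<lambda>z. vdm z ^ 2)" by (simp add: f_def rho0_cube)
  have "(\<Sum>z\<in>{z\<in>?B. f z + g z = 0}. zorder (\<lambda>z. f z + g z) z) = (\<Sum>z\<in>{z\<in>?B. f z = 0}. zorder f z)"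
  proof (rule Rouche_theorem_ball[OF fh])
    show "cmod (g z) < cmod (f z)" if "cmod (z - of_real (ctr n)) = 2 / sqrt 3" for z
      unfolding f_def g_def by (rule near_freeD(3)[OF p separated_circle[OF n that]])
  qed simp
  also have "{z\<in>?B. f z = 0} = {of_real (ctr n)}" unfolding fV using vdm_ball(1)[OF n] by simp
  also have "(\<Sum>z\<in>{of_real (ctr n)}. zorder f z) = 2"
  proof -
    have V1: "vdm (of_real (ctr 1 + 2 / sqrt 3)) \<noteq> 0"
      using near_free_outside(1)[OF p separated_exists] near_freeD(3)[OF p separated_exists] rho0_cube by force
    have "zorder (\<lambda>z. vdm z ^ 2) (of_real (ctr n)) = int 2 * zorder vdm (of_real (ctr n))"
      by (intro zorder_power analytic_on_imp_meromorphic_on entire_frequently_nonzero[OF vdm_holomorphic V1])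
        (use vdm_holomorphic analytic_on_holomorphic in blast)
    then show ?thesis by (simp add: fV vdm_ball(2)[OF n])
  qed
  finally show "(\<Sum>lam\<in>zeros_in (rho p q) (Dn n). zorder (rho p q) lam) = 2"
    unfolding S(1) by (simp add: f_def g_def)
qed

text \<open>Cubing branches at the origin, so Rouche's theorem is applied in \<open>lam\<close>
  itself; the multiplicity \<open>2\<close> is that of the factor \<open>lam^2\<close> in
  \<open>rho0_Del0\<close>.\<close>

lemma rho_count_0:
  assumes p: "near_free p q"
  shows "(\<Sum>lam\<in>zeros_in (rho p q) (Dn 0). zorder (rho p q) lam) = 2" "finite (zeros_in (rho p q) (Dn 0))"
proof -
  let ?B = "ball (0::complex) ((2 / sqrt 3) ^ 3)"
  note sp = near_freeD(2)[OF p]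
  obtain w where w: "rho p q w \<noteq> 0" using near_free_nonzero[OF p] by blast
  show "finite (zeros_in (rho p q) (Dn 0))"
    unfolding zeros_in_def Dn_0
    by (rule finite_subset[OF _ entire_finite_zeros[OF rho_holomorphic[OF sp] w compact_cball[of 0 "(2 / sqrt 3) ^ 3"]]]) auto
  define g where "g = (\<lambda>z. rho p q z - rho0 z)"
  have gh: "g holomorphic_on UNIV" unfolding g_def by (intro holomorphic_on_diff rho_holomorphic sp smallpot_0)
  have "(\<Sum>z\<in>{z\<in>?B. rho0 z + g z = 0}. zorder (\<lambda>z. rho0 z + g z) z) = (\<Sum>z\<in>{z\<in>?B. rho0 z = 0}. zorder rho0 z)"
  proof (rule Rouche_theorem_ball[OF rho_holomorphic[OF smallpot_0] gh])
    show "cmod (g z) < cmod (rho0 z)" if "cmod (z - 0) = (2 / sqrt 3) ^ 3" for z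
      using near_freeD(3)[OF p Dn_0_circle_good, of z] that by (simp add: g_def cbrt_cube)
  qed simp
  also have "{z\<in>?B. rho0 z = 0} = {0}"
    using dir_det0_nonzero by (auto simp: rho0_Del0 dest: less_imp_le)
  also have "(\<Sum>z\<in>{0}. zorder rho0 z) = 2"
  proof -
    have "zorder rho0 0 = 2"
    proof (rule zorder_eqI[OF open_UNIV UNIV_I])
      show "(\<lambda>z. - 27 * dir_det0 z ^ 2) holomorphic_on UNIV"
        by (intro holomorphic_intros dir_det_holomorphic smallpot_0)
      show "rho0 w = - 27 * dir_det0 w ^ 2 * (w - 0) powi 2" if "w \<noteq> 0" for w
        by (simp add: rho0_Del0 power_int_def)
    qed (simp add: dir_det0_0)
    then show ?thesis by simp
  qed
  finally show "(\<Sum>lam\<in>zeros_in (rho p q) (Dn 0). zorder (rho p q) lam) = 2"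
    unfolding zeros_in_def Dn_0 by (simp add: g_def)
qed

lemma dir_det_count:
  assumes p: "near_free p q" and n: "1 \<le> n"
  obtains mu where "{lam \<in> Dn n. dir_det p q lam = 0} = {mu}" "deriv (dir_det p q) mu \<noteq> 0"
proof -
  let ?B = "ball (complex_of_real (ctr n)) (2 / sqrt 3)"
  note sp = near_freeD(2)[OF p]
  obtain w where w: "dir_det p q w \<noteq> 0" using near_free_nonzero[OF p] by blast
  note S = sum_zorder_Dn[OF n dir_det_holomorphic[OF sp] w]
  define f where "f = (\<lambda>z. dir_det0 (z ^ 3))"
  define g where "g = (\<lambda>z. dir_det p q (z ^ 3) - dir_det0 (z ^ 3))"
  have fh: "f holomorphic_on UNIV" "g holomorphic_on UNIV"
    unfolding f_def g_def by (intro holomorphic_on_diff holomorphic_cube dir_det_holomorphic sp smallpot_0)+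
  have k: "omega\<^sup>2 - omega \<noteq> 0" using norm_omega_diff by auto
  have fV: "9 * z ^ 3 * f z = (omega\<^sup>2 - omega) * vdm z" for z unfolding f_def by (rule dir_det0_cube)
  have nz: "z \<noteq> 0" if "z \<in> ?B" for z
    using cball_ctr(5)[OF n, of z] that by (simp add: dist_norm norm_minus_commute)
  have "(\<Sum>z\<in>{z\<in>?B. f z + g z = 0}. zorder (\<lambda>z. f z + g z) z) = (\<Sum>z\<in>{z\<in>?B. f z = 0}. zorder f z)"
  proof (rule Rouche_theorem_ball[OF fh])
    show "cmod (g z) < cmod (f z)" if "cmod (z - of_real (ctr n)) = 2 / sqrt 3" for z
      unfolding f_def g_def by (rule near_freeD(4)[OF p separated_circle[OF n that]])
  qed simp
  also have "{z\<in>?B. f z = 0} = {z\<in>?B. vdm z = 0}"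
  proof (intro Collect_cong conj_cong refl)
    fix z assume "z \<in> ?B"
    then show "f z = 0 \<longleftrightarrow> vdm z = 0" using fV[of z] nz[of z] k by auto
  qed
  also have "\<dots> = {of_real (ctr n)}" by (rule vdm_ball(1)[OF n])
  also have "(\<Sum>z\<in>{of_real (ctr n)}. zorder f z) = 1"
  proof -
    let ?c = "complex_of_real (ctr n)"
    have c0: "?c \<noteq> 0" by (rule nz) simp
    have f1: "f (of_real (ctr 1 + 2 / sqrt 3)) \<noteq> 0"
      using near_freeD(4)[OF p separated_exists] unfolding f_def by force
    have gz: "of_real (ctr 1 + 2 / sqrt 3) \<noteq> (0::complex)"
      using separated_norm_ge[OF separated_exists] by (metis norm_zero not_one_le_zero)
    have ah: "(\<lambda>z. 9 * z ^ 3) holomorphic_on UNIV" "(\<lambda>z. 9 * z ^ 3 * f z) holomorphic_on UNIV"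
      by (intro holomorphic_intros fh)+
    have an: "h analytic_on {?c}" if "h holomorphic_on UNIV" for h
      using that analytic_on_holomorphic by blast
    \<comment> \<open>Near the centre, which is not \<open>0\<close>, the factor
      \<open>9 * z ^ 3\<close> has order \<open>0\<close>, so the simple zero of \<open>vdm\<close>
      passes to the three-point determinant.\<close>
    have "zorder (\<lambda>z. 9 * z ^ 3 * f z) ?c = zorder (\<lambda>z. 9 * z ^ 3) ?c + zorder f ?c"
    proof (rule zorder_times_analytic[OF an[OF ah(1)] an[OF fh(1)]])
      show "\<forall>\<^sub>F z in at ?c. 9 * z ^ 3 * f z \<noteq> 0"
        by (rule entire_eventually_nonzero[OF ah(2)]) (use f1 gz in auto)
    qed
    moreover have "zorder (\<lambda>z. 9 * z ^ 3) ?c = 0"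
      using c0 by (intro zorder_eq_0I[OF an[OF ah(1)]]) auto
    moreover have "zorder (\<lambda>z. 9 * z ^ 3 * f z) ?c = zorder vdm ?c"
      unfolding fV using k by (rule zorder_cmult)
    ultimately show ?thesis using vdm_ball(2)[OF n] by simp
  qed
  finally have sum1: "(\<Sum>lam\<in>zeros_in (dir_det p q) (Dn n). zorder (dir_det p q) lam) = 1"
    unfolding S(1) by (simp add: f_def g_def)
  have pos: "zorder (dir_det p q) lam > 0" if "lam \<in> zeros_in (dir_det p q) (Dn n)" for lam
    using entire_zorder_pos[OF dir_det_holomorphic[OF sp] w] that by (simp add: zeros_in_def)
  obtain mu where mu: "zeros_in (dir_det p q) (Dn n) = {mu}" "zorder (dir_det p q) mu = 1"
    using sum_pos_eq_1[OF S(2) pos sum1] by blast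
  have "dir_det p q mu = 0" using mu(1) by (auto simp: zeros_in_def)
  then have "deriv (dir_det p q) mu \<noteq> 0"
    using entire_simple_zero_deriv[OF dir_det_holomorphic[OF sp] w _ mu(2)] by blast
  then show ?thesis using that mu(1) by (simp add: zeros_in_def)
qed

section \<open>Reality of the zeros and the ordering around the eigenvalue\<close>

lemma cnj_Dn:
  assumes n: "1 \<le> n" and "lam \<in> Dn n"
  shows "cnj lam \<in> Dn n"
proof -
  obtain z where z: "z \<in> ball (complex_of_real (ctr n)) (2 / sqrt 3)" "lam = z ^ 3"
    using assms(2) unfolding Dn_pos_image(1)[OF n] by blast
  have "dist (complex_of_real (ctr n)) (cnj z) = cmod (cnj (of_real (ctr n) - z))" by (simp add: dist_norm)
  then have "cnj z \<in> ball (complex_of_real (ctr n)) (2 / sqrt 3)"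
    using z(1) unfolding complex_mod_cnj by (simp add: dist_norm)
  then show ?thesis unfolding Dn_pos_image(1)[OF n] z(2) by auto
qed

lemma real_in_Dn:
  assumes n: "1 \<le> n" and "lam \<in> Dn n" "cnj lam = lam"
  obtains x where "lam = of_real x ^ 3" "ctr n - 2 / sqrt 3 < x" "x < ctr n + 2 / sqrt 3" "2.3 \<le> x"
proof -
  let ?B = "ball (complex_of_real (ctr n)) (2 / sqrt 3)"
  obtain z where z: "z \<in> ?B" "lam = z ^ 3"
    using assms(2) unfolding Dn_pos_image(1)[OF n] by blast
  have "dist (complex_of_real (ctr n)) (cnj z) = cmod (cnj (of_real (ctr n) - z))" by (simp add: dist_norm)
  then have "cnj z \<in> ?B"
    using z(1) unfolding complex_mod_cnj by (simp add: dist_norm)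
  moreover have "cnj z ^ 3 = z ^ 3" using assms(3) z(2) by simp
  ultimately have "cnj z = z" using inj_onD[OF Dn_pos_image(2)[OF n]] z(1) by blast
  then have zr: "z = of_real (Re z)" by (simp add: complex_eq_iff)
  have "2.3 \<le> Re z" using cball_ctr(1)[OF n, of z] z(1) by (simp add: dist_norm norm_minus_commute)
  moreover have "\<bar>ctr n - Re z\<bar> < 2 / sqrt 3"
    using z(1) zr by (metis dist_norm mem_ball norm_of_real of_real_diff)
  ultimately show ?thesis using that[of "Re z"] z(2) zr by auto
qed

lemma of_real_cube_in_Dn:
  assumes n: "1 \<le> n" and "ctr n - 2 / sqrt 3 < x" "x < ctr n + 2 / sqrt 3"
  shows "complex_of_real x ^ 3 \<in> Dn n"
proof -
  have "\<bar>ctr n - x\<bar> < 2 / sqrt 3" using assms by linarith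
  then have "of_real x \<in> ball (complex_of_real (ctr n)) (2 / sqrt 3)"
    by (simp add: dist_norm flip: of_real_diff)
  then show ?thesis unfolding Dn_pos_image(1)[OF n] by blast
qed

text \<open>For real \<open>x\<close> the two small free multipliers are conjugate, so
  \<open>vdm\<close> is purely imaginary and \<open>rho0 = vdm^2 <= 0\<close>; a perturbation
  smaller than \<open>|rho0|\<close> keeps the sign and makes it strict.\<close>

lemma rho_negative_on_circle:
  assumes p: "near_free p q" and n: "1 \<le> n" and x: "x = ctr n - 2 / sqrt 3 \<or> x = ctr n + 2 / sqrt 3"
  shows "Re (rho p q (of_real x ^ 3)) < 0"
proof -
  have "of_real x - of_real (ctr n) = complex_of_real (x - ctr n)" by simp
  then have "cmod (of_real x - of_real (ctr n)) = \<bar>x - ctr n\<bar>" by (simp only: norm_of_real)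
  then have g: "separated (of_real x)"
    using x by (intro separated_circle[OF n]) auto
  let ?a = "exp (omega * complex_of_real x)"
  have b: "exp (omega\<^sup>2 * of_real x) = cnj ?a" by (simp add: exp_cnj cnj_omega)
  have "exp (complex_of_real x) = of_real (exp x)" by (rule exp_of_real)
  then have "vdm (of_real x) = ((of_real (exp x) - ?a) * cnj (of_real (exp x) - ?a)) * (?a - cnj ?a)"
    unfolding vdm_def b by simp
  also have "\<dots> = of_real ((cmod (of_real (exp x) - ?a))\<^sup>2 * (2 * Im ?a)) * \<i>"
    unfolding complex_norm_square[symmetric] complex_diff_cnj by simp
  finally have "rho0 (of_real x ^ 3) = - of_real (((cmod (of_real (exp x) - ?a))\<^sup>2 * (2 * Im ?a))\<^sup>2)"
    unfolding rho0_cube by (simp add: power_mult_distrib)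
  then obtain y where y: "rho0 (of_real x ^ 3) = - of_real y" "0 \<le> y" by (metis zero_le_power2)
  have "cmod (rho p q (of_real x ^ 3) - rho0 (of_real x ^ 3)) < y"
    using near_freeD(3)[OF p g] y by simp
  then have "Re (rho p q (of_real x ^ 3) - rho0 (of_real x ^ 3)) < y"
    using complex_Re_le_cmod[of "rho p q (of_real x ^ 3) - rho0 (of_real x ^ 3)"] by linarith
  then show ?thesis using y by simp
qed

lemma zero_mset_single:
  "zeros_in f S = {a} \<Longrightarrow> zorder f a = 2 \<Longrightarrow> zero_mset f S = {#a, a#}"
  by (simp add: zero_mset_def numeral_2_eq_2)

lemma zero_mset_pair:
  "zeros_in f S = {a, b} \<Longrightarrow> a \<noteq> b \<Longrightarrow> zorder f a = 1 \<Longrightarrow> zorder f b = 1 \<Longrightarrow> zero_mset f S = {#a, b#}"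
  by (simp add: zero_mset_def)

text \<open>The eigenvalue is real because it is the only one in a disc invariant under conjugation;
  the reality of the zeros of \<open>rho\<close> rests on the count of two.\<close>

lemma positive_index:
  assumes p: "near_free p q" and n: "1 \<le> n"
  obtains rm rp mu :: real where
    "zero_mset (rho p q) (Dn n) = {#complex_of_real rm, complex_of_real rp#}" "rm \<le> rp"
    "{lam \<in> Dn n. dir_eigenvalue p q lam} = {complex_of_real mu}"
    "dir_simple p q (complex_of_real mu)" "rm \<le> mu" "mu \<le> rp"
proof -
  note result = that
  note sp = near_freeD(2)[OF p]
  obtain mu where mu: "{lam \<in> Dn n. dir_det p q lam = 0} = {mu}" "deriv (dir_det p q) mu \<noteq> 0"
    using dir_det_count[OF p n] by blast
  have muD: "mu \<in> Dn n" "dir_det p q mu = 0" using mu(1) by auto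
  have "cnj mu \<in> {lam \<in> Dn n. dir_det p q lam = 0}"
    using cnj_Dn[OF n muD(1)] muD(2) by (simp add: dir_det_cnj[OF sp])
  then have mur: "cnj mu = mu" using mu(1) by auto
  obtain x where x: "mu = of_real x ^ 3" "ctr n - 2 / sqrt 3 < x" "x < ctr n + 2 / sqrt 3" "2.3 \<le> x"
    using real_in_Dn[OF n muD(1) mur] by blast
  define h where "h = (\<lambda>y. Re (rho p q (of_real y ^ 3)))"
  have hrho: "rho p q (of_real y ^ 3) = of_real (h y)" for y
    using rho_of_real[OF sp, of "y ^ 3"] by (simp add: h_def)
  have hx: "0 \<le> h x"
    unfolding h_def using dir_det_simple_zero_imp_entries[OF sp mu(2)] muD(2) x
    by (intro rho_nonneg_at_eigenvalue[OF near_freeD(1)[OF p]]) auto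
  have hcont: "isCont h y" for y
  proof -
    have "isCont (rho p q) w" for w
      using holomorphic_on_imp_continuous_on[OF rho_holomorphic[OF sp, of UNIV]] continuous_on_eq_continuous_at by blast
    from isCont_o2[OF _ this, of y "\<lambda>y. complex_of_real y ^ 3"]
    have "isCont (\<lambda>y. rho p q (of_real y ^ 3)) y" by (simp add: continuous_intros)
    then show ?thesis unfolding h_def by (rule isCont_Re)
  qed
  have ev: "{lam \<in> Dn n. dir_eigenvalue p q lam} = {complex_of_real (x ^ 3)}"
    using mu(1) x(1) by (simp add: dir_eigenvalue_iff[OF sp])
  have simp: "dir_simple p q (complex_of_real (x ^ 3))"
    using dir_det_simple_zero_imp_dir_simple[OF sp muD(2) mu(2)] x(1) by simp
  obtain w where w: "rho p q w \<noteq> 0" using near_free_nonzero[OF p] by blast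
  let ?Z = "zeros_in (rho p q) (Dn n)"
  have pos: "zorder (rho p q) lam > 0" if "lam \<in> ?Z" for lam
    using entire_zorder_pos[OF rho_holomorphic[OF sp] w] that by (simp add: zeros_in_def)
  have inZ: "of_real y ^ 3 \<in> ?Z" if "ctr n - 2 / sqrt 3 < y" "y < ctr n + 2 / sqrt 3" "h y = 0" for y
    using of_real_cube_in_Dn[OF n that(1,2)] hrho[of y] that(3) by (simp add: zeros_in_def)
  have cnjZ: "cnj lam \<in> ?Z" if "lam \<in> ?Z" for lam
    using that cnj_Dn[OF n] by (simp add: zeros_in_def rho_cnj[OF sp])
  have real_eq: "lam = of_real (Re lam)" if "cnj lam = lam" for lam
    using that by (simp add: complex_eq_iff)
  show ?thesis
  \<comment> \<open>If \<open>mu\<close> is itself a zero of \<open>rho\<close>, a second distinct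
    zero must be real since zeros come in conjugate pairs. Otherwise \<open>rho\<close> changes sign
    on either side of \<open>mu\<close>, and the two zeros found exhaust the count.\<close>
  proof (cases "h x = 0")
    case True
    then have muZ: "mu \<in> ?Z" using inZ[OF x(2,3)] x(1) by simp
    from rho_count(2)[OF p n] pos rho_count(1)[OF p n] show ?thesis
    proof (rule sum_pos_eq_2)
      fix a assume a: "?Z = {a}" "zorder (rho p q) a = 2"
      then have "a = mu" using muZ by auto
      then show ?thesis
        using result[of "x ^ 3" "x ^ 3" "x ^ 3"] zero_mset_single[OF a] ev simp x(1) by simp
    next
      fix a b assume ab: "?Z = {a, b}" "a \<noteq> b" "zorder (rho p q) a = 1" "zorder (rho p q) b = 1"
      have pair: ?thesis if v: "?Z = {mu, v}" "mu \<noteq> v" "zero_mset (rho p q) (Dn n) = {#mu, v#}" for v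
      proof -
        have "cnj v \<in> {mu, v}" using cnjZ[of v] v(1) by auto
        then have vr: "v = of_real (Re v)" using mur v(2) by (metis complex_cnj_cnj insertE real_eq singletonD)
        have m: "zero_mset (rho p q) (Dn n) = {#complex_of_real (x ^ 3), of_real (Re v)#}"
          using v(3) vr x(1) by simp
        show ?thesis
        proof (cases "x ^ 3 \<le> Re v")
          case True
          then show ?thesis using result[of "x ^ 3" "Re v" "x ^ 3"] m ev simp by simp
        next
          case False
          then show ?thesis using result[of "Re v" "x ^ 3" "x ^ 3"] m ev simp by (simp add: add_mset_commute)
        qed
      qed
      show ?thesis
      proof (cases "mu = a")
        case True
        then show ?thesis using pair[of b] ab zero_mset_pair[OF ab] by simp
      next
        case False
        then have "mu = b" using muZ ab(1) by auto
        then show ?thesis using pair[of a] ab zero_mset_pair[OF ab] by (simp add: insert_commute add_mset_commute)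
      qed
    qed
  next
    case False
    then have hx: "0 < h x" using hx by simp
    have hl: "h (ctr n - 2 / sqrt 3) < 0" "h (ctr n + 2 / sqrt 3) < 0"
      unfolding h_def by (rule rho_negative_on_circle[OF p n]; simp)+
    obtain y1 where y1: "ctr n - 2 / sqrt 3 \<le> y1" "y1 \<le> x" "h y1 = 0"
      using IVT[of h "ctr n - 2 / sqrt 3" 0 x] hl(1) hx x(2) hcont by auto
    obtain y2 where y2: "x \<le> y2" "y2 \<le> ctr n + 2 / sqrt 3" "h y2 = 0"
      using IVT2[of h "ctr n + 2 / sqrt 3" 0 x] hl(2) hx x(3) hcont by auto
    have s: "ctr n - 2 / sqrt 3 < y1" "y1 < x" "x < y2" "y2 < ctr n + 2 / sqrt 3"
      using y1 y2 hl hx by (auto simp: less_le)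
    have "cmod (of_real y1 - of_real (ctr n)) \<le> 2 / sqrt 3"
      using s x(3) by (simp only: norm_of_real flip: of_real_diff)
    then have "2.3 \<le> y1" using cball_ctr(1)[OF n, of "of_real y1"] by simp
    then have c: "y1 ^ 3 < x ^ 3" "x ^ 3 < y2 ^ 3"
      using s by (auto intro!: power_strict_mono)
    have Z: "complex_of_real (y1 ^ 3) \<in> ?Z" "complex_of_real (y2 ^ 3) \<in> ?Z"
      using inZ[of y1] inZ[of y2] s x(2,3) y1(3) y2(3) by auto
    have ne: "complex_of_real (y1 ^ 3) \<noteq> complex_of_real (y2 ^ 3)"
      unfolding of_real_eq_iff using c by linarith
    have "zero_mset (rho p q) (Dn n) = {#complex_of_real (y1 ^ 3), complex_of_real (y2 ^ 3)#}" (is ?M)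
      using rho_count(2)[OF p n] pos rho_count(1)[OF p n]
    proof (rule sum_pos_eq_2)
      fix a assume "?Z = {a}"
      then show ?M using Z ne by auto
    next
      fix a b assume ab: "?Z = {a, b}" "a \<noteq> b" "zorder (rho p q) a = 1" "zorder (rho p q) b = 1"
      then have "(a = complex_of_real (y1 ^ 3) \<and> b = complex_of_real (y2 ^ 3)) \<or> (b = complex_of_real (y1 ^ 3) \<and> a = complex_of_real (y2 ^ 3))"
        using Z ne by auto
      then show ?M using zero_mset_pair[OF ab] by (auto simp: add_mset_commute)
    qed
    then show ?thesis using result[of "y1 ^ 3" "y2 ^ 3" "x ^ 3"] c ev simp by simp
  qed
qed

section \<open>Transfer to negative indices\<close>

lemma image_mset_sum_mset: "image_mset h (\<Sum>x\<in>A. F x) = (\<Sum>x\<in>A. image_mset h (F x))"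
  by (induction A rule: infinite_finite_induct) auto

lemma zero_mset_uminus:
  assumes g: "g holomorphic_on UNIV" "g w \<noteq> 0" and f: "\<And>z. f z = g (- z)"
  shows "zero_mset f (uminus ` S) = image_mset uminus (zero_mset g S)"
proof -
  have Z: "zeros_in f (uminus ` S) = uminus ` zeros_in g S"
    by (auto simp: zeros_in_def f)
  have zo: "zorder f (- z) = zorder g z" for z
  proof -
    have "zorder (\<lambda>u. g (- 1 * u)) (- z) = zorder g (- 1 * - z)"
    proof (rule Laurent_Convergence.zorder_scale)
      show "g analytic_on {- 1 * - z}" using g(1) analytic_on_holomorphic by blast
      show "\<forall>\<^sub>F u in at (- 1 * - z). g u \<noteq> 0" by (rule entire_eventually_nonzero[OF g])
    qed simp
    then show ?thesis using f by (simp add: f[abs_def] ext[OF f])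
  qed
  show ?thesis
    unfolding zero_mset_def Z image_mset_sum_mset
    by (subst sum.reindex) (auto simp: zo inj_on_def)
qed

lemma dir_eigenvalue_uminus_image:
  assumes "smallpot p q"
  shows "{lam \<in> uminus ` S. dir_eigenvalue p q lam}
     = uminus ` {lam \<in> S. dir_eigenvalue (\<lambda>x. p (1 - x)) (\<lambda>x. - q (1 - x)) lam}"
proof -
  have e: "dir_eigenvalue p q (- lam) \<longleftrightarrow> dir_eigenvalue (\<lambda>x. p (1 - x)) (\<lambda>x. - q (1 - x)) lam" for lam
    using dir_eigenvalue_reflect[OF assms, of "- lam"] by simp
  have "{lam \<in> uminus ` S. dir_eigenvalue p q lam} = uminus ` {lam \<in> S. dir_eigenvalue p q (- lam)}"
    by blast
  then show ?thesis unfolding e .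
qed

text \<open>For negative \<open>n\<close> the result for the reflected potentials at index
  \<open>- n\<close> is negated, which exchanges the roles of \<open>rm\<close> and
  \<open>rp\<close>.\<close>

lemma nonzero_index:
  assumes p: "near_free p q" and pr: "near_free (\<lambda>x. p (1 - x)) (\<lambda>x. - q (1 - x))" and n: "n \<noteq> 0"
  shows "finite (zeros_in (rho p q) (Dn n))"
    "\<exists>rm rp mu :: real. zero_mset (rho p q) (Dn n) = {#complex_of_real rm, complex_of_real rp#} \<and> rm \<le> rp \<and>
       {lam \<in> Dn n. dir_eigenvalue p q lam} = {complex_of_real mu} \<and>
       dir_simple p q (complex_of_real mu) \<and> rm \<le> mu \<and> mu \<le> rp"
proof -
  note sp = near_freeD(2)[OF p]
  let ?pr = "\<lambda>x. p (1 - x)" and ?qr = "\<lambda>x. - q (1 - x)"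
  have "finite (zeros_in (rho p q) (Dn n)) \<and> (\<exists>rm rp mu :: real. zero_mset (rho p q) (Dn n) = {#complex_of_real rm, complex_of_real rp#} \<and> rm \<le> rp \<and>
       {lam \<in> Dn n. dir_eigenvalue p q lam} = {complex_of_real mu} \<and>
       dir_simple p q (complex_of_real mu) \<and> rm \<le> mu \<and> mu \<le> rp)"
  proof (cases "1 \<le> n")
    case True
    obtain rm rp mu :: real where
      "zero_mset (rho p q) (Dn n) = {#complex_of_real rm, complex_of_real rp#}" "rm \<le> rp"
      "{lam \<in> Dn n. dir_eigenvalue p q lam} = {complex_of_real mu}"
      "dir_simple p q (complex_of_real mu)" "rm \<le> mu" "mu \<le> rp"
      by (rule positive_index[OF p True]) (rule that)
    then show ?thesis using rho_count(2)[OF p True] by blast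
  next
    case False
    then have m: "1 \<le> - n" using n by simp
    have D: "Dn n = uminus ` Dn (- n)" using Dn_uminus[of "- n"] n by simp
    have rr: "rho p q z = rho ?pr ?qr (- z)" for z using rho_reflect(1)[OF sp, of z] by simp
    obtain rm rp mu :: real where *: "zero_mset (rho ?pr ?qr) (Dn (- n)) = {#complex_of_real rm, complex_of_real rp#}" "rm \<le> rp"
      "{lam \<in> Dn (- n). dir_eigenvalue ?pr ?qr lam} = {complex_of_real mu}"
      "dir_simple ?pr ?qr (complex_of_real mu)" "rm \<le> mu" "mu \<le> rp"
      by (rule positive_index[OF pr m]) (rule that)
    obtain w where w: "rho ?pr ?qr w \<noteq> 0" using near_free_nonzero[OF pr] by blast
    have 1: "zero_mset (rho p q) (Dn n) = {#complex_of_real (- rp), complex_of_real (- rm)#}"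
      unfolding D zero_mset_uminus[OF rho_holomorphic[OF near_freeD(2)[OF pr]] w rr] *(1) by (simp add: add_mset_commute)
    have "{lam \<in> Dn n. dir_eigenvalue p q lam} = uminus ` {lam \<in> Dn (- n). dir_eigenvalue ?pr ?qr lam}"
      unfolding D by (rule dir_eigenvalue_uminus_image[OF sp])
    then have 2: "{lam \<in> Dn n. dir_eigenvalue p q lam} = {complex_of_real (- mu)}"
      unfolding *(3) by simp
    have 3: "dir_simple p q (complex_of_real (- mu))"
      using dir_simple_reflect[OF near_freeD(2)[OF pr] *(4)] by simp
    have "zeros_in (rho p q) (Dn n) = uminus ` zeros_in (rho ?pr ?qr) (Dn (- n))"
      unfolding D zeros_in_def by (auto simp: rr)
    then have 4: "finite (zeros_in (rho p q) (Dn n))" using rho_count(2)[OF pr m] by simp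
    show ?thesis
      using 1 2 3 4 *(2,5,6) by (intro conjI exI[of _ "- rp"] exI[of _ "- rm"] exI[of _ "- mu"]) auto
  qed
  then show "finite (zeros_in (rho p q) (Dn n))"
    "\<exists>rm rp mu :: real. zero_mset (rho p q) (Dn n) = {#complex_of_real rm, complex_of_real rp#} \<and> rm \<le> rp \<and>
       {lam \<in> Dn n. dir_eigenvalue p q lam} = {complex_of_real mu} \<and>
       dir_simple p q (complex_of_real mu) \<and> rm \<le> mu \<and> mu \<le> rp" by blast+
qed

section \<open>From the energy ball to bounds on the potentials\<close>

lemma L2_bound_imp_L1_bound:
  fixes f :: "real \<Rightarrow> real"
  assumes d: "0 < d" and f: "f integrable_on {0..1}" "(\<lambda>x. (f x)\<^sup>2) integrable_on {0..1}" "integral {0..1} (\<lambda>x. (f x)\<^sup>2) \<le> d\<^sup>2"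
  shows "f absolutely_integrable_on {0..1}" "integral {0..1} (\<lambda>x. \<bar>f x\<bar>) \<le> d"
proof -
  have gi: "((\<lambda>x. d / 2 + 1 / (2 * d) * (f x)\<^sup>2) has_integral (1 - 0) * (d / 2) + 1 / (2 * d) * integral {0..1} (\<lambda>x. (f x)\<^sup>2)) {0..1}"
    using has_integral_const_real[of "d / 2" 0 "1::real"] f(2)
    by (intro has_integral_add has_integral_mult_right) auto
  \<comment> \<open>Young's inequality instead of Cauchy-Schwarz; for a mean square of at most
    \<open>d^2\<close> the two halves add up to exactly \<open>d\<close>.\<close>
  have bd: "\<bar>f x\<bar> \<le> d / 2 + 1 / (2 * d) * (f x)\<^sup>2" for x
  proof -
    have "0 \<le> (\<bar>f x\<bar> - d)\<^sup>2" by simp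
    then have "2 * d * \<bar>f x\<bar> \<le> d\<^sup>2 + (f x)\<^sup>2" by (simp add: power2_eq_square algebra_simps)
    then show ?thesis using d by (simp add: field_simps power2_eq_square)
  qed
  show 1: "f absolutely_integrable_on {0..1}"
    by (rule measurable_bounded_by_integrable_imp_absolutely_integrable[OF _ _ has_integral_integrable[OF gi]])
      (use bd f(1) integrable_imp_measurable in auto)
  have "integral {0..1} (\<lambda>x. \<bar>f x\<bar>) \<le> integral {0..1} (\<lambda>x. d / 2 + 1 / (2 * d) * (f x)\<^sup>2)"
    using 1 bd has_integral_integrable[OF gi] by (intro integral_le) (auto simp: absolutely_integrable_on_def)
  also have "\<dots> = d / 2 + 1 / (2 * d) * integral {0..1} (\<lambda>x. (f x)\<^sup>2)"
    using integral_unique[OF gi] by simp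
  also have "\<dots> \<le> d / 2 + 1 / (2 * d) * d\<^sup>2"
    using f(3) d by (intro add_left_mono mult_left_mono) auto
  also have "\<dots> = d" using d by (simp add: power2_eq_square)
  finally show "integral {0..1} (\<lambda>x. \<bar>f x\<bar>) \<le> d" .
qed

lemma periodic1_frac:
  assumes "periodic1 p"
  shows "p (frac x) = p x"
proof -
  have n: "p (y + real k) = p y" for y k
  proof (induction k)
    case (Suc k)
    then show ?case using assms unfolding periodic1_def by (metis add.assoc of_nat_Suc add.commute)
  qed simp
  have "p (y + of_int k) = p y" for y and k :: int
  proof (cases "0 \<le> k")
    case True
    then show ?thesis using n[of y "nat k"] by simp
  next
    case False
    then show ?thesis using n[of "y + of_int k" "nat (- k)"] by simp
  qed
  from this[of "frac x" "\<lfloor>x\<rfloor>"] show ?thesis by (simp add: frac_def)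
qed

lemma in_Beps_imp_pot:
  assumes d: "0 < d" and B: "in_Beps (d\<^sup>2) p q"
  shows "pot d p q"
proof -
  obtain dp where dp: "weak_deriv p dp" "in_calH dp" and I: "integral {0..1} (\<lambda>x. (dp x)\<^sup>2 + (q x)\<^sup>2) < d\<^sup>2"
    and pq: "in_calH p" "in_calH q"
    using B unfolding in_Beps_def in_frakH_def in_calH1_def by blast
  have i: "dp integrable_on {0..1}" "(\<lambda>x. (dp x)\<^sup>2) integrable_on {0..1}" "q integrable_on {0..1}" "(\<lambda>x. (q x)\<^sup>2) integrable_on {0..1}"
    "periodic1 p" "periodic1 q" "p integrable_on {0..1}" "integral {0..1} p = 0"
    using dp(2) pq unfolding in_calH_def by auto
  have nn: "0 \<le> integral {0..1} (\<lambda>x. (dp x)\<^sup>2)" "0 \<le> integral {0..1} (\<lambda>x. (q x)\<^sup>2)"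
    using i by (auto intro!: integral_nonneg)
  have I2: "integral {0..1} (\<lambda>x. (dp x)\<^sup>2) \<le> d\<^sup>2" "integral {0..1} (\<lambda>x. (q x)\<^sup>2) \<le> d\<^sup>2"
    using I nn unfolding integral_add[OF i(2) i(4)] by linarith+
  note q1 = L2_bound_imp_L1_bound[OF d i(3,4) I2(2)] and p1 = L2_bound_imp_L1_bound[OF d i(1,2) I2(1)]
  have w: "(dp has_integral (p b - p a)) {a..b}" if "a \<le> b" for a b
    using dp(1) that unfolding weak_deriv_def by blast
  have "continuous_on UNIV p"
  proof (rule continuous_at_imp_continuous_on, rule ballI)
    fix x :: real
    have "continuous_on {x - 1..x + 1} (\<lambda>t. p (x - 1) + integral {x - 1..t} dp)"
      using w[of "x - 1" "x + 1"] by (intro continuous_intros indefinite_integral_continuous_1) auto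
    then have "continuous_on {x - 1..x + 1} p"
    proof (rule continuous_on_eq)
      show "p (x - 1) + integral {x - 1..t} dp = p t" if "t \<in> {x - 1..x + 1}" for t
        using integral_unique[OF w[of "x - 1" t]] that by simp
    qed
    then show "isCont p x"
      by (rule continuous_on_interior) simp
  qed
  moreover have "\<bar>p x\<bar> \<le> d" for x
  proof -
    define A where "A = integral {0..1} (\<lambda>x. \<bar>dp x\<bar>)"
    have diff: "\<bar>p v - p u\<bar> \<le> A" if "0 \<le> u" "u \<le> v" "v \<le> 1" for u v
    proof -
      have ab: "(\<lambda>x. \<bar>dp x\<bar>) integrable_on {0..1}" using p1(1) by (simp add: absolutely_integrable_on_def)
      then have abu: "(\<lambda>x. \<bar>dp x\<bar>) integrable_on {u..v}"
        by (rule integrable_subinterval_real) (use that in auto)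
      have "\<bar>integral {u..v} dp\<bar> \<le> integral {u..v} (\<lambda>x. \<bar>dp x\<bar>)"
        using integral_norm_bound_integral[OF has_integral_integrable[OF w[OF that(2)]] abu] by simp
      also have "\<dots> \<le> A"
        unfolding A_def by (rule integral_subset_le) (use that ab abu in auto)
      finally show ?thesis using integral_unique[OF w[OF that(2)]] by simp
    qed
    have diff': "\<bar>p v - p u\<bar> \<le> A" if "u \<in> {0..1}" "v \<in> {0..1}" for u v
      using diff[of u v] diff[of v u] that by (cases "u \<le> v") (auto simp: abs_minus_commute)
    define y where "y = frac x"
    have y: "y \<in> {0..1}" using frac_lt_1[of x] by (auto simp: y_def)
    \<comment> \<open>As \<open>p\<close> has mean zero, \<open>p y\<close> is the average over
      \<open>t\<close> of \<open>p y - p t\<close>, and each such difference is at most the L1 norm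
      of \<open>dp\<close>.\<close>
    have ci: "((\<lambda>t. p y - p t) has_integral (1 - 0) * p y - 0) {0..1}"
      using has_integral_const_real[of "p y" 0 "1::real"] i(7,8)
      by (intro has_integral_diff) (auto simp: has_integral_iff)
    have cA: "((\<lambda>t. A) has_integral A) {0..1::real}"
      using has_integral_const_real[of A 0 "1::real"] by simp
    have "\<bar>p y\<bar> \<le> A"
      using integral_norm_bound_integral[OF has_integral_integrable[OF ci] has_integral_integrable[OF cA]] diff' y
      unfolding integral_unique[OF ci] integral_unique[OF cA] by simp
    then show ?thesis
      using p1(2) periodic1_frac[OF i(5), of x] by (simp add: A_def y_def)
  qed
  ultimately show ?thesis
    unfolding pot_def using q1 i(5,6) unfolding periodic1_def by auto
qed

lemma size_zero_mset:
  assumes "finite (zeros_in f S)" "\<And>z. z \<in> zeros_in f S \<Longrightarrow> zorder f z \<ge> 0"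
  shows "int (size (zero_mset f S)) = (\<Sum>z\<in>zeros_in f S. zorder f z)"
proof -
  have "size (\<Sum>z\<in>A. replicate_mset (nat (zorder f z)) z) = (\<Sum>z\<in>A. nat (zorder f z))" for A
    by (induction A rule: infinite_finite_induct) auto
  then show ?thesis unfolding zero_mset_def using assms by simp
qed

text \<open>The relations among the \<open>r_n\<close> are equalities of multisets: negation
  reverses a sorted pair, which accounts for the exchanged signs. \<open>in_Beps\<close> bounds a
  squared norm, hence the choice \<open>eps = d^2\<close>.\<close>

theorem theorem2:
  shows "\<exists>eps>0. \<forall>p q. in_Beps eps p q \<longrightarrow>
    (\<forall>n::int. n \<noteq> 0 \<longrightarrow>
       finite (zeros_in (rho p q) (Dn n)) \<and>
       (\<exists>rm rp mu :: real.
          zero_mset (rho p q) (Dn n) = {#complex_of_real rm, complex_of_real rp#} \<and> rm \<le> rp \<and>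
          {lam \<in> Dn n. dir_eigenvalue p q lam} = {complex_of_real mu} \<and>
          dir_simple p q (complex_of_real mu) \<and> rm \<le> mu \<and> mu \<le> rp) \<and>
       zero_mset (rho (\<lambda>x. p (1 - x)) (\<lambda>x. q (1 - x))) (Dn n) = zero_mset (rho p q) (Dn n) \<and>
       zero_mset (rho p (\<lambda>x. - q x)) (Dn (- n)) = image_mset uminus (zero_mset (rho p q) (Dn n)) \<and>
       zero_mset (rho (\<lambda>x. p (1 - x)) (\<lambda>x. - q (1 - x))) (Dn (- n))
          = image_mset uminus (zero_mset (rho p q) (Dn n)) \<and>
       {lam \<in> Dn (- n). dir_eigenvalue p q lam}
          = uminus ` {lam \<in> Dn n. dir_eigenvalue (\<lambda>x. p (1 - x)) (\<lambda>x. - q (1 - x)) lam}) \<and>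
    finite (zeros_in (rho p q) (Dn 0)) \<and> size (zero_mset (rho p q) (Dn 0)) = 2 \<and>
    (\<forall>lam. dir_eigenvalue p q lam \<longrightarrow> (\<exists>n. n \<noteq> 0 \<and> lam \<in> Dn n)) \<and>
    (\<forall>lam. rho p q lam = 0 \<longrightarrow> (\<exists>n. lam \<in> Dn n))"
proof -
  obtain d where d: "0 < d" "d \<le> 1/50000" "\<And>p q. pot d p q \<Longrightarrow>
     (\<forall>z. separated z \<longrightarrow> cmod (rho p q (z ^ 3) - rho0 (z ^ 3)) < cmod (rho0 (z ^ 3)) \<and>
        cmod (dir_det p q (z ^ 3) - dir_det0 (z ^ 3)) < cmod (dir_det0 (z ^ 3))) \<and>
     (\<forall>lam. cmod lam \<le> (2 / sqrt 3) ^ 3 \<longrightarrow> cmod (dir_det p q lam - dir_det0 lam) < cmod (dir_det0 lam))"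
    using perturbation_bounds by blast
  have near_free: "near_free p q" if "pot d p q" for p q
    unfolding near_free_def using d(3)[OF that] pot_mono[OF that d(2)] by blast
  show ?thesis
  proof (rule exI[of _ "d\<^sup>2"], intro conjI allI impI)
    show "0 < d\<^sup>2" using d(1) by simp
    fix p q assume B: "in_Beps (d\<^sup>2) p q"
    have pd: "pot d p q" by (rule in_Beps_imp_pot[OF d(1) B])
    have p: "near_free p q" and pr: "near_free (\<lambda>x. p (1 - x)) (\<lambda>x. - q (1 - x))"
      using near_free[OF pd] near_free[OF pot_reflect_adjoint[OF pd]] .
    note sp = near_freeD(2)[OF p]
    obtain w where w: "rho p q w \<noteq> 0" using near_free_nonzero[OF p] by blast
    note hol = rho_holomorphic[OF sp, of UNIV]
    {
      fix n :: int assume n: "n \<noteq> 0"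
      show "finite (zeros_in (rho p q) (Dn n))" by (rule nonzero_index(1)[OF p pr n])
      show "\<exists>rm rp mu :: real.
          zero_mset (rho p q) (Dn n) = {#complex_of_real rm, complex_of_real rp#} \<and> rm \<le> rp \<and>
          {lam \<in> Dn n. dir_eigenvalue p q lam} = {complex_of_real mu} \<and>
          dir_simple p q (complex_of_real mu) \<and> rm \<le> mu \<and> mu \<le> rp"
        by (rule nonzero_index(2)[OF p pr n])
      have "rho (\<lambda>x. p (1 - x)) (\<lambda>x. q (1 - x)) = rho p q"
        using rho_reflect(2)[OF sp] by auto
      then show "zero_mset (rho (\<lambda>x. p (1 - x)) (\<lambda>x. q (1 - x))) (Dn n) = zero_mset (rho p q) (Dn n)"
        by simp
      have a: "rho p (\<lambda>x. - q x) z = rho p q (- z)" for z using rho_adjoint[OF sp, of "- z"] by simp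
      have b: "rho (\<lambda>x. p (1 - x)) (\<lambda>x. - q (1 - x)) z = rho p q (- z)" for z using rho_reflect(1)[OF sp, of "- z"] by simp
      show "zero_mset (rho p (\<lambda>x. - q x)) (Dn (- n)) = image_mset uminus (zero_mset (rho p q) (Dn n))"
        unfolding Dn_uminus[OF n] by (rule zero_mset_uminus[OF hol w a])
      show "zero_mset (rho (\<lambda>x. p (1 - x)) (\<lambda>x. - q (1 - x))) (Dn (- n)) = image_mset uminus (zero_mset (rho p q) (Dn n))"
        unfolding Dn_uminus[OF n] by (rule zero_mset_uminus[OF hol w b])
      show "{lam \<in> Dn (- n). dir_eigenvalue p q lam}
          = uminus ` {lam \<in> Dn n. dir_eigenvalue (\<lambda>x. p (1 - x)) (\<lambda>x. - q (1 - x)) lam}"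
        unfolding Dn_uminus[OF n] by (rule dir_eigenvalue_uminus_image[OF sp])
    }
    show f0: "finite (zeros_in (rho p q) (Dn 0))" by (rule rho_count_0(2)[OF p])
    have "int (size (zero_mset (rho p q) (Dn 0))) = 2"
      unfolding rho_count_0(1)[OF p, symmetric]
      using entire_zorder_pos[OF hol w] by (intro size_zero_mset f0) (auto simp: zeros_in_def intro: less_imp_le)
    then show "size (zero_mset (rho p q) (Dn 0)) = 2" by simp
    {
      fix lam assume "dir_eigenvalue p q lam"
      then have D: "dir_det p q lam = 0" by (simp add: dir_eigenvalue_iff[OF sp])
      show "\<exists>n. n \<noteq> 0 \<and> lam \<in> Dn n"
      proof (rule ccontr)
        assume no: "\<not> ?thesis"
        have "lam \<notin> Dn 0"
        proof
          assume "lam \<in> Dn 0"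
          then have "cmod lam \<le> (2 / sqrt 3) ^ 3" by (simp add: Dn_0)
          from near_freeD(5)[OF p this] show False using D by simp
        qed
        with no have "lam \<notin> Dn n" for n by (cases "n = 0") auto
        from near_free_outside(2)[OF p separated_outside[OF this]] show False using D by (simp add: cbrt_cube)
      qed
    }
    fix lam assume r: "rho p q lam = 0"
    show "\<exists>n. lam \<in> Dn n"
    proof (rule ccontr)
      assume "\<not> ?thesis"
      then have "lam \<notin> Dn n" for n by blast
      from near_free_outside(1)[OF p separated_outside[OF this]] show False using r by (simp add: cbrt_cube)
    qed
  qed
qed

end
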